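(* Let $q_{ij}, b_i:\mathbb{R}^{1+d}\to\mathbb{R}$ ($i,j=1,\dots,d$) satisfy the following assumptions. (i) $q_{ij}, b_i\in C^{\alpha/2,\alpha}_{loc}(\mathbb{R}^{1+d})$ for some $\alpha\in(0,1)$. (ii) For every $(s,x)\in\mathbb{R}^{1+d}$ the matrix $Q(s,x)=(q_{ij}(s,x))$ is symmetric, and there is a function $\eta:\mathbb{R}^{1+d}\to\mathbb{R}$ with $\inf_{\mathbb{R}^{1+d}}\eta>0$ such that $\langle Q(s,x)\xi,\xi\rangle\ge\eta(s,x)|\xi|^2$ for all $\xi\in\mathbb{R}^d$, $(s,x)\in\mathbb{R}^{1+d}$. (iii) There exist a positive function $W_0\in C^2(\mathbb{R}^d)$ and $\lambda\in\mathbb{R}$ such that $\lim_{|x|\to\infty}W_0(x)=\infty$ and $\sup_{s\in\mathbb{R},\,x\in\mathbb{R}^d}\big((\mathcal{A}(s)W_0)(x)-\lambda W_0(x)\big)<0$. Assume in addition that there exist a $C^2$ function $W:\mathbb{R}^d\to\mathbb{R}$ such that $\lim_{|x|\to\infty}W(x)=+\infty$, a number $R>0$, and a convex increasing function $g:[0,+\infty)\to\mathbb{R}$ such that $1/g\in L^1(a,+\infty)$ for large $a$, and $$(\mathcal{A}(s)W)(x)\le -g(W(x)),\qquad s\in\mathbb{R},\ |x|\ge R.$$ Then for every $\delta>0$ there is $C=C(\delta)>0$ such that $$(G(t,s)W)(x):=\int_{\mathbb{R}^d}W(y)\,p_{t,s,x}(dy)\le C\qquad\text{for every } x\in\mathbb{R}^d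 \text{ and all } s,t\in\mathbb{R} \text{ with } s\le t-\delta.$$ Consequently, for every $\delta>0$ the family of probability measures $\{p_{t,s,x}: s\le t-\delta,\ x\in\mathbb{R}^d\}$ is tight, and $G(t,s)$ is compact in $C_b(\mathbb{R}^d)$ for all $t>s$.
   Context: $C_b(\mathbb{R}^d)$ is the space of bounded continuous functions $\mathbb{R}^d\to\mathbb{R}$ with the sup norm. For $0<\alpha<1$, $C^{\alpha/2,\alpha}_{loc}(\mathbb{R}^{1+d})$ is the space of continuous functions on $\mathbb{R}^{1+d}$ (variables $(s,x)\in\mathbb{R}\times\mathbb{R}^d$) whose restriction to $[a,b]\times B(0,\rho)$ belongs to the usual parabolic Hölder space $C^{\alpha/2,\alpha}([a,b]\times B(0,\rho))$ ($\alpha/2$-Hölder in time, $\alpha$-Hölder in space) for every $a<b$, $\rho>0$. The coefficients are allowed to be unbounded. For $s\in\mathbb{R}$ and $\varphi\in C^2(\mathbb{R}^d)$, $$(\mathcal{A}(s)\varphi)(x)=\sum_{i,j=1}^d q_{ij}(s,x)D_{ij}\varphi(x)+\sum_{i=1}^d b_i(s,x)D_i\varphi(x).$$ Evolution operator. Under assumptions (i)-(iii) of the claim it is known that for every $s\in\mathbb{R}$, $\varphi\in C_b(\mathbb{R}^d)$ there is a unique bounded classical solution $u$ (bounded, continuous on $[s,\infty)\times\mathbb{R}^d$, $C^1$ in time and $C^2$ in space for $t>s$) of $D_tu(t,x)=(\mathcal{A}(t)u(t,\cdot))(x)$ for $t>s$, $x\in\mathbb{R}^d$, $u(s,x)=\varphi(x)$.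 One sets $G(t,s)\varphi:=u(t,\cdot)$, $t\ge s$. It is also known that for every $t>s$, $x\in\mathbb{R}^d$ there is a unique Borel probability measure $p_{t,s,x}$ on $\mathbb{R}^d$ such that $(G(t,s)\varphi)(x)=\int_{\mathbb{R}^d}\varphi(y)\,p_{t,s,x}(dy)$ for all $\varphi\in C_b(\mathbb{R}^d)$, and $p_{t,s,x}$ has a positive density with respect to Lebesgue measure. The function $W$ of the additional assumption is continuous and tends to $+\infty$ at infinity, hence is bounded below, so the integral defining $(G(t,s)W)(x)$ makes sense in $(-\infty,+\infty]$. Since $g$ is defined on $[0,+\infty)$, the displayed inequality for $|x|\ge R$ presupposes $W(x)\ge 0$ for those $x$ only; no sign is imposed on $W$ for $|x|<R$. A family $\mathcal P$ of Borel probability measures on $\mathbb{R}^d$ is tight if for every $\varepsilon>0$ there is $\rho>0$ with $p(B(0,\rho))\ge1-\varepsilon$ for all $p\in\mathcal P$. *)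

theory Defs
  imports "HOL-Analysis.Analysis" "HOL-Probability.Probability_Measure"
begin

section \<open>Function spaces\<close>

definition partial :: "'n::finite \<Rightarrow> (real ^ 'n \<Rightarrow> real) \<Rightarrow> real ^ 'n \<Rightarrow> real" where
  "partial i f x = frechet_derivative f (at x) (axis i 1)"

definition C1_fun :: "(real ^ 'n::finite \<Rightarrow> real) \<Rightarrow> bool" where
  "C1_fun f \<longleftrightarrow> f differentiable_on UNIV \<and> (\<forall>i. continuous_on UNIV (partial i f))"

definition C2_fun :: "(real ^ 'n::finite \<Rightarrow> real) \<Rightarrow> bool" where
  "C2_fun f \<longleftrightarrow> C1_fun f \<and> (\<forall>i. C1_fun (partial i f))"

definition parabolic_Holder_on ::
    "real \<Rightarrow> (real \<times> (real ^ 'n::finite)) set \<Rightarrow> (real \<Rightarrow> real ^ 'n \<Rightarrow> real) \<Rightarrow> bool" where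
  "parabolic_Holder_on \<alpha> D f \<longleftrightarrow>
     bounded ((\<lambda>(s, x). f s x) ` D) \<and>
     (\<exists>K. \<forall>(s, x)\<in>D. \<forall>(t, y)\<in>D.
        \<bar>f s x - f t y\<bar> \<le> K * (\<bar>s - t\<bar> powr (\<alpha> / 2) + norm (x - y) powr \<alpha>))"

definition parabolic_Holder_loc ::
    "real \<Rightarrow> (real \<Rightarrow> real ^ 'n::finite \<Rightarrow> real) \<Rightarrow> bool" where
  "parabolic_Holder_loc \<alpha> f \<longleftrightarrow>
     continuous_on UNIV (\<lambda>(s, x). f s x) \<and>
     (\<forall>a b \<rho>. a < b \<longrightarrow> 0 < \<rho> \<longrightarrow> parabolic_Holder_on \<alpha> ({a..b} \<times> ball 0 \<rho>) f)"

section \<open>The equation, its evolution operator and its transition measures\<close>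

text \<open>The coefficients are a matrix field and a vector field:
  \<open>q\<^sub>i\<^sub>j(s,x)\<close> is \<open>q s x $ i $ j\<close> and \<open>b\<^sub>i(s,x)\<close> is \<open>b s x $ i\<close>.\<close>

definition ell_op ::
    "(real \<Rightarrow> real ^ 'n \<Rightarrow> real ^ 'n ^ 'n) \<Rightarrow> (real \<Rightarrow> real ^ 'n \<Rightarrow> real ^ 'n) \<Rightarrow>
     real \<Rightarrow> (real ^ 'n::finite \<Rightarrow> real) \<Rightarrow> real ^ 'n \<Rightarrow> real" where
  "ell_op q b s \<phi> x =
     (\<Sum>i\<in>UNIV. \<Sum>j\<in>UNIV. q s x $ i $ j * partial i (partial j \<phi>) x)
     + (\<Sum>i\<in>UNIV. b s x $ i * partial i \<phi> x)"

definition bounded_classical_solution ::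
    "(real \<Rightarrow> real ^ 'n \<Rightarrow> real ^ 'n ^ 'n) \<Rightarrow> (real \<Rightarrow> real ^ 'n \<Rightarrow> real ^ 'n) \<Rightarrow>
     real \<Rightarrow> ((real ^ 'n::finite) \<Rightarrow>\<^sub>C real) \<Rightarrow> (real \<Rightarrow> real ^ 'n \<Rightarrow> real) \<Rightarrow> bool" where
  "bounded_classical_solution q b s \<phi> u \<longleftrightarrow>
     bounded ((\<lambda>(t, x). u t x) ` ({s..} \<times> UNIV)) \<and>
     continuous_on ({s..} \<times> UNIV) (\<lambda>(t, x). u t x) \<and>
     (\<forall>t>s. \<forall>x. (\<lambda>r. u r x) differentiable (at t)) \<and>
     continuous_on ({s<..} \<times> UNIV) (\<lambda>(t, x). deriv (\<lambda>r. u r x) t) \<and>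
     (\<forall>t>s. C2_fun (u t)) \<and>
     (\<forall>i. continuous_on ({s<..} \<times> UNIV) (\<lambda>(t, x). partial i (u t) x)) \<and>
     (\<forall>i j. continuous_on ({s<..} \<times> UNIV) (\<lambda>(t, x). partial i (partial j (u t)) x)) \<and>
     (\<forall>t>s. \<forall>x. deriv (\<lambda>r. u r x) t = ell_op q b t (u t) x) \<and>
     (\<forall>x. u s x = apply_bcontfun \<phi> x)"

text \<open>Under the standing assumptions on the coefficients a bounded classical solution
  exists and is unique for every initial datum, so the following two predicates determine
  \<open>G t s\<close> for \<open>s \<le> t\<close> and \<open>p t s x\<close> for \<open>s < t\<close>. For other arguments the values are
  irrelevant.\<close>

definition evolution_operator ::
    "(real \<Rightarrow> real ^ 'n \<Rightarrow> real ^ 'n ^ 'n) \<Rightarrow> (real \<Rightarrow> real ^ 'n \<Rightarrow> real ^ 'n) \<Rightarrow>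
     (real \<Rightarrow> real \<Rightarrow> ((real ^ 'n::finite) \<Rightarrow>\<^sub>C real) \<Rightarrow> ((real ^ 'n) \<Rightarrow>\<^sub>C real)) \<Rightarrow> bool" where
  "evolution_operator q b G \<longleftrightarrow>
     (\<forall>s \<phi>. bounded_classical_solution q b s \<phi> (\<lambda>t x. apply_bcontfun (G t s \<phi>) x))"

definition transition_measures ::
    "(real \<Rightarrow> real \<Rightarrow> ((real ^ 'n::finite) \<Rightarrow>\<^sub>C real) \<Rightarrow> ((real ^ 'n) \<Rightarrow>\<^sub>C real)) \<Rightarrow>
     (real \<Rightarrow> real \<Rightarrow> real ^ 'n \<Rightarrow> (real ^ 'n) measure) \<Rightarrow> bool" where
  "transition_measures G p \<longleftrightarrow>
     (\<forall>s t x. s < t \<longrightarrow>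
        prob_space (p t s x) \<and> sets (p t s x) = sets borel \<and>
        (\<forall>\<phi>. apply_bcontfun (G t s \<phi>) x = (\<integral>y. apply_bcontfun \<phi> y \<partial>(p t s x))))"

section \<open>Extended integral, tightness, compact operators\<close>

text \<open>The Bochner integral of a non-integrable function is 0. The integral of a function
  bounded below, with values in \<open>(-\<infinity>, \<infinity>]\<close>, is therefore taken as the difference of the
  integrals of the positive and the negative part.\<close>

definition ext_integral :: "'a measure \<Rightarrow> ('a \<Rightarrow> real) \<Rightarrow> ereal" where
  "ext_integral M f =
     enn2ereal (\<integral>\<^sup>+ y. ennreal (f y) \<partial>M) - enn2ereal (\<integral>\<^sup>+ y. ennreal (- f y) \<partial>M)"

definition tight_family :: "('a::real_normed_vector) measure set \<Rightarrow> bool" where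
  "tight_family P \<longleftrightarrow> (\<forall>\<epsilon>>0. \<exists>\<rho>>0. \<forall>p\<in>P. measure p (ball 0 \<rho>) \<ge> 1 - \<epsilon>)"

definition compact_operator :: "('a::real_normed_vector \<Rightarrow> 'b::real_normed_vector) \<Rightarrow> bool" where
  "compact_operator T \<longleftrightarrow> linear T \<and> (\<forall>B. bounded B \<longrightarrow> compact (closure (T ` B)))"

end

theory Submission
  imports Defs "HOL-Complex_Analysis.Great_Picard"
begin

text \<open>
  Everything rests on one comparison principle, made coercive by \<open>W\<^sub>0\<close>.

  The hypothesis on \<open>W\<close> says nothing on the ball of radius \<open>R\<close>, where the coefficients may be
  unbounded in time. Since \<open>W\<^sub>0\<close> is controlled everywhere, \<open>W\<close> can be replaced by a function
  \<open>V\<close> equal to \<open>W + m\<close> outside a compact set and to a multiple of \<open>W\<^sub>0\<close> inside, glued by a concave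
  minimum; then \<open>\<A>(s) V \<le> C - \<Gamma>(V)\<close> everywhere, with a smooth convex \<open>\<Gamma>\<close> growing like \<open>g\<close>.
  If \<open>y(\<tau>, r)\<close> solves \<open>y' = - \<Gamma>(y)\<close>, \<open>y(0) = r\<close>, then \<open>C (t - s) + y(t - s, V(x))\<close> is a
  supersolution, because \<open>y\<close> is concave in \<open>r\<close>. As \<open>1/\<Gamma>\<close> is integrable at infinity, \<open>y(\<delta>, r)\<close> is
  bounded in \<open>r\<close>, and this bounds \<open>G(t,s)\<phi>\<close> uniformly for all \<open>\<phi> \<le> V\<close>.

  For the compactness one writes \<open>G(t,s) = G(t,r) G(r,s)\<close>: doubling the variables in the manner of
  Ishii and Lions bounds the Hoelder seminorm of order \<open>1/2\<close> of \<open>G(r,s)\<phi>\<close> on balls by the sup norm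
  of \<open>\<phi>\<close>, and tightness makes \<open>G(t,r)\<close> continuous from locally uniform to uniform convergence on
  bounded sets.
\<close>

section \<open>Second derivatives and the parabolic maximum principle\<close>

text \<open>\<open>W\<close> is unbounded, so \<open>G t s\<close> cannot be applied to it. The
  estimate is proved for all bounded continuous functions below \<open>V\<close>, with a constant
  that does not depend on the function, and monotone convergence over truncations of
  \<open>V\<close> turns it into a bound for the integral. The supersolution is differentiated twice
  in its initial value, so the rate has to be differentiable, whereas \<open>g\<close> is merely
  convex; this is why \<open>\<Gamma>\<close> is built by averaging. Its term linear in time grows,
  so it is used for a time \<open>\<delta>\<close> only, after which constants propagate the bound.
  In the compactness part the modulus \<open>|z|^(1/2)\<close> is strictly concave along
  \<open>z\<close>. The reflected part of the coupling therefore contributes a negative term of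
  order \<open>|z|^(-3/2)\<close>. It beats the drift, of order \<open>|z|^(-1/2)\<close>, and the
  mismatch of the two diffusion matrices, of the same order \<open>|z|^(-3/2)\<close> but with a
  factor made small by uniform continuity. Any exponent strictly between 0 and 1 behaves in this
  way; 1/2 is the power 1/4 of the polynomial \<open>z \<bullet> z\<close>.\<close>

definition outer_prod :: "real ^ 'n \<Rightarrow> real ^ 'm \<Rightarrow> real ^ 'm ^ 'n" where
  "outer_prod u v = (\<chi> i j. u $ i * v $ j)"

lemma outer_prod_mult_vec: "outer_prod u v *v h = (v \<bullet> h) *\<^sub>R u"
  by (simp add: outer_prod_def vec_eq_iff matrix_vector_mult_def inner_vec_def
      sum_distrib_left sum_distrib_right mult_ac)

lemma inner_outer_prod: "Q \<bullet> outer_prod u v = (Q *v v) \<bullet> u"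
  by (simp add: outer_prod_def inner_vec_def matrix_vector_mult_def sum_distrib_right
      sum_distrib_left mult_ac)

lemma inner_mat_1: "Q \<bullet> mat 1 = trace Q"
  by (simp add: inner_vec_def mat_def trace_def if_distrib sum.delta cong: if_cong)

lemma sum_insert_insert:
  fixes F :: "'a \<Rightarrow> 'a \<Rightarrow> real"
  assumes "finite I" "n \<notin> I"
  shows "(\<Sum>i\<in>insert n I. \<Sum>j\<in>insert n I. F i j)
      = F n n + (\<Sum>j\<in>I. F n j) + (\<Sum>j\<in>I. F j n) + (\<Sum>i\<in>I. \<Sum>j\<in>I. F i j)"
  using assms by (simp add: sum.distrib algebra_simps)

text \<open>Lagrange reduction of \<open>Q\<close>: subtracting the rank one form built from the row
  \<open>Q n\<close> leaves the Schur complement on \<open>I\<close>, and the rank one part paired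
  with \<open>H\<close> is \<open>H\<close> evaluated at \<open>Q n\<close>. Symmetry is asked of
  \<open>Q\<close> only, so a Hessian can be inserted for \<open>H\<close> without a theorem on
  mixed partial derivatives.\<close>

lemma sum_mult_psd_nonneg:
  fixes Q H :: "'a \<Rightarrow> 'a \<Rightarrow> real"
  assumes "finite I" and "\<And>i j. Q i j = Q j i"
    and "\<And>x. 0 \<le> (\<Sum>i\<in>I. \<Sum>j\<in>I. Q i j * x i * x j)"
    and "\<And>x. 0 \<le> (\<Sum>i\<in>I. \<Sum>j\<in>I. H i j * x i * x j)"
  shows "0 \<le> (\<Sum>i\<in>I. \<Sum>j\<in>I. Q i j * H i j)"
  using assms
proof (induction I arbitrary: Q rule: finite_induct)
  case empty
  then show ?case by simp
next
  case (insert n I)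
  note ins = sum_insert_insert[OF insert.hyps(1,2)]
  have upd: "(\<Sum>j\<in>I. F j ((x(n := c)) j)) = (\<Sum>j\<in>I. F j (x j))"
    for F and x :: "'a \<Rightarrow> real" and c
    using insert.hyps(2) by (intro sum.cong) auto
  have exp: "(\<Sum>i\<in>insert n I. \<Sum>j\<in>insert n I. P i j * (x(n := c)) i * (x(n := c)) j)
     = P n n * c^2 + c * (\<Sum>j\<in>I. (P n j + P j n) * x j) + (\<Sum>i\<in>I. \<Sum>j\<in>I. P i j * x i * x j)"
    for P :: "'a \<Rightarrow> 'a \<Rightarrow> real" and x c
  proof -
    have "(\<Sum>i\<in>I. \<Sum>j\<in>I. P i j * (x(n := c)) i * (x(n := c)) j)
        = (\<Sum>i\<in>I. \<Sum>j\<in>I. P i j * x i * x j)"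
      using insert.hyps(2) by (intro sum.cong) auto
    moreover have "(\<Sum>j\<in>I. P n j * (x(n := c)) n * (x(n := c)) j) = c * (\<Sum>j\<in>I. P n j * x j)"
      using insert.hyps(2) by (auto simp: sum_distrib_left intro!: sum.cong)
    moreover have "(\<Sum>j\<in>I. P j n * (x(n := c)) j * (x(n := c)) n) = c * (\<Sum>j\<in>I. P j n * x j)"
      using insert.hyps(2) by (auto simp: sum_distrib_left intro!: sum.cong)
    ultimately show ?thesis
      unfolding ins by (simp add: power2_eq_square algebra_simps sum.distrib)
  qed
  have HI: "0 \<le> (\<Sum>i\<in>I. \<Sum>j\<in>I. H i j * x i * x j)" for x
    using insert.prems(3)[of "x(n := 0)"] unfolding exp by simp
  have Qexp: "0 \<le> Q n n * c^2 + 2 * c * (\<Sum>j\<in>I. Q n j * x j) + (\<Sum>i\<in>I. \<Sum>j\<in>I. Q i j * x i * x j)"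
    for x c
  proof -
    have "(\<Sum>j\<in>I. (Q n j + Q j n) * x j) = 2 * (\<Sum>j\<in>I. Q n j * x j)"
      unfolding sum_distrib_left by (intro sum.cong) (auto simp: insert.prems(1)[of _ n])
    then show ?thesis
      using insert.prems(2)[of "x(n := c)"] unfolding exp by simp
  qed
  have Qnn: "0 \<le> Q n n" using Qexp[of 1 "\<lambda>_. 0"] by simp
  show ?case
  proof (cases "Q n n = 0")
    case True
    \<comment> \<open>With a zero diagonal entry the form is affine in the entry at
      \<open>n\<close>, so its slope has to vanish.\<close>
    have z: "(\<Sum>j\<in>I. Q n j * x j) = 0" for x
    proof (rule ccontr)
      assume a: "\<not> ?thesis"
      define S T where "S = (\<Sum>j\<in>I. Q n j * x j)" and "T = (\<Sum>i\<in>I. \<Sum>j\<in>I. Q i j * x i * x j)"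
      have "0 \<le> 2 * (- (T + 1) / (2 * S)) * S + T"
        using Qexp[of "- (T + 1) / (2 * S)" x] True by (simp add: S_def T_def)
      then show False using a by (simp add: S_def field_simps)
    qed
    have "(\<Sum>j\<in>I. Q n j * H j n) = 0" "(\<Sum>j\<in>I. Q n j * H n j) = 0"
      using z by auto
    moreover have "(\<Sum>j\<in>I. Q j n * H j n) = (\<Sum>j\<in>I. Q n j * H j n)"
      by (intro sum.cong) (auto simp: insert.prems(1)[of _ n])
    moreover have "0 \<le> (\<Sum>i\<in>I. \<Sum>j\<in>I. Q i j * H i j)"
      using Qexp[of 0] by (intro insert.IH insert.prems(1) HI) simp
    ultimately show ?thesis unfolding ins using True by simp
  next
    case False
    define a where "a = Q n n"
    have a: "a > 0" using Qnn False by (simp add: a_def)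
    \<comment> \<open>The Schur complement inherits nonnegativity: it is the form of
      \<open>Q\<close> with the entry at \<open>n\<close> set to its minimiser
      \<open>- S / a\<close>.\<close>
    define Q' where "Q' = (\<lambda>i j. Q i j - Q n i * Q n j / a)"
    have "0 \<le> (\<Sum>i\<in>I. \<Sum>j\<in>I. Q' i j * H i j)"
    proof (intro insert.IH HI)
      show "Q' i j = Q' j i" for i j
        unfolding Q'_def by (simp add: insert.prems(1)[of i j])
      fix x
      define S where "S = (\<Sum>j\<in>I. Q n j * x j)"
      have "0 \<le> a * (- S / a)^2 + 2 * (- S / a) * S + (\<Sum>i\<in>I. \<Sum>j\<in>I. Q i j * x i * x j)"
        using Qexp[of "- S / a" x] by (simp add: S_def a_def)
      also have "a * (- S / a)^2 + 2 * (- S / a) * S = - (S * S / a)"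
        using a by (simp add: field_simps power2_eq_square)
      also have "S * S / a = (\<Sum>i\<in>I. \<Sum>j\<in>I. (Q n i * Q n j / a) * x i * x j)"
        unfolding S_def sum_product sum_divide_distrib by (intro sum.cong) auto
      finally show "0 \<le> (\<Sum>i\<in>I. \<Sum>j\<in>I. Q' i j * x i * x j)"
        by (simp add: Q'_def algebra_simps sum_subtractf)
    qed
    moreover have "0 \<le> (\<Sum>i\<in>insert n I. \<Sum>j\<in>insert n I. H i j * Q n i * Q n j) / a"
      using insert.prems(3)[of "Q n"] a by simp
    moreover have "(\<Sum>i\<in>insert n I. \<Sum>j\<in>insert n I. Q i j * H i j)
       = (\<Sum>i\<in>I. \<Sum>j\<in>I. Q' i j * H i j) + (\<Sum>i\<in>insert n I. \<Sum>j\<in>insert n I. H i j * Q n i * Q n j) / a"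
    proof -
      have "(\<Sum>i\<in>insert n I. \<Sum>j\<in>insert n I. H i j * Q n i * Q n j) / a
        = (\<Sum>i\<in>insert n I. \<Sum>j\<in>insert n I. H i j * Q n i * Q n j / a)"
        by (simp only: sum_divide_distrib)
      also have "\<dots> = H n n * a + (\<Sum>j\<in>I. H n j * Q n j) + (\<Sum>j\<in>I. H j n * Q n j)
         + (\<Sum>i\<in>I. \<Sum>j\<in>I. H i j * Q n i * Q n j / a)"
        unfolding ins using a by (auto simp: a_def[symmetric])
      finally have 1: "(\<Sum>i\<in>insert n I. \<Sum>j\<in>insert n I. H i j * Q n i * Q n j) / a = \<dots>" .
      have 2: "(\<Sum>i\<in>I. \<Sum>j\<in>I. Q' i j * H i j) = (\<Sum>i\<in>I. \<Sum>j\<in>I. Q i j * H i j)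
          - (\<Sum>i\<in>I. \<Sum>j\<in>I. H i j * Q n i * Q n j / a)"
        by (simp add: Q'_def algebra_simps sum_subtractf)
      have 3: "(\<Sum>j\<in>I. Q j n * H j n) = (\<Sum>j\<in>I. H j n * Q n j)"
        by (intro sum.cong) (auto simp: insert.prems(1)[of _ n])
      show ?thesis unfolding 1 2 unfolding ins 3
        by (simp add: a_def mult.commute)
    qed
    ultimately show ?thesis by linarith
  qed
qed

lemma inner_psd_nonneg:
  fixes Q H :: "real ^ 'n ^ 'n"
  assumes "transpose Q = Q" and "\<And>\<xi>. 0 \<le> (Q *v \<xi>) \<bullet> \<xi>" and "\<And>\<xi>. 0 \<le> (H *v \<xi>) \<bullet> \<xi>"
  shows "0 \<le> Q \<bullet> H"
proof -
  have e: "(\<Sum>i\<in>UNIV. \<Sum>j\<in>UNIV. A $ i $ j * x i * x j) = (A *v (\<chi> i. x i)) \<bullet> (\<chi> i. x i)"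
    for A :: "real ^ 'n ^ 'n" and x
    by (simp add: inner_vec_def matrix_vector_mult_def sum_distrib_right sum_distrib_left mult_ac)
  have "0 \<le> (\<Sum>i\<in>UNIV. \<Sum>j\<in>UNIV. Q $ i $ j * H $ i $ j)"
  proof (rule sum_mult_psd_nonneg)
    show "Q $ i $ j = Q $ j $ i" for i j
      using assms(1) by (metis transpose_def vec_lambda_beta)
  qed (simp_all add: e assms)
  then show ?thesis by (simp add: inner_vec_def)
qed

section \<open>Gradients, Hessians and the second derivative test\<close>

lemma second_deriv_nonneg_at_min:
  fixes F :: "real \<Rightarrow> real"
  assumes "0 < d"
    and F: "\<And>r. \<bar>r\<bar> < d \<Longrightarrow> (F has_real_derivative F' r) (at r)"
    and F': "(F' has_real_derivative D) (at 0)"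
    and min: "\<And>r. \<bar>r\<bar> < d \<Longrightarrow> F 0 \<le> F r"
  shows "F' 0 = 0" "0 \<le> D"
proof -
  show z: "F' 0 = 0"
    by (rule DERIV_local_min[OF F \<open>0 < d\<close>]) (use assms in auto)
  show "0 \<le> D"
  proof (rule ccontr)
    assume "\<not> 0 \<le> D"
    then obtain e where e: "e > 0" "\<And>h. 0 < h \<Longrightarrow> h < e \<Longrightarrow> F' h < 0"
      using DERIV_neg_dec_right[OF F'] z by auto
    define h where "h = min d e / 2"
    have h: "0 < h" "h < d" "h < e" using e \<open>0 < d\<close> by (auto simp: h_def)
    have "F h < F 0"
    proof (rule DERIV_neg_imp_decreasing_open[OF h(1)])
      show "\<exists>y. (F has_real_derivative y) (at x) \<and> y < 0" if "0 < x" "x < h" for x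
        using F[of x] e(2)[of x] that h by (intro exI[of _ "F' x"]) auto
      show "continuous_on {0..h} F"
      proof (intro continuous_at_imp_continuous_on ballI)
        fix x assume "x \<in> {0..h}"
        then show "isCont F x" using F[of x] h by (intro DERIV_isCont[of F "F' x"]) auto
      qed
    qed
    then show False using min[of h] h by auto
  qed
qed

text \<open>Gradient and Hessian are explicit data, so that sums, compositions and glued functions
  obtain theirs from introduction rules. Twice Frechet differentiable is what the maximum principle
  sees; continuity of \<open>H\<close> is not recorded.\<close>

definition has_grad_hess ::
    "(real ^ 'n \<Rightarrow> real) \<Rightarrow> (real ^ 'n \<Rightarrow> real ^ 'n) \<Rightarrow> (real ^ 'n \<Rightarrow> real ^ 'n ^ 'n) \<Rightarrow> bool" where
  "has_grad_hess f g H \<longleftrightarrow>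
     (\<forall>x. (f has_derivative (\<lambda>h. g x \<bullet> h)) (at x)) \<and>
     (\<forall>x. (g has_derivative (\<lambda>h. H x *v h)) (at x))"

lemma has_grad_hessD:
  assumes "has_grad_hess f g H"
  shows "(f has_derivative (\<lambda>h. g x \<bullet> h)) (at x)" "(g has_derivative (\<lambda>h. H x *v h)) (at x)"
  using assms by (auto simp: has_grad_hess_def)

lemma has_grad_hess_continuous: "has_grad_hess f g H \<Longrightarrow> continuous_on S f"
  by (meson has_grad_hessD(1) has_derivative_continuous continuous_at_imp_continuous_on)

lemma has_grad_hess_add:
  assumes "has_grad_hess f g H" "has_grad_hess f' g' H'"
  shows "has_grad_hess (\<lambda>x. f x + f' x) (\<lambda>x. g x + g' x) (\<lambda>x. H x + H' x)"
  unfolding has_grad_hess_def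
  by (auto intro!: derivative_eq_intros has_grad_hessD[OF assms(1)] has_grad_hessD[OF assms(2)]
      simp: inner_add_left matrix_vector_mult_add_rdistrib)

lemma has_grad_hess_const: "has_grad_hess (\<lambda>x. c) (\<lambda>x. 0) (\<lambda>x. 0)"
  unfolding has_grad_hess_def by (auto intro!: derivative_eq_intros)

lemma has_grad_hess_cmult:
  assumes "has_grad_hess f g H"
  shows "has_grad_hess (\<lambda>x. c * f x) (\<lambda>x. c *\<^sub>R g x) (\<lambda>x. c *\<^sub>R H x)"
  unfolding has_grad_hess_def
  by (auto intro!: derivative_eq_intros has_grad_hessD[OF assms] simp: scaleR_matrix_vector_assoc)

lemma has_grad_hess_diff:
  assumes "has_grad_hess f g H" "has_grad_hess f' g' H'"
  shows "has_grad_hess (\<lambda>x. f x - f' x) (\<lambda>x. g x - g' x) (\<lambda>x. H x - H' x)"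
  using has_grad_hess_add[OF assms(1) has_grad_hess_cmult[OF assms(2), of "-1"]] by simp

lemma has_grad_hess_compose:
  assumes f: "has_grad_hess f g H"
    and p: "\<And>x. (\<phi> has_real_derivative \<phi>' (f x)) (at (f x))"
    and p': "\<And>x. (\<phi>' has_real_derivative \<phi>'' (f x)) (at (f x))"
  shows "has_grad_hess (\<lambda>x. \<phi> (f x)) (\<lambda>x. \<phi>' (f x) *\<^sub>R g x)
      (\<lambda>x. \<phi>' (f x) *\<^sub>R H x + \<phi>'' (f x) *\<^sub>R outer_prod (g x) (g x))"
proof -
  have 1: "((\<lambda>x. \<phi> (f x)) has_derivative (\<lambda>h. (\<phi>' (f x) *\<^sub>R g x) \<bullet> h)) (at x)" for x
    using has_derivative_compose[OF has_grad_hessD(1)[OF f] p[unfolded has_field_derivative_def]]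
    by simp
  have 2: "((\<lambda>x. \<phi>' (f x)) has_derivative (\<lambda>h. (\<phi>'' (f x) *\<^sub>R g x) \<bullet> h)) (at x)" for x
    using has_derivative_compose[OF has_grad_hessD(1)[OF f] p'[unfolded has_field_derivative_def]]
    by simp
  have "((\<lambda>x. \<phi>' (f x) *\<^sub>R g x) has_derivative
      (\<lambda>h. (\<phi>' (f x) *\<^sub>R H x + \<phi>'' (f x) *\<^sub>R outer_prod (g x) (g x)) *v h)) (at x)" for x
    by (rule derivative_eq_intros 2 has_grad_hessD(2)[OF f] refl)+
      (simp add: matrix_vector_mult_add_rdistrib scaleR_matrix_vector_assoc[symmetric]
        outer_prod_mult_vec fun_eq_iff)
  with 1 show ?thesis unfolding has_grad_hess_def by blast
qed

lemma has_grad_hess_line: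
  assumes "has_grad_hess f g H"
  shows "((\<lambda>r. f (x + r *\<^sub>R \<xi>)) has_real_derivative g (x + r *\<^sub>R \<xi>) \<bullet> \<xi>) (at r)"
    and "((\<lambda>r. g (x + r *\<^sub>R \<xi>) \<bullet> \<xi>) has_real_derivative (H (x + r *\<^sub>R \<xi>) *v \<xi>) \<bullet> \<xi>) (at r)"
proof -
  have l: "((\<lambda>r. x + r *\<^sub>R \<xi>) has_derivative (\<lambda>h. h *\<^sub>R \<xi>)) (at r)" for r
    by (auto intro!: derivative_eq_intros)
  show "((\<lambda>r. f (x + r *\<^sub>R \<xi>)) has_real_derivative g (x + r *\<^sub>R \<xi>) \<bullet> \<xi>) (at r)"
    unfolding has_field_derivative_def
    using has_derivative_compose[OF l has_grad_hessD(1)[OF assms], of r]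
    by (simp add: mult.commute[of _ "g (x + r *\<^sub>R \<xi>) \<bullet> \<xi>"])
  have "((\<lambda>r. g (x + r *\<^sub>R \<xi>)) has_derivative (\<lambda>h. H (x + r *\<^sub>R \<xi>) *v (h *\<^sub>R \<xi>))) (at r)"
    using has_derivative_compose[OF l has_grad_hessD(2)[OF assms]] by simp
  then have "((\<lambda>r. g (x + r *\<^sub>R \<xi>) \<bullet> \<xi>) has_derivative
      (\<lambda>h. (H (x + r *\<^sub>R \<xi>) *v (h *\<^sub>R \<xi>)) \<bullet> \<xi>)) (at r)"
    by (rule has_derivative_inner_left)
  then show "((\<lambda>r. g (x + r *\<^sub>R \<xi>) \<bullet> \<xi>) has_real_derivative (H (x + r *\<^sub>R \<xi>) *v \<xi>) \<bullet> \<xi>) (at r)"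
    unfolding has_field_derivative_def
    by (simp add: matrix_vector_mult_scaleR mult_commute_abs)
qed

lemma has_grad_hess_min:
  assumes f: "has_grad_hess f g H" and min: "\<And>y. f x \<le> f y"
  shows "g x = 0" "0 \<le> (H x *v \<xi>) \<bullet> \<xi>"
proof -
  have *: "g x \<bullet> \<xi> = 0 \<and> 0 \<le> (H x *v \<xi>) \<bullet> \<xi>" for \<xi>
    using second_deriv_nonneg_at_min[of 1 "\<lambda>r. f (x + r *\<^sub>R \<xi>)" "\<lambda>r. g (x + r *\<^sub>R \<xi>) \<bullet> \<xi>"]
      has_grad_hess_line[OF f, of x \<xi>] has_grad_hess_line(2)[OF f, of x \<xi> 0] min
    by auto
  show "g x = 0" using *[of "g x"] by simp
  show "0 \<le> (H x *v \<xi>) \<bullet> \<xi>" using * by blast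
qed

section \<open>From partial derivatives to gradient and Hessian\<close>

lemma has_derivative_vec_lambda:
  fixes f :: "'a::real_normed_vector \<Rightarrow> 'n::finite \<Rightarrow> real"
  assumes "\<And>i. ((\<lambda>x. f x i) has_derivative (\<lambda>h. f' h i)) (at a)"
  shows "((\<lambda>x. \<chi> i. f x i) has_derivative (\<lambda>h. \<chi> i. f' h i)) (at a)"
  unfolding has_derivative_componentwise_within[where 'b = "real ^ 'n"]
  using assms by (auto simp: Basis_vec_def cart_eq_inner_axis[symmetric])

definition grad :: "(real ^ 'n \<Rightarrow> real) \<Rightarrow> real ^ 'n \<Rightarrow> real ^ 'n" where
  "grad f x = (\<chi> i. partial i f x)"

definition hess :: "(real ^ 'n \<Rightarrow> real) \<Rightarrow> real ^ 'n \<Rightarrow> real ^ 'n ^ 'n" where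
  "hess f x = (\<chi> i j. partial j (partial i f) x)"

lemma has_derivative_grad:
  assumes "f differentiable (at x)"
  shows "(f has_derivative (\<lambda>h. grad f x \<bullet> h)) (at x)"
proof -
  let ?D = "frechet_derivative f (at x)"
  have D: "(f has_derivative ?D) (at x)" using assms by (simp add: frechet_derivative_works)
  have lin: "linear ?D" using D by (rule has_derivative_linear)
  have "?D h = grad f x \<bullet> h" for h
  proof -
    have "h = (\<Sum>i\<in>UNIV. (h $ i) *\<^sub>R axis i 1)"
      using basis_expansion[of h] by (simp add: scalar_mult_eq_scaleR)
    then have "?D h = ?D (\<Sum>i\<in>UNIV. (h $ i) *\<^sub>R axis i 1)" by simp
    also have "\<dots> = (\<Sum>i\<in>UNIV. (h $ i) * ?D (axis i 1))"
      by (simp add: linear_sum[OF lin] linear_cmul[OF lin])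
    also have "\<dots> = grad f x \<bullet> h"
      by (simp add: grad_def partial_def inner_vec_def mult.commute)
    finally show ?thesis .
  qed
  then have "?D = (\<lambda>h. grad f x \<bullet> h)" by auto
  with D show ?thesis by simp
qed

lemma C2_fun_has_grad_hess:
  assumes "C2_fun f"
  shows "has_grad_hess f (grad f) (hess f)"
  unfolding has_grad_hess_def
proof (intro conjI allI)
  fix x
  show "(f has_derivative (\<lambda>h. grad f x \<bullet> h)) (at x)"
    using assms by (intro has_derivative_grad)
      (auto simp: C2_fun_def C1_fun_def differentiable_on_def)
  have "(grad f has_derivative (\<lambda>h. \<chi> i. grad (partial i f) x \<bullet> h)) (at x)"
    unfolding grad_def[of f, abs_def]
  proof (rule has_derivative_vec_lambda)
    fix i
    show "(partial i f has_derivative (\<lambda>h. grad (partial i f) x \<bullet> h)) (at x)"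
      using assms by (intro has_derivative_grad)
        (auto simp: C2_fun_def C1_fun_def differentiable_on_def)
  qed
  moreover have "(\<lambda>h. \<chi> i. grad (partial i f) x \<bullet> h) = (\<lambda>h. hess f x *v h)"
    by (simp add: fun_eq_iff vec_eq_iff matrix_vector_mul_component hess_def grad_def)
  ultimately show "(grad f has_derivative (\<lambda>h. hess f x *v h)) (at x)" by simp
qed

text \<open>The two sides take the mixed derivatives in opposite orders; the symmetry of
  \<open>q s x\<close> reconciles them.\<close>

lemma ell_op_eq_inner:
  assumes "transpose (q s x) = q s x"
  shows "ell_op q b s f x = q s x \<bullet> hess f x + b s x \<bullet> grad f x"
proof -
  have s: "q s x $ i $ j = q s x $ j $ i" for i j
    using assms by (metis transpose_def vec_lambda_beta)
  have "(\<Sum>i\<in>UNIV. \<Sum>j\<in>UNIV. q s x $ i $ j * partial i (partial j f) x)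
     = (\<Sum>j\<in>UNIV. \<Sum>i\<in>UNIV. q s x $ j $ i * partial i (partial j f) x)"
    by (subst sum.swap) (simp add: s)
  then show ?thesis
    by (simp add: ell_op_def hess_def grad_def inner_vec_def)
qed

text \<open>What the maximum principle sees of the equation, in terms of matrices and vectors
  instead of \<open>ell_op\<close>. Quantitative ellipticity enters with
  \<open>interior_Holder\<close>.\<close>

locale lyapunov_setting =
  fixes q :: "real \<Rightarrow> real ^ 'n \<Rightarrow> real ^ 'n ^ 'n"
    and b :: "real \<Rightarrow> real ^ 'n \<Rightarrow> real ^ 'n"
    and W0 :: "real ^ 'n \<Rightarrow> real" and gW0 hW0 lam
  assumes q_sym: "\<And>s x. transpose (q s x) = q s x"
    and q_psd: "\<And>s x \<xi>. 0 \<le> (q s x *v \<xi>) \<bullet> \<xi>"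
    and W0: "has_grad_hess W0 gW0 hW0"
    and W0_pos: "\<And>x. W0 x > 0"
    and W0_lim: "filterlim W0 at_top at_infinity"
    and W0_lyap: "\<And>s x. q s x \<bullet> hW0 x + b s x \<bullet> gW0 x \<le> lam * W0 x"
begin

lemma bounded_sublevel: "bounded {x. W0 x \<le> c}"
proof -
  have "\<forall>\<^sub>F x in at_infinity. c < W0 x"
    using W0_lim by (simp add: filterlim_at_top_dense)
  then obtain B where "\<And>x. B \<le> norm x \<Longrightarrow> c < W0 x"
    by (auto simp: eventually_at_infinity)
  then have "norm x \<le> B" if "W0 x \<le> c" for x using that by (meson not_le less_imp_le)
  then show ?thesis by (auto simp: bounded_iff)
qed

lemma compact_sublevel: "compact {x. W0 x \<le> c}"
proof -
  have "closed {x. W0 x \<le> c}"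
    by (intro closed_Collect_le has_grad_hess_continuous[OF W0] continuous_on_const)
  then show ?thesis using bounded_sublevel by (simp add: compact_eq_bounded_closed)
qed

text \<open>Adding a small multiple of \<open>exp (\<mu> t) W0\<close> makes the supersolution coercive and strict, so
  that a negative minimum would be attained and contradict the elliptic inequality there.\<close>

lemma parabolic_comparison:
  fixes w :: "real \<Rightarrow> real ^ 'n \<Rightarrow> real"
  assumes cont: "continuous_on ({s..T} \<times> UNIV) (\<lambda>(t, x). w t x)"
    and bdd: "\<And>t x. t \<in> {s..T} \<Longrightarrow> M \<le> w t x"
    and init: "\<And>x. 0 \<le> w s x"
    and C2: "\<And>t. t \<in> {s<..T} \<Longrightarrow> has_grad_hess (w t) (g t) (H t)"
    and dt: "\<And>t x. t \<in> {s<..T} \<Longrightarrow> ((\<lambda>r. w r x) has_real_derivative d t x) (at t)"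
    and super: "\<And>t x. t \<in> {s<..T} \<Longrightarrow> q t x \<bullet> H t x + b t x \<bullet> g t x \<le> d t x"
    and t: "t \<in> {s..T}"
  shows "0 \<le> w t x"
proof (rule ccontr)
  assume neg: "\<not> 0 \<le> w t x"
  define \<mu> where "\<mu> = \<bar>lam\<bar> + 1"
  \<comment> \<open>Half of the value that would cancel \<open>w t x\<close>, so that
    \<open>F\<close> is still negative at \<open>(t, x)\<close>.\<close>
  define \<epsilon> where "\<epsilon> = - w t x / (2 * (exp (\<mu> * (t - s)) * W0 x))"
  have \<epsilon>: "\<epsilon> > 0" using neg W0_pos[of x] by (auto simp: \<epsilon>_def field_simps)
  define F where "F = (\<lambda>t x. w t x + (\<epsilon> * exp (\<mu> * (t - s))) * W0 x)"
  have "F t x = w t x / 2" using W0_pos[of x] by (simp add: F_def \<epsilon>_def field_simps)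
  then have Fneg: "F t x < 0" using neg by simp
  define c where "c = \<bar>M\<bar> / \<epsilon>"
  \<comment> \<open>Outside the sublevel set \<open>\<epsilon> * W0\<close> exceeds
    \<open>\<bar>M\<bar>\<close> and \<open>F\<close> is nonnegative. The point \<open>x\<close> is
    added so that the minimum over \<open>K\<close> is negative, hence global.\<close>
  define K where "K = {x. W0 x \<le> c} \<union> {x}"
  have K: "compact K" unfolding K_def using compact_sublevel by (intro compact_Un) auto
  have out: "F r y \<ge> 0" if "y \<notin> K" "r \<in> {s..T}" for r y
  proof -
    have "\<bar>M\<bar> < \<epsilon> * W0 y" using that(1) \<epsilon> by (auto simp: K_def c_def field_simps)
    also have "\<dots> \<le> (\<epsilon> * exp (\<mu> * (r - s))) * W0 y"
      using that(2) \<epsilon> W0_pos[of y] by (auto simp: \<mu>_def)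
    finally show ?thesis using bdd[OF that(2), of y] by (simp add: F_def)
  qed
  have contF: "continuous_on ({s..T} \<times> UNIV) (\<lambda>p. F (fst p) (snd p))"
    unfolding F_def using cont
    by (auto intro!: continuous_intros has_grad_hess_continuous[OF W0]
        continuous_on_compose2[OF has_grad_hess_continuous[OF W0, of UNIV]]
        simp: case_prod_unfold)
  have ne: "(t, x) \<in> {s..T} \<times> K" using t by (auto simp: K_def)
  obtain p where p: "p \<in> {s..T} \<times> K" "\<And>z. z \<in> {s..T} \<times> K \<Longrightarrow> F (fst p) (snd p) \<le> F (fst z) (snd z)"
    using continuous_attains_inf[of "{s..T} \<times> K" "\<lambda>p. F (fst p) (snd p)"]
      compact_Times[OF compact_Icc K] ne continuous_on_subset[OF contF, of "{s..T} \<times> K"] by blast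
  obtain t0 x0 where tx: "p = (t0, x0)" by (cases p)
  have t0: "t0 \<in> {s..T}" using p(1) tx by auto
  have m0: "F t0 x0 < 0" using p(2)[OF ne] Fneg tx by simp
  have min: "F t0 x0 \<le> F r y" if "r \<in> {s..T}" for r y
    using p(2)[of "(r, y)"] out[of y r] that m0 tx by (cases "y \<in> K") auto
  have "F s x0 \<ge> 0" using init[of x0] W0_pos[of x0] \<epsilon> by (simp add: F_def)
  with m0 have "t0 \<noteq> s" by auto
  with t0 have t0': "t0 \<in> {s<..T}" by auto
  define E where "E = \<epsilon> * exp (\<mu> * (t0 - s))"
  have E: "E > 0" using \<epsilon> by (simp add: E_def)
  have gh: "has_grad_hess (F t0) (\<lambda>x. g t0 x + E *\<^sub>R gW0 x) (\<lambda>x. H t0 x + E *\<^sub>R hW0 x)"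
    unfolding F_def E_def by (intro has_grad_hess_add C2 t0' has_grad_hess_cmult W0)
  have "0 \<le> q t0 x0 \<bullet> (H t0 x0 + E *\<^sub>R hW0 x0)"
    using has_grad_hess_min[OF gh] min[OF t0]
    by (intro inner_psd_nonneg q_sym q_psd) blast
  moreover have "g t0 x0 + E *\<^sub>R gW0 x0 = 0"
    using has_grad_hess_min(1)[OF gh] min[OF t0] by blast
  ultimately have "0 \<le> q t0 x0 \<bullet> (H t0 x0 + E *\<^sub>R hW0 x0) + b t0 x0 \<bullet> (g t0 x0 + E *\<^sub>R gW0 x0)"
    by simp
  also have "\<dots> = (q t0 x0 \<bullet> H t0 x0 + b t0 x0 \<bullet> g t0 x0) + E * (q t0 x0 \<bullet> hW0 x0 + b t0 x0 \<bullet> gW0 x0)"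
    by (simp add: inner_add_right algebra_simps)
  also have "\<dots> \<le> d t0 x0 + E * (lam * W0 x0)"
    using super[OF t0', of x0] W0_lyap[of t0 x0] E by (intro add_mono mult_left_mono) auto
  also have "E * (lam * W0 x0) < E * (\<mu> * W0 x0)"
    using E W0_pos[of x0] by (intro mult_strict_left_mono mult_strict_right_mono) (auto simp: \<mu>_def)
  finally have pos: "0 < d t0 x0 + E * (\<mu> * W0 x0)" by simp
  have dF: "((\<lambda>r. F r x0) has_real_derivative d t0 x0 + E * (\<mu> * W0 x0)) (at t0)"
    unfolding F_def E_def by (auto intro!: derivative_eq_intros dt[OF t0'])
  \<comment> \<open>\<open>t0\<close> may be the final time \<open>T\<close>, so the contradiction
    is drawn from earlier times.\<close>
  obtain e where e: "e > 0" "\<And>h. 0 < h \<Longrightarrow> h < e \<Longrightarrow> F (t0 - h) x0 < F t0 x0"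
    using DERIV_pos_inc_left[OF dF pos] by auto
  define h where "h = min e (t0 - s) / 2"
  have "0 < h" "h < e" "t0 - h \<in> {s..T}" using e(1) t0' by (auto simp: h_def min_def field_simps)
  then show False using e(2)[of h] min[of "t0 - h" x0] by auto
qed

end

section \<open>Coming down from infinity\<close>

text \<open>\<open>H\<close> is the travel time: separation of variables turns
  \<open>y' = - \<Gamma>(y)\<close> into \<open>H(y(\<tau>)) = H(r) - \<tau>\<close>. Boundedness of
  \<open>H\<close> above is the convergence of the integral of \<open>1/\<Gamma>\<close> at
  infinity, and monotonicity of \<open>\<Gamma>'\<close>, the convexity of \<open>\<Gamma>\<close>,
  makes the flow concave in \<open>r\<close>.\<close>

locale coming_down =
  fixes \<Gamma> \<Gamma>' H :: "real \<Rightarrow> real"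
  assumes \<Gamma>_ge: "\<And>r. 1 \<le> \<Gamma> r"
    and \<Gamma>_deriv: "\<And>r. (\<Gamma> has_real_derivative \<Gamma>' r) (at r)"
    and \<Gamma>_mono: "mono \<Gamma>"
    and \<Gamma>'_mono: "mono \<Gamma>'"
    and H_deriv: "\<And>r. (H has_real_derivative 1 / \<Gamma> r) (at r)"
    and H_bdd: "bdd_above (range H)"
begin

text \<open>The solution at time \<open>\<tau>\<close> of \<open>y' = - \<Gamma>(y)\<close>, \<open>y(0) = r\<close>.\<close>

definition flow :: "real \<Rightarrow> real \<Rightarrow> real" where
  "flow \<tau> r = inv H (H r - \<tau>)"

lemma \<Gamma>_pos: "0 < \<Gamma> r"
  using \<Gamma>_ge[of r] by linarith

lemma H_strict_mono: "r < r' \<Longrightarrow> H r < H r'"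
  by (rule DERIV_pos_imp_increasing) (use H_deriv \<Gamma>_pos in \<open>force\<close>)+

lemma H_less_iff: "H r < H r' \<longleftrightarrow> r < r'"
  using H_strict_mono by (metis less_asym linorder_neqE_linordered_idom)

lemma H_inj: "inj H"
  by (metis injI H_strict_mono linorder_neqE_linordered_idom less_irrefl)

lemma H_isCont: "isCont H r"
  using H_deriv DERIV_isCont by blast

lemma inv_H: "inv H (H r) = r"
  by (simp add: H_inj)

text \<open>To the left of \<open>r\<close> the slope of \<open>H\<close> is at least
  \<open>1 / \<Gamma> r\<close>, so \<open>H\<close> has dropped to \<open>u\<close> no later than
  its tangent at \<open>r\<close> does, at \<open>a\<close>. Thus \<open>H\<close> is unbounded
  below and the flow exists for all positive times.\<close>

lemma H_range_down:
  assumes "u \<le> H r"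
  shows "u \<in> range H"
proof -
  define a where "a = r - \<Gamma> r * (H r - u)"
  have ar: "a \<le> r" using assms \<Gamma>_pos[of r] by (simp add: a_def)
  have nz: "\<Gamma> r \<noteq> 0" using \<Gamma>_pos[of r] by simp
  have "H r - r / \<Gamma> r \<ge> H a - a / \<Gamma> r"
  proof (rule DERIV_nonneg_imp_nondecreasing[OF ar])
    fix x assume x: "a \<le> x" "x \<le> r"
    have "((\<lambda>x. H x - x / \<Gamma> r) has_real_derivative 1 / \<Gamma> x - 1 / \<Gamma> r) (at x)"
      using nz by (auto intro!: derivative_eq_intros H_deriv)
    moreover have "1 / \<Gamma> r \<le> 1 / \<Gamma> x"
      using monoD[OF \<Gamma>_mono x(2)] \<Gamma>_pos by (simp add: frac_le)
    ultimately show "\<exists>y. ((\<lambda>x. H x - x / \<Gamma> r) has_real_derivative y) (at x) \<and> 0 \<le> y" by force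
  qed
  then have "H a \<le> u" using nz by (simp add: a_def diff_divide_distrib)
  then obtain x where "H x = u"
    using IVT[of H a u r] assms ar H_isCont by auto
  then show ?thesis by blast
qed

lemma H_inv: "u \<le> H r \<Longrightarrow> H (inv H u) = u"
  using H_range_down f_inv_into_f by metis

lemma inv_H_deriv:
  assumes "u \<in> range H"
  shows "(inv H has_real_derivative \<Gamma> (inv H u)) (at u)"
proof -
  obtain r where r: "u = H r" using assms by auto
  have "isCont (inv H) u"
    unfolding r by (rule isCont_inverse_function[of 1]) (auto simp: inv_H H_isCont)
  moreover have "u < H (r + 1)" using H_strict_mono[of r "r + 1"] r by simp
  ultimately have "(inv H has_real_derivative inverse (1 / \<Gamma> (inv H u))) (at u)"
    using \<Gamma>_pos[of r]
    by (intro DERIV_inverse_function[of H _ _ _ "u - 1" "H (r + 1)"] H_deriv)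
      (auto simp: r inv_H intro: H_inv less_imp_le)
  then show ?thesis by simp
qed

lemma H_flow: "0 \<le> \<tau> \<Longrightarrow> H (flow \<tau> r) = H r - \<tau>"
  unfolding flow_def by (rule H_inv[of _ r]) simp

lemma flow_0: "flow 0 r = r"
  by (simp add: flow_def inv_H)

lemma flow_le: "0 \<le> \<tau> \<Longrightarrow> flow \<tau> r \<le> r"
  using H_flow[of \<tau> r] H_less_iff[of r "flow \<tau> r"] by linarith

lemma flow_mono: "0 \<le> \<tau> \<Longrightarrow> r \<le> r' \<Longrightarrow> flow \<tau> r \<le> flow \<tau> r'"
  using H_flow[of \<tau> r] H_flow[of \<tau> r'] H_less_iff[of "flow \<tau> r'" "flow \<tau> r"] H_less_iff[of r' r]
  by linarith

lemma flow_antimono_time: "0 \<le> \<tau> \<Longrightarrow> \<tau> \<le> \<tau>' \<Longrightarrow> flow \<tau>' r \<le> flow \<tau> r"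
  using H_flow[of \<tau> r] H_flow[of \<tau>' r] H_less_iff[of "flow \<tau> r" "flow \<tau>' r"]
  by linarith

lemma flow_range: "0 \<le> \<tau> \<Longrightarrow> H r - \<tau> \<in> range H"
  by (metis H_flow rangeI)

lemma flow_continuous: "continuous_on ({0..} \<times> UNIV) (\<lambda>(\<tau>, r). flow \<tau> r)"
proof -
  have 1: "continuous_on (range H) (inv H)"
    by (intro continuous_at_imp_continuous_on ballI) (metis DERIV_isCont inv_H_deriv)
  have 2: "continuous_on UNIV H"
    by (intro continuous_at_imp_continuous_on ballI H_isCont)
  show ?thesis
    unfolding flow_def case_prod_unfold
    by (intro continuous_on_compose2[OF 1] continuous_intros continuous_on_compose2[OF 2])
      (auto intro: flow_range)
qed

text \<open>After time \<open>\<tau>\<close> the value of \<open>H\<close> is at most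
  \<open>Sup (range H) - \<tau>\<close>, a level which \<open>H\<close> exceeds at some
  \<open>c\<close> that does not depend on \<open>r\<close>.\<close>

lemma flow_bounded:
  assumes "0 < \<tau>"
  shows "\<exists>C. \<forall>r. flow \<tau> r \<le> C"
proof -
  have "Sup (range H) - \<tau> < Sup (range H)" using assms by simp
  then obtain c where c: "Sup (range H) - \<tau> < H c"
    using less_cSup_iff[OF _ H_bdd] by auto
  have "flow \<tau> r \<le> c" for r
  proof -
    have "H r - \<tau> \<le> Sup (range H) - \<tau>" using H_bdd by (simp add: cSup_upper)
    then have "H (flow \<tau> r) < H c" using c H_flow[of \<tau> r] assms by linarith
    then show ?thesis by (simp add: H_less_iff)
  qed
  then show ?thesis by blast
qed

lemma flow_deriv_time:
  assumes "0 \<le> \<tau>"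
  shows "((\<lambda>\<tau>. flow \<tau> r) has_real_derivative - \<Gamma> (flow \<tau> r)) (at \<tau>)"
proof -
  have "((\<lambda>\<tau>. H r - \<tau>) has_real_derivative -1) (at \<tau>)"
    by (auto intro!: derivative_eq_intros)
  from DERIV_chain2[OF inv_H_deriv[OF flow_range[OF assms]] this]
  show ?thesis by (simp add: flow_def)
qed

lemma flow_deriv:
  assumes "0 \<le> \<tau>"
  shows "(flow \<tau> has_real_derivative \<Gamma> (flow \<tau> r) / \<Gamma> r) (at r)"
proof -
  have "((\<lambda>r. H r - \<tau>) has_real_derivative 1 / \<Gamma> r) (at r)"
    by (auto intro!: derivative_eq_intros H_deriv)
  from DERIV_chain2[OF inv_H_deriv[OF flow_range[OF assms]] this]
  show ?thesis by (simp add: flow_def[abs_def])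
qed

lemma flow_deriv2:
  assumes "0 \<le> \<tau>"
  shows "((\<lambda>r. \<Gamma> (flow \<tau> r) / \<Gamma> r) has_real_derivative
      \<Gamma> (flow \<tau> r) * (\<Gamma>' (flow \<tau> r) - \<Gamma>' r) / (\<Gamma> r)\<^sup>2) (at r)"
  by (rule derivative_eq_intros DERIV_chain2[OF \<Gamma>_deriv] flow_deriv assms \<Gamma>_deriv refl)+
    (use \<Gamma>_pos[of r] in \<open>auto simp: field_simps power2_eq_square\<close>)

lemma flow_deriv_bounds:
  assumes "0 \<le> \<tau>"
  shows "0 < \<Gamma> (flow \<tau> r) / \<Gamma> r" "\<Gamma> (flow \<tau> r) / \<Gamma> r \<le> 1"
  using \<Gamma>_pos monoD[OF \<Gamma>_mono flow_le[OF assms]] by auto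

lemma flow_concave:
  assumes "0 \<le> \<tau>"
  shows "\<Gamma> (flow \<tau> r) * (\<Gamma>' (flow \<tau> r) - \<Gamma>' r) / (\<Gamma> r)\<^sup>2 \<le> 0"
  using \<Gamma>_pos[of "flow \<tau> r"] monoD[OF \<Gamma>'_mono flow_le[OF assms], of r]
  by (intro divide_nonpos_nonneg mult_nonneg_nonpos) auto

end

text \<open>Beyond \<open>a + 1\<close> the increments of \<open>K\<close> are integrals of
  \<open>k\<close> and are dominated by the integral of \<open>f\<close>; on \<open>{a..a+1}\<close>
  compactness suffices. The split keeps the interval of integration inside the open ray where
  \<open>k \<le> f\<close> is known.\<close>

lemma integrable_deriv_imp_bounded:
  fixes K :: "real \<Rightarrow> real"
  assumes K: "\<And>x. (K has_real_derivative k x) (at x)"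
    and cont: "\<And>x. isCont k x"
    and le: "\<And>x. a < x \<Longrightarrow> k x \<le> f x" and f: "set_integrable lborel {a<..} f"
    and f0: "\<And>x. a < x \<Longrightarrow> 0 \<le> f x"
  shows "\<exists>B. \<forall>r>a. K r \<le> B"
proof -
  define I where "I = (LINT x:{a<..}|lborel. f x)"
  have I: "0 \<le> I"
    unfolding I_def set_lebesgue_integral_def by (intro integral_nonneg_AE) (auto simp: f0 indicator_def)
  have 1: "K r - K (a + 1) \<le> I" if r: "a + 1 \<le> r" for r
  proof -
    have FTC: "has_bochner_integral lborel (\<lambda>x. k x * indicator {a+1 .. r} x) (K r - K (a+1))"
      by (rule has_bochner_integral_FTC_Icc_real[OF r K cont])
    then have "K r - K (a+1) = (\<integral>x. k x * indicator {a+1 .. r} x \<partial>lborel)"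
      by (simp add: has_bochner_integral_integral_eq)
    also have "\<dots> \<le> I"
      unfolding I_def set_lebesgue_integral_def
      using FTC f le f0
      by (intro integral_mono) (auto simp: has_bochner_integral_iff set_integrable_def split: split_indicator)
    finally show ?thesis .
  qed
  have "continuous_on {a..a+1} K"
    by (intro continuous_at_imp_continuous_on ballI DERIV_isCont[OF K])
  then have "compact (K ` {a..a+1})" by (intro compact_continuous_image) auto
  then have "bdd_above (K ` {a..a+1})"
    by (meson bounded_imp_bdd_above compact_imp_bounded)
  then obtain B where B: "\<And>x. x \<in> {a..a+1} \<Longrightarrow> K x \<le> B"
    unfolding bdd_above_def by blast
  have "K r \<le> B + I" if "a < r" for r
    using 1[of r] B[of r] B[of "a+1"] that I by (cases "a + 1 \<le> r") force+
  then show ?thesis by blast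
qed

text \<open>An increasing \<open>g\<close> that stayed negative would be bounded, and then
  \<open>1 / \<bar>g\<bar>\<close> would stay away from 0 and not be integrable. \<open>nz\<close>
  guards against \<open>1 / 0 = 0\<close>, by which \<open>g = 0\<close> would have an integrable
  reciprocal.\<close>

lemma mono_integrable_inverse_eventually_pos:
  fixes g :: "real \<Rightarrow> real"
  assumes mono: "mono_on {0..} g" and nz: "\<forall>r>a. g r \<noteq> 0"
    and int: "set_integrable lborel {a<..} (\<lambda>r. 1 / g r)"
  shows "\<exists>r\<ge>0. 0 < g r"
proof (rule ccontr)
  assume c: "\<not> ?thesis"
  define d where "d = max a 0 + 1"
  have neg: "g r < 0" if "r \<ge> d" for r
    proof -
    have "r \<ge> 0" "r > a" using that by (auto simp: d_def)
    then have "\<not> 0 < g r" "g r \<noteq> 0" using c nz by blast+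
    then show ?thesis by simp
  qed
  have gd: "g d \<le> g r" if "r \<ge> d" for r
    using that by (intro mono_onD[OF mono]) (auto simp: d_def)
  have "set_integrable lborel {d<..} (\<lambda>r. \<bar>1 / g r\<bar>)"
    by (intro set_integrable_abs set_integrable_subset[OF int]) (auto simp: d_def)
  then have "\<exists>B. \<forall>r>d. (1 / \<bar>g d\<bar>) * r \<le> B"
  proof (rule integrable_deriv_imp_bounded[rotated 3])
    show "((*) (1 / \<bar>g d\<bar>) has_real_derivative 1 / \<bar>g d\<bar>) (at x)" for x
      by (auto intro!: derivative_eq_intros)
    show "1 / \<bar>g d\<bar> \<le> \<bar>1 / g x\<bar>" if "d < x" for x
      using gd[of x] neg[of x] that by (simp add: abs_divide divide_simps)
  qed auto
  then obtain B where B: "\<And>r. r > d \<Longrightarrow> (1 / \<bar>g d\<bar>) * r \<le> B" by blast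
  define r where "r = max (d + 1) (\<bar>g d\<bar> * (B + 1))"
  have "(1 / \<bar>g d\<bar>) * (\<bar>g d\<bar> * (B + 1)) \<le> (1 / \<bar>g d\<bar>) * r"
    by (intro mult_left_mono) (auto simp: r_def)
  then have "B + 1 \<le> (1 / \<bar>g d\<bar>) * r" using neg[of d] by simp
  moreover have "r > d" by (simp add: r_def)
  ultimately show False using B[of r] by simp
qed

text \<open>Shifting \<open>g\<close> by \<open>m\<close>, truncating it at \<open>1\<close> and averaging over unit intervals gives a
  \<open>C\<^sup>1\<close> convex minorant that grows as fast as \<open>g\<close>.\<close>

lemma coming_down_exists:
  fixes g :: "real \<Rightarrow> real" and m :: real
  assumes cvx: "convex_on {0..} g" and mono: "mono_on {0..} g"
    and int: "\<forall>\<^sub>F a in at_top. (\<forall>r>a. g r \<noteq> 0) \<and> set_integrable lborel {a<..} (\<lambda>r. 1 / g r)"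
  shows "\<exists>\<Gamma> \<Gamma>' H. coming_down \<Gamma> \<Gamma>' H \<and> (\<forall>r. \<Gamma> r \<le> max 1 (g (max 0 (r - m))))"
proof -
  define f where "f r = max 1 (g (max 0 (r - m)))" for r
  have f1: "1 \<le> f r" for r by (simp add: f_def)
  have fmono: "f r \<le> f r'" if "r \<le> r'" for r r'
    unfolding f_def using that by (intro max.mono mono_onD[OF mono]) auto
  \<comment> \<open>\<open>f\<close> is the maximum of 1 and an increasing convex function of the
    convex map \<open>?k\<close>.\<close>
  have fcvx: "convex_on UNIV f"
  proof
    fix t x y :: real assume t: "0 < t" "t < 1"
    let ?k = "\<lambda>r. max 0 (r - m)"
    have "?k ((1 - t) * x + t * y) \<le> (1 - t) * ?k x + t * ?k y"
    proof (rule max.boundedI)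
      show "0 \<le> (1 - t) * ?k x + t * ?k y" using t by simp
      have "(1 - t) * (x - m) \<le> (1 - t) * ?k x" "t * (y - m) \<le> t * ?k y"
        using t by (intro mult_left_mono; simp)+
      then show "(1 - t) * x + t * y - m \<le> (1 - t) * ?k x + t * ?k y"
        by (simp add: algebra_simps)
    qed
    then have "g (?k ((1 - t) * x + t * y)) \<le> g ((1 - t) * ?k x + t * ?k y)"
      using t by (intro mono_onD[OF mono]) auto
    also have "\<dots> \<le> (1 - t) * g (?k x) + t * g (?k y)"
      using convex_onD[OF cvx, of t "?k x" "?k y"] t by simp
    also have "\<dots> \<le> (1 - t) * f x + t * f y"
      unfolding f_def using t by (intro add_mono mult_left_mono) auto
    finally have "g (?k ((1 - t) * x + t * y)) \<le> (1 - t) * f x + t * f y" .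
    moreover have "(1 - t) * 1 + t * 1 \<le> (1 - t) * f x + t * f y"
      using t f1 by (intro add_mono mult_left_mono) auto
    ultimately show "f ((1 - t) *\<^sub>R x + t *\<^sub>R y) \<le> (1 - t) * f x + t * f y"
      by (subst f_def) simp
  qed auto
  have fcont: "isCont f r" for r
    using convex_on_continuous[OF open_UNIV fcvx] by (simp add: continuous_on_eq_continuous_at)
  obtain P where P: "\<And>x. (P has_real_derivative f x) (at x)"
    using einterval_antiderivative[of "-\<infinity>" \<infinity> f] fcont
    by (auto simp: has_real_derivative_iff_has_vector_derivative)
  \<comment> \<open>The averaging window lies to the left of \<open>r\<close>: the average stays
    below \<open>f r\<close>, yet above \<open>f (r - 1)\<close>, so only a shift by 1 is
    lost.\<close>
  define \<Gamma> where "\<Gamma> r = P r - P (r - 1)" for r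
  define \<Gamma>' where "\<Gamma>' r = f r - f (r - 1)" for r
  have \<Gamma>d: "(\<Gamma> has_real_derivative \<Gamma>' r) (at r)" for r
    unfolding \<Gamma>_def[abs_def] \<Gamma>'_def by (auto intro!: derivative_eq_intros DERIV_chain2[OF P] P)
  have \<Gamma>b: "f (r - 1) \<le> \<Gamma> r \<and> \<Gamma> r \<le> f r" for r
  proof -
    obtain z where z: "r - 1 < z" "z < r" "P r - P (r - 1) = (r - (r - 1)) * f z"
      using MVT2[of "r - 1" r P f] P by auto
    then show ?thesis unfolding \<Gamma>_def using fmono[of z r] fmono[of "r - 1" z] by auto
  qed
  have \<Gamma>1: "1 \<le> \<Gamma> r" for r using \<Gamma>b[of r] f1[of "r - 1"] by linarith
  have \<Gamma>m: "mono \<Gamma>"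
  proof
    fix x y :: real assume "x \<le> y"
    then show "\<Gamma> x \<le> \<Gamma> y"
      by (rule DERIV_nonneg_imp_nondecreasing) (use \<Gamma>d fmono in \<open>force simp: \<Gamma>'_def\<close>)
  qed
  have \<Gamma>'m: "mono \<Gamma>'"
  proof
    fix x y :: real assume xy: "x \<le> y"
    \<comment> \<open>\<open>x\<close> and \<open>y - 1\<close> are convex combinations of
      \<open>x - 1\<close> and \<open>y\<close> with exchanged weights; adding the two convexity
      inequalities gives \<open>f x + f (y - 1) \<le> f (x - 1) + f y\<close>.\<close>
    define t where "t = 1 / (y - x + 1)"
    have t: "0 \<le> t" "t \<le> 1" and tt: "t * (y - x + 1) = 1" using xy by (auto simp: t_def)
    have "(1 - t) * (x - 1) + t * y = x" "(1 - (1 - t)) * (x - 1) + (1 - t) * y = y - 1"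
      using tt by (simp_all add: algebra_simps)
    then have "f x \<le> (1 - t) * f (x - 1) + t * f y"
      "f (y - 1) \<le> (1 - (1 - t)) * f (x - 1) + (1 - t) * f y"
      using convex_onD[OF fcvx, of t "x - 1" y] convex_onD[OF fcvx, of "1 - t" "x - 1" y] t by auto
    then show "\<Gamma>' x \<le> \<Gamma>' y" by (simp add: \<Gamma>'_def algebra_simps)
  qed
  have \<Gamma>c: "isCont (\<lambda>r. 1 / \<Gamma> r) r" for r
    using DERIV_isCont[OF \<Gamma>d] \<Gamma>1[of r] by (intro continuous_intros) auto
  obtain H where H: "\<And>x. (H has_real_derivative 1 / \<Gamma> x) (at x)"
    using einterval_antiderivative[of "-\<infinity>" \<infinity> "\<lambda>r. 1 / \<Gamma> r"] \<Gamma>c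
    by (auto simp: has_real_derivative_iff_has_vector_derivative)
  obtain a0 where a0: "\<And>a. a \<ge> a0 \<Longrightarrow> (\<forall>r>a. g r \<noteq> 0) \<and> set_integrable lborel {a<..} (\<lambda>r. 1 / g r)"
    using int by (auto simp: eventually_at_top_linorder)
  obtain r0 where r0: "r0 \<ge> 0" "0 < g r0"
    using mono_integrable_inverse_eventually_pos[OF mono] a0[of a0] by blast
  define a where "a = max a0 r0"
  have gpos: "0 < g r" if "a < r" for r
    using mono_onD[OF mono, of r0 r] r0 that by (auto simp: a_def)
  \<comment> \<open>In the shift \<open>m + 1\<close> the summand \<open>m\<close> undoes the shift
    in \<open>f\<close>, and 1 pays for the averaging window.\<close>
  have le: "1 / \<Gamma> (x + (m + 1)) \<le> 1 / g x" if "a < x" for x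
  proof -
    have "g x \<le> f (x + (m + 1) - 1)" using that r0(1) by (auto simp: f_def a_def)
    also have "\<dots> \<le> \<Gamma> (x + (m + 1))" using \<Gamma>b by blast
    finally show ?thesis using gpos[OF that] by (simp add: frac_le)
  qed
  have "\<exists>B. \<forall>r>a. H (r + (m + 1)) \<le> B"
  proof (rule integrable_deriv_imp_bounded[OF _ _ le])
    show "((\<lambda>r. H (r + (m + 1))) has_real_derivative 1 / \<Gamma> (x + (m + 1))) (at x)" for x
      using H DERIV_shift[of H "1 / \<Gamma> (x + (m + 1))" x "m + 1"] by blast
    show "isCont (\<lambda>x. 1 / \<Gamma> (x + (m + 1))) x" for x
      by (rule isCont_o2[of x "\<lambda>x. x + (m + 1)" "\<lambda>r. 1 / \<Gamma> r"]) (auto intro: \<Gamma>c)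
    show "set_integrable lborel {a<..} (\<lambda>r. 1 / g r)" using a0[of a] by (simp add: a_def)
  qed (auto simp: gpos less_imp_le)
  then obtain B where B: "\<And>r. r > a \<Longrightarrow> H (r + (m + 1)) \<le> B" by blast
  have "H r \<le> B" for r
  proof -
    define r' where "r' = max r (a + m + 2)"
    have "r \<le> r'" by (simp add: r'_def)
    then have "H r \<le> H r'"
    proof (rule DERIV_nonneg_imp_nondecreasing)
      show "\<exists>y. (H has_real_derivative y) (at x) \<and> 0 \<le> y" for x
        using H[of x] \<Gamma>1[of x] by (intro exI[of _ "1 / \<Gamma> x"]) auto
    qed
    also have "\<dots> \<le> B" using B[of "r' - (m + 1)"] by (simp add: r'_def)
    finally show ?thesis .
  qed
  then have "bdd_above (range H)" by (auto simp: bdd_above_def)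
  then have "coming_down \<Gamma> \<Gamma>' H"
    using \<Gamma>1 \<Gamma>d \<Gamma>m \<Gamma>'m H by unfold_locales
  moreover have "\<Gamma> r \<le> max 1 (g (max 0 (r - m)))" for r
    using \<Gamma>b[of r] by (simp add: f_def)
  ultimately show ?thesis by blast
qed

section \<open>A Lyapunov function bounded uniformly in time\<close>

text \<open>Truncated powers are the spline pieces of the cutoff. The exponent is at least 2, as the
  first power has a kink at \<open>c\<close>.\<close>

lemma DERIV_max_0_power:
  "((\<lambda>x::real. max 0 (x - c) ^ Suc (Suc n)) has_real_derivative
     of_nat (Suc (Suc n)) * max 0 (x - c) ^ Suc n) (at x)"
proof -
  consider "x < c" | "x > c" | "x = c" by linarith
  then show ?thesis
  proof cases
    case 1
    have "((\<lambda>x::real. 0) has_real_derivative of_nat (Suc (Suc n)) * max 0 (x - c) ^ Suc n) (at x)"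
      using 1 by simp
    then show ?thesis
      by (rule has_field_derivative_transform_within_open[of _ _ _ "{..<c}"]) (use 1 in auto)
  next
    case 2
    have "((\<lambda>x::real. (x - c) ^ Suc (Suc n)) has_real_derivative
        of_nat (Suc (Suc n)) * max 0 (x - c) ^ Suc n) (at x)"
      using 2 DERIV_power_Suc[of "\<lambda>x. x - c" 1 x UNIV "Suc n"]
      by (auto intro!: derivative_eq_intros simp del: power_Suc)
    then show ?thesis
      by (rule has_field_derivative_transform_within_open[of _ _ _ "{c<..}"]) (use 2 in auto)
  next
    case 3
    have "((\<lambda>h::real. max 0 h ^ Suc n) \<longlongrightarrow> max 0 0 ^ Suc n) (at 0)"
      by (intro tendsto_intros)
    moreover have "max 0 h ^ Suc (Suc n) / h = max 0 h ^ Suc n" for h :: real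
      by (cases "h > 0") auto
    ultimately show ?thesis unfolding 3 DERIV_def by simp
  qed
qed

text \<open>A smooth concave substitute for the minimum of \<open>z\<close> and a constant:
  \<open>A + \<theta> (B - A)\<close> equals \<open>B\<close> where \<open>B \<le> A\<close> and is
  \<open>A\<close> plus a constant where \<open>B \<ge> A + 1\<close>.\<close>

lemma concave_cutoff:
  obtains \<theta> \<theta>' \<theta>'' :: "real \<Rightarrow> real" where
    "\<And>z. (\<theta> has_real_derivative \<theta>' z) (at z)"
    "\<And>z. (\<theta>' has_real_derivative \<theta>'' z) (at z)"
    "\<And>z. \<theta>'' z \<le> 0" "\<And>z. 0 \<le> \<theta>' z" "\<And>z. \<theta>' z \<le> 1"
    "\<And>z. z \<le> 0 \<Longrightarrow> \<theta> z = z" "\<And>z. 1 \<le> z \<Longrightarrow> \<theta>' z = 0"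
proof
  \<comment> \<open>\<open>- \<theta>''\<close> is the tent on \<open>[0, 1]\<close> of height 2 and
    area 1, so that \<open>\<theta>'\<close> falls from 1 to 0; the other two formulas are its
    antiderivatives.\<close>
  define \<theta> \<theta>' \<theta>'' :: "real \<Rightarrow> real"
    where "\<theta> = (\<lambda>z. z - 2/3 * (max 0 (z - 0) ^ 3 - 2 * max 0 (z - 1/2) ^ 3 + max 0 (z - 1) ^ 3))"
      and "\<theta>' = (\<lambda>z. 1 - 2 * (max 0 (z - 0) ^ 2 - 2 * max 0 (z - 1/2) ^ 2 + max 0 (z - 1) ^ 2))"
      and "\<theta>'' = (\<lambda>z. - 4 * (max 0 (z - 0) - 2 * max 0 (z - 1/2) + max 0 (z - 1)))"
  have d3: "((\<lambda>x::real. max 0 (x - c) ^ 3) has_real_derivative 3 * max 0 (x - c) ^ 2) (at x)" for c x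
    using DERIV_max_0_power[of c 1 x] by (simp add: numeral_3_eq_3 numeral_2_eq_2)
  have d2: "((\<lambda>x::real. max 0 (x - c) ^ 2) has_real_derivative 2 * max 0 (x - c)) (at x)" for c x
    using DERIV_max_0_power[of c 0 x] by (simp add: numeral_2_eq_2)
  show "(\<theta> has_real_derivative \<theta>' z) (at z)" for z
    unfolding \<theta>_def \<theta>'_def
    by (rule derivative_eq_intros d3 refl)+ (simp add: algebra_simps)
  show d: "(\<theta>' has_real_derivative \<theta>'' z) (at z)" for z
    unfolding \<theta>'_def \<theta>''_def
    by (rule derivative_eq_intros d2 refl)+ (simp add: algebra_simps)
  show neg: "\<theta>'' z \<le> 0" for z by (simp add: \<theta>''_def max_def)
  show "\<theta> z = z" if "z \<le> 0" for z using that by (simp add: \<theta>_def)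
  have one: "\<theta>' z = 1" if "z \<le> 0" for z using that by (simp add: \<theta>'_def)
  show zero: "\<theta>' z = 0" if "1 \<le> z" for z
    using that by (simp add: \<theta>'_def power2_eq_square algebra_simps)
  have mono: "\<theta>' y \<le> \<theta>' x" if "x \<le> y" for x y
    by (rule DERIV_nonpos_imp_nonincreasing[OF that]) (use d neg in blast)
  show "0 \<le> \<theta>' z" for z using mono[of z "max z 1"] zero[of "max z 1"] by simp
  show "\<theta>' z \<le> 1" for z using mono[of "min z 0" z] one[of "min z 0"] by simp
qed

lemma has_grad_hess_unique_on_open:
  assumes 1: "has_grad_hess f1 g1 H1" and 2: "has_grad_hess f2 g2 H2"
    and U: "open U" and eq: "\<And>x. x \<in> U \<Longrightarrow> f1 x = f2 x" and x: "x \<in> U"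
  shows "g1 x = g2 x" "H1 x = H2 x"
proof -
  have g: "g1 y = g2 y" if "y \<in> U" for y
  proof -
    have "(f2 has_derivative (\<lambda>h. g1 y \<bullet> h)) (at y)"
      using has_derivative_transform_within_open[OF has_grad_hessD(1)[OF 1] U that] eq by blast
    then have "(\<lambda>h. g1 y \<bullet> h) = (\<lambda>h. g2 y \<bullet> h)"
      using has_grad_hessD(1)[OF 2] by (rule has_derivative_unique)
    then show ?thesis by (metis vector_eq_rdot)
  qed
  show "g1 x = g2 x" using g x .
  have "(g2 has_derivative (\<lambda>h. H1 x *v h)) (at x)"
    using has_derivative_transform_within_open[OF has_grad_hessD(2)[OF 1] U x] g by blast
  then have "(\<lambda>h. H1 x *v h) = (\<lambda>h. H2 x *v h)"
    using has_grad_hessD(2)[OF 2] by (rule has_derivative_unique)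
  then show "H1 x = H2 x" by (metis matrix_eq)
qed

text \<open>The overlap is open, so agreement of the functions there entails agreement of gradients
  and Hessians, and each point has a neighbourhood on which a single formula is valid.\<close>

lemma has_grad_hess_glue:
  assumes 1: "has_grad_hess f1 g1 H1" and 2: "has_grad_hess f2 g2 H2"
    and op: "open S" "open T" "S \<union> T = UNIV" and eq: "\<And>x. x \<in> S \<inter> T \<Longrightarrow> f1 x = f2 x"
  shows "has_grad_hess (\<lambda>x. if x \<in> S then f1 x else f2 x)
    (\<lambda>x. if x \<in> S then g1 x else g2 x) (\<lambda>x. if x \<in> S then H1 x else H2 x)"
    (is "has_grad_hess ?f ?g ?H")
proof -
  have ST: "open (S \<inter> T)" using op by auto
  note u = has_grad_hess_unique_on_open[OF 1 2 ST eq]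
  have fT: "?f x = f2 x" and gT: "?g x = g2 x" and HT: "?H x = H2 x" if "x \<in> T" for x
    using that eq u by auto
  show ?thesis unfolding has_grad_hess_def
  proof (intro conjI allI)
    fix x
    show "(?f has_derivative (\<lambda>h. ?g x \<bullet> h)) (at x)"
    proof (cases "x \<in> S")
      case True
      then show ?thesis
        using has_derivative_transform_within_open[OF has_grad_hessD(1)[OF 1] op(1) True, of ?f]
        by simp
    next
      case False
      then have "x \<in> T" using op by auto
      then show ?thesis
        using has_derivative_transform_within_open[OF has_grad_hessD(1)[OF 2] op(2), of x ?f]
          fT gT by simp
    qed
    show "(?g has_derivative (\<lambda>h. ?H x *v h)) (at x)"
    proof (cases "x \<in> S")
      case True
      then show ?thesis
        using has_derivative_transform_within_open[OF has_grad_hessD(2)[OF 1] op(1) True, of ?g]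
        by simp
    next
      case False
      then have "x \<in> T" using op by auto
      then show ?thesis
        using has_derivative_transform_within_open[OF has_grad_hessD(2)[OF 2] op(2), of x ?g]
          gT HT by simp
    qed
  qed
qed

context lyapunov_setting
begin

text \<open>On \<open>ball 0 R\<close> nothing bounds the operator applied to \<open>W\<close> uniformly in time, so \<open>W\<close> is
  replaced there by a multiple of \<open>W0\<close>. A smooth concave minimum of the two functions in the
  annulus \<open>a < W0 < a + 2\<close> keeps the supersolution property, as the second order
  contribution of a concave function has the right sign.\<close>

lemma merged_lyapunov:
  assumes W: "has_grad_hess W gW hW"
    and W_nonneg: "\<And>x. norm x \<ge> R \<Longrightarrow> 0 \<le> W x"
    and g_mono: "mono_on {0..} g"
    and W_ineq: "\<And>s x. norm x \<ge> R \<Longrightarrow> q s x \<bullet> hW x + b s x \<bullet> gW x \<le> - g (W x)"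
  obtains V gV hV m where "has_grad_hess V gV hV"
    "\<exists>c. \<forall>x. c \<le> V x" "\<exists>c. \<forall>x. W x \<le> V x + c"
    "\<And>\<Gamma> :: real \<Rightarrow> real. mono \<Gamma> \<Longrightarrow> (\<And>r. \<Gamma> r \<le> max 1 (g (max 0 (r - m)))) \<Longrightarrow> (\<And>r. 0 \<le> \<Gamma> r) \<Longrightarrow>
       \<exists>C. \<forall>s x. q s x \<bullet> hV x + b s x \<bullet> gV x \<le> C - \<Gamma> (V x)"
proof -
  have "compact (W0 ` cball 0 R)"
    by (intro compact_continuous_image has_grad_hess_continuous[OF W0]) auto
  then obtain a0 where a0: "\<And>x. norm x \<le> R \<Longrightarrow> W0 x \<le> a0"
    by (meson bdd_above_def bounded_imp_bdd_above compact_imp_bounded imageI mem_cball_0)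
  \<comment> \<open>Where \<open>W0\<close> exceeds \<open>a\<close> the ball of radius
    \<open>R\<close> has been left and the inequality for \<open>W\<close> is available.\<close>
  define a where "a = max a0 0"
  have a: "a \<ge> 0" by (simp add: a_def)
  have far: "norm x \<ge> R" if "a < W0 x" for x
    using a0[of x] that by (force simp: a_def)
  define Sub where "Sub = {x. W0 x \<le> a + 2}"
  have Sub: "compact Sub" unfolding Sub_def by (rule compact_sublevel)
  have "compact (W ` Sub)" by (intro compact_continuous_image has_grad_hess_continuous[OF W] Sub)
  then obtain l0 where l0: "\<And>x. x \<in> Sub \<Longrightarrow> \<bar>W x\<bar> \<le> l0"
    using compact_imp_bounded by (fastforce simp: bounded_iff)
  define l where "l = max l0 0"
  have l: "\<bar>W x\<bar> \<le> l" if "W0 x \<le> a + 2" for x using l0[of x] that by (auto simp: l_def Sub_def)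
  have l_ge: "0 \<le> l" by (simp add: l_def)
  \<comment> \<open>Chosen so that \<open>z\<close> has passed both ends of the transition interval
    of \<open>\<theta>\<close>: \<open>z \<ge> - l + m - K * a = 1\<close> where
    \<open>W0 x \<le> a\<close>, and \<open>z \<le> l + m - K * (a + 1) = 0\<close> where
    \<open>W0\<close> lies between \<open>a + 1\<close> and \<open>a + 2\<close>.\<close>
  define K where "K = 2 * l + 1"
  define m where "m = 1 + l + K * a"
  have K: "K > 0" using l_ge by (simp add: K_def)
  define z where "z x = W x + m - K * W0 x" for x
  have z1: "1 \<le> z x" if "W0 x \<le> a" for x
  proof -
    have "K * W0 x \<le> K * a" using that K by (intro mult_left_mono) auto
    then show ?thesis using l[of x] that by (auto simp: z_def m_def)
  qed
  have z0: "z x \<le> 0" if "a + 1 \<le> W0 x" "W0 x \<le> a + 2" for x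
  proof -
    have "K * (a + 1) \<le> K * W0 x" using that K by (intro mult_left_mono) auto
    then show ?thesis using l[of x] that by (auto simp: z_def m_def K_def algebra_simps)
  qed
  obtain \<theta> \<theta>' \<theta>'' :: "real \<Rightarrow> real" where
    \<theta>: "\<And>z. (\<theta> has_real_derivative \<theta>' z) (at z)" "\<And>z. (\<theta>' has_real_derivative \<theta>'' z) (at z)"
      "\<And>z. \<theta>'' z \<le> 0" "\<And>z. 0 \<le> \<theta>' z" "\<And>z. \<theta>' z \<le> 1"
      "\<And>z. z \<le> 0 \<Longrightarrow> \<theta> z = z" "\<And>z. 1 \<le> z \<Longrightarrow> \<theta>' z = 0"
    using concave_cutoff by blast
  define gz where "gz x = gW x - K *\<^sub>R gW0 x" for x
  define hz where "hz x = hW x - K *\<^sub>R hW0 x" for x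
  have "has_grad_hess (\<lambda>x. (W x + m) - K * W0 x) (\<lambda>x. (gW x + 0) - K *\<^sub>R gW0 x)
      (\<lambda>x. (hW x + 0) - K *\<^sub>R hW0 x)"
    by (intro has_grad_hess_diff has_grad_hess_add has_grad_hess_cmult has_grad_hess_const W W0)
  then have zgh: "has_grad_hess z gz hz" by (simp add: z_def[abs_def] gz_def[abs_def] hz_def[abs_def])
  define V1 where "V1 x = K * W0 x + \<theta> (z x)" for x
  define gV1 where "gV1 x = K *\<^sub>R gW0 x + \<theta>' (z x) *\<^sub>R gz x" for x
  define hV1 where "hV1 x = K *\<^sub>R hW0 x + (\<theta>' (z x) *\<^sub>R hz x + \<theta>'' (z x) *\<^sub>R outer_prod (gz x) (gz x))" for x
  have V1: "has_grad_hess V1 gV1 hV1"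
    unfolding V1_def[abs_def] gV1_def[abs_def] hV1_def[abs_def]
    by (intro has_grad_hess_add has_grad_hess_cmult W0 has_grad_hess_compose zgh \<theta>)
  have V2: "has_grad_hess (\<lambda>x. W x + m) (\<lambda>x. gW x + 0) (\<lambda>x. hW x + 0)"
    by (intro has_grad_hess_add has_grad_hess_const W)
  define S where "S = {x. W0 x < a + 2}"
  define T where "T = {x. a + 1 < W0 x}"
  define V where "V x = (if x \<in> S then V1 x else W x + m)" for x
  define gV where "gV x = (if x \<in> S then gV1 x else gW x + 0)" for x
  define hV where "hV x = (if x \<in> S then hV1 x else hW x + 0)" for x
  have V: "has_grad_hess V gV hV"
    unfolding V_def[abs_def] gV_def[abs_def] hV_def[abs_def]
  proof (rule has_grad_hess_glue[OF V1 V2])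
    show "open S" "open T" unfolding S_def T_def
      by (intro open_Collect_less has_grad_hess_continuous[OF W0] continuous_on_const)+
    show "S \<union> T = UNIV" by (auto simp: S_def T_def)
    show "V1 x = W x + m" if "x \<in> S \<inter> T" for x
      using z0[of x] that \<theta>(6)[of "z x"] by (auto simp: S_def T_def V1_def z_def)
  qed
  have "compact (V ` Sub)" by (intro compact_continuous_image has_grad_hess_continuous[OF V] Sub)
  then obtain v where v: "\<And>x. x \<in> Sub \<Longrightarrow> \<bar>V x\<bar> \<le> v"
    using compact_imp_bounded by (fastforce simp: bounded_iff)
  have out: "x \<notin> S \<and> V x = W x + m \<and> W x \<ge> 0 \<and> norm x \<ge> R" if "x \<notin> Sub" for x
    using that far[of x] W_nonneg[of x] by (auto simp: Sub_def S_def V_def)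
  have low: "min (- v) m \<le> V x" for x
    using v[of x] out[of x] by (cases "x \<in> Sub") auto
  have up: "W x \<le> V x + max (l + v) (- m)" for x
    using v[of x] out[of x] l[of x] by (cases "x \<in> Sub") (auto simp: Sub_def)
  \<comment> \<open>\<open>\<Gamma>\<close> is quantified only here, because the shift
    \<open>m\<close> that it has to match is fixed by the gluing.\<close>
  have main: "\<exists>C. \<forall>s x. q s x \<bullet> hV x + b s x \<bullet> gV x \<le> C - \<Gamma> (V x)"
    if \<Gamma>: "mono \<Gamma>" "\<And>r. \<Gamma> r \<le> max 1 (g (max 0 (r - m)))" "\<And>r. 0 \<le> \<Gamma> r" for \<Gamma> :: "real \<Rightarrow> real"
  proof -
    define C where "C = K * (\<bar>lam\<bar> * (a + 2)) + \<bar>g 0\<bar> + 1 + \<Gamma> v"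
    have "q s x \<bullet> hV x + b s x \<bullet> gV x \<le> C - \<Gamma> (V x)" for s x
    proof (cases "x \<in> S")
      case True
      define A0 where "A0 = q s x \<bullet> hW0 x + b s x \<bullet> gW0 x"
      define AW where "AW = q s x \<bullet> hW x + b s x \<bullet> gW x"
      define E where "E = (q s x *v gz x) \<bullet> gz x"
      \<comment> \<open>A convex combination of the operator applied to \<open>K * W0\<close> and to
        \<open>W\<close>, plus a term with the sign of \<open>\<theta>''\<close>. The weight of the
        uncontrolled second part vanishes where \<open>W0 x \<le> a\<close>; elsewhere
        \<open>norm x \<ge> R\<close>.\<close>
      have "q s x \<bullet> hV x + b s x \<bullet> gV x
          = (1 - \<theta>' (z x)) * (K * A0) + \<theta>' (z x) * AW + \<theta>'' (z x) * E"
        using True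
        by (simp add: hV_def gV_def hV1_def gV1_def inner_add_right inner_diff_right
            inner_outer_prod gz_def hz_def A0_def AW_def E_def algebra_simps)
      also have "\<theta>'' (z x) * E \<le> 0"
        using \<theta>(3)[of "z x"] q_psd[of s x "gz x"] by (intro mult_nonpos_nonneg) (auto simp: E_def)
      also have "(1 - \<theta>' (z x)) * (K * A0) \<le> 1 * (K * (\<bar>lam\<bar> * (a + 2)))"
      proof -
        have "A0 \<le> lam * W0 x" using W0_lyap by (simp add: A0_def)
        also have "\<dots> \<le> \<bar>lam\<bar> * (a + 2)"
          using True W0_pos[of x] by (intro mult_mono) (auto simp: S_def)
        finally have "K * A0 \<le> K * (\<bar>lam\<bar> * (a + 2))" using K by (intro mult_left_mono) auto
        then have "(1 - \<theta>' (z x)) * (K * A0) \<le> (1 - \<theta>' (z x)) * (K * (\<bar>lam\<bar> * (a + 2)))"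
          by (rule mult_left_mono) (use \<theta>(5)[of "z x"] in auto)
        also have "\<dots> \<le> 1 * (K * (\<bar>lam\<bar> * (a + 2)))"
          using \<theta>(4)[of "z x"] K a by (intro mult_right_mono) auto
        finally show ?thesis .
      qed
      also have "\<theta>' (z x) * AW \<le> \<bar>g 0\<bar>"
      proof (cases "W0 x \<le> a")
        case True
        then show ?thesis using \<theta>(7)[OF z1] by simp
      next
        case False
        then have x: "norm x \<ge> R" using far by auto
        have "g 0 \<le> g (W x)" using W_nonneg[OF x] by (intro mono_onD[OF g_mono]) auto
        then have "AW \<le> \<bar>g 0\<bar>" using W_ineq[OF x, of s] by (simp add: AW_def)
        then have "\<theta>' (z x) * AW \<le> \<theta>' (z x) * \<bar>g 0\<bar>" using \<theta>(4) by (intro mult_left_mono)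
        also have "\<dots> \<le> 1 * \<bar>g 0\<bar>" using \<theta>(5) by (intro mult_right_mono) auto
        finally show ?thesis by simp
      qed
      also have "\<Gamma> (V x) \<le> \<Gamma> v"
        using v[of x] True by (intro monoD[OF \<Gamma>(1)]) (auto simp: S_def Sub_def)
      ultimately show ?thesis by (simp add: C_def)
    next
      case False
      then have x: "norm x \<ge> R" using far[of x] by (auto simp: S_def)
      have "g 0 \<le> g (W x)" using W_nonneg[OF x] by (intro mono_onD[OF g_mono]) auto
      \<comment> \<open>The shift in the bound for \<open>\<Gamma>\<close> cancels the summand
        \<open>m\<close> of \<open>V\<close>, and truncation at 1 costs at most
        \<open>1 + \<bar>g 0\<bar>\<close>, since \<open>g (W x) \<ge> g 0\<close>.\<close>
      then have "max 1 (g (W x)) \<le> g (W x) + 1 + \<bar>g 0\<bar>" by auto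
      moreover have "\<Gamma> (V x) \<le> max 1 (g (W x))"
        using \<Gamma>(2)[of "V x"] False W_nonneg[OF x] by (simp add: V_def)
      moreover have "q s x \<bullet> hV x + b s x \<bullet> gV x \<le> - g (W x)"
        using W_ineq[OF x, of s] False by (simp add: hV_def gV_def)
      moreover have "0 \<le> K * (\<bar>lam\<bar> * (a + 2)) + \<Gamma> v"
        using K a \<Gamma>(3) by (intro add_nonneg_nonneg mult_nonneg_nonneg) auto
      ultimately show ?thesis unfolding C_def by linarith
    qed
    then show ?thesis by blast
  qed
  show thesis using that[of V gV hV m] V low up main by blast
qed

end

section \<open>Uniform bounds for the transition measures\<close>

lemma bounded_classical_solutionD:
  assumes "bounded_classical_solution q b s \<phi> u"
    and q_sym: "\<And>s x. transpose (q s x) = q s x"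
  shows "\<exists>B. \<forall>t\<ge>s. \<forall>x. \<bar>u t x\<bar> \<le> B"
    and "continuous_on ({s..} \<times> UNIV) (\<lambda>(t, x). u t x)"
    and "\<And>t. s < t \<Longrightarrow> has_grad_hess (u t) (grad (u t)) (hess (u t))"
    and "\<And>t x. s < t \<Longrightarrow> ((\<lambda>r. u r x) has_real_derivative
           q t x \<bullet> hess (u t) x + b t x \<bullet> grad (u t) x) (at t)"
    and "\<And>x. u s x = apply_bcontfun \<phi> x"
proof -
  note sol = assms(1)[unfolded bounded_classical_solution_def]
  obtain B where B: "\<forall>z\<in>(\<lambda>(t, x). u t x) ` ({s..} \<times> UNIV). norm z \<le> B"
    using conjunct1[OF sol] unfolding bounded_iff by (rule exE)
  have "\<forall>t\<ge>s. \<forall>x. \<bar>u t x\<bar> \<le> B"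
  proof (intro allI impI)
    fix t x assume "s \<le> t"
    then have "u t x \<in> (\<lambda>(t, x). u t x) ` ({s..} \<times> UNIV)"
      by (intro image_eqI[of _ _ "(t, x)"]) auto
    then show "\<bar>u t x\<bar> \<le> B" using B by (metis real_norm_def)
  qed
  then show "\<exists>B. \<forall>t\<ge>s. \<forall>x. \<bar>u t x\<bar> \<le> B" by blast
  show "continuous_on ({s..} \<times> UNIV) (\<lambda>(t, x). u t x)" using sol by blast
  show "has_grad_hess (u t) (grad (u t)) (hess (u t))" if "s < t" for t
    using sol that C2_fun_has_grad_hess by blast
  show "((\<lambda>r. u r x) has_real_derivative q t x \<bullet> hess (u t) x + b t x \<bullet> grad (u t) x) (at t)"
    if "s < t" for t x
  proof -
    have "(\<lambda>r. u r x) differentiable (at t)" using sol that by blast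
    then have "((\<lambda>r. u r x) has_real_derivative deriv (\<lambda>r. u r x) t) (at t)"
      by (simp add: DERIV_deriv_iff_real_differentiable)
    moreover have "deriv (\<lambda>r. u r x) t = ell_op q b t (u t) x" using sol that by blast
    ultimately show ?thesis by (simp add: ell_op_eq_inner q_sym)
  qed
  show "u s x = apply_bcontfun \<phi> x" for x using sol by blast
qed

context lyapunov_setting
begin

text \<open>The comparison principle for \<open>v - u\<close>. It may start at a time
  \<open>s\<close> later than the initial time \<open>s0\<close> of \<open>u\<close>; uniqueness
  from an intermediate time and the propagation of constants depend on this.\<close>

lemma solution_le_supersolution:
  assumes sol: "bounded_classical_solution q b s0 \<phi> u" and s: "s0 \<le> s"
    and cont: "continuous_on ({s..T} \<times> UNIV) (\<lambda>(t, x). v t x)"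
    and bdd: "\<And>t x. t \<in> {s..T} \<Longrightarrow> M \<le> v t x"
    and init: "\<And>x. u s x \<le> v s x"
    and C2: "\<And>t. t \<in> {s<..T} \<Longrightarrow> has_grad_hess (v t) (g t) (H t)"
    and dt: "\<And>t x. t \<in> {s<..T} \<Longrightarrow> ((\<lambda>r. v r x) has_real_derivative d t x) (at t)"
    and super: "\<And>t x. t \<in> {s<..T} \<Longrightarrow> q t x \<bullet> H t x + b t x \<bullet> g t x \<le> d t x"
    and t: "t \<in> {s..T}"
  shows "u t x \<le> v t x"
proof -
  note u = bounded_classical_solutionD[OF sol q_sym]
  obtain B where B: "\<And>t x. s0 \<le> t \<Longrightarrow> \<bar>u t x\<bar> \<le> B" using u(1) by blast
  have "0 \<le> v t x - u t x"
  proof (rule parabolic_comparison[where w = "\<lambda>t x. v t x - u t x" and s = s and T = T and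
        M = "M - B" and g = "\<lambda>t x. g t x - grad (u t) x" and H = "\<lambda>t x. H t x - hess (u t) x" and
        d = "\<lambda>t x. d t x - (q t x \<bullet> hess (u t) x + b t x \<bullet> grad (u t) x)"])
    show "continuous_on ({s..T} \<times> UNIV) (\<lambda>(t, x). v t x - u t x)"
    proof -
      have "{s..T} \<times> UNIV \<subseteq> {s0..} \<times> (UNIV :: (real ^ 'n) set)" using s by auto
      from continuous_on_diff[OF cont continuous_on_subset[OF u(2) this]]
      show ?thesis by (simp add: case_prod_unfold)
    qed
    show "M - B \<le> v t x - u t x" if "t \<in> {s..T}" for t x
      using bdd[OF that, of x] B[of t x] that s by (auto simp: abs_le_iff)
    show "0 \<le> v s x - u s x" for x using init[of x] by simp
    show "has_grad_hess (\<lambda>x. v t x - u t x) (\<lambda>x. g t x - grad (u t) x) (\<lambda>x. H t x - hess (u t) x)"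
      if "t \<in> {s<..T}" for t
      using that s by (intro has_grad_hess_diff C2 u(3)) auto
    show "((\<lambda>r. v r x - u r x) has_real_derivative
        d t x - (q t x \<bullet> hess (u t) x + b t x \<bullet> grad (u t) x)) (at t)"
      if "t \<in> {s<..T}" for t x
      using that s by (intro DERIV_diff dt u(4)) auto
    show "q t x \<bullet> (H t x - hess (u t) x) + b t x \<bullet> (g t x - grad (u t) x)
       \<le> d t x - (q t x \<bullet> hess (u t) x + b t x \<bullet> grad (u t) x)" if "t \<in> {s<..T}" for t x
      using super[OF that, of x] by (simp add: inner_diff_right)
  qed (fact t)
  then show ?thesis by simp
qed

text \<open>The two solutions may have different initial times and data and need to agree at time
  \<open>s\<close> only; this is the form that yields the evolution law.\<close>

lemma solution_unique:
  assumes 1: "bounded_classical_solution q b s1 \<phi>1 u1" "s1 \<le> s"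
    and 2: "bounded_classical_solution q b s2 \<phi>2 u2" "s2 \<le> s"
    and eq: "\<And>x. u1 s x = u2 s x" and t: "s \<le> t"
  shows "u1 t x = u2 t x"
proof -
  have le: "u t x \<le> v t x"
    if u: "bounded_classical_solution q b s1 \<phi>1 u" "s1 \<le> s"
      and v: "bounded_classical_solution q b s2 \<phi>2 v" "s2 \<le> s"
      and eq: "\<And>x. u s x = v s x" for s1 \<phi>1 u s2 \<phi>2 v
  proof -
    note vD = bounded_classical_solutionD[OF v(1) q_sym]
    obtain B where B: "\<And>t x. s2 \<le> t \<Longrightarrow> \<bar>v t x\<bar> \<le> B" using vD(1) by blast
    show ?thesis
    proof (rule solution_le_supersolution[OF u, of t v "- B" "\<lambda>t. grad (v t)" "\<lambda>t. hess (v t)"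
          "\<lambda>t x. q t x \<bullet> hess (v t) x + b t x \<bullet> grad (v t) x"])
      show "continuous_on ({s..t} \<times> UNIV) (\<lambda>(t, x). v t x)"
        using v(2) by (intro continuous_on_subset[OF vD(2)]) auto
      show "- B \<le> v r y" if "r \<in> {s..t}" for r y
        using B[of r y] that v(2) by (simp add: abs_le_iff)
    qed (use v(2) t eq vD in auto)
  qed
  show ?thesis using le[OF 1 2 eq] le[OF 2 1] eq by (simp add: antisym)
qed

lemma solution_le_const:
  assumes sol: "bounded_classical_solution q b s0 \<phi> u" and s: "s0 \<le> s"
    and le: "\<And>x. u s x \<le> M" and t: "s \<le> t"
  shows "u t x \<le> M"
  using solution_le_supersolution[OF sol s, of t "\<lambda>_ _. M" M "\<lambda>_ _. 0" "\<lambda>_ _. 0" "\<lambda>_ _. 0"] le t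
  by (simp add: has_grad_hess_const case_prod_unfold)

text \<open>If \<open>A V \<le> C - \<Gamma>(V)\<close>, then \<open>C (t - s) + flow (t - s) (V x)\<close> is a supersolution, because
  the flow of \<open>- \<Gamma>\<close> is a concave nonexpansive function of its initial value.\<close>

lemma solution_le_uniform:
  assumes cd: "coming_down \<Gamma> \<Gamma>' h"
    and V: "has_grad_hess V gV hV" and V_low: "\<And>x. c \<le> V x"
    and AV: "\<And>s x. q s x \<bullet> hV x + b s x \<bullet> gV x \<le> C - \<Gamma> (V x)"
    and \<delta>: "0 < \<delta>"
  shows "\<exists>M. \<forall>s \<phi> u t x. bounded_classical_solution q b s \<phi> u \<longrightarrow>
    (\<forall>x. apply_bcontfun \<phi> x \<le> V x) \<longrightarrow> s + \<delta> \<le> t \<longrightarrow> u t x \<le> M"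
proof -
  interpret coming_down \<Gamma> \<Gamma>' h by (fact cd)
  \<comment> \<open>Nonnegativity lets the factor \<open>k t x \<le> 1\<close> be dropped from
    \<open>k t x * C'\<close>, and keeps \<open>v\<close> above the flow.\<close>
  define C' where "C' = max C 0"
  have AV': "q s x \<bullet> hV x + b s x \<bullet> gV x \<le> C' - \<Gamma> (V x)" for s x
    using AV[of s x] by (simp add: C'_def)
  obtain D where D: "\<And>r. flow \<delta> r \<le> D" using flow_bounded[OF \<delta>] by blast
  have "u t x \<le> C' * \<delta> + D"
    if u: "bounded_classical_solution q b s \<phi> u" and le: "\<And>x. apply_bcontfun \<phi> x \<le> V x"
      and t: "s + \<delta> \<le> t" for s \<phi> u t x
  proof -
    define v where "v t x = C' * (t - s) + flow (t - s) (V x)" for t x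
    define k where "k t x = \<Gamma> (flow (t - s) (V x)) / \<Gamma> (V x)" for t x
    define k' where "k' t x = \<Gamma> (flow (t - s) (V x)) * (\<Gamma>' (flow (t - s) (V x)) - \<Gamma>' (V x)) / (\<Gamma> (V x))\<^sup>2"
      for t x
    \<comment> \<open>The leading \<open>0\<close> is the derivative of the part of \<open>v\<close>
      that is constant in \<open>x\<close>; it is kept so that the introduction rules match.\<close>
    define g where "g t x = 0 + k t x *\<^sub>R gV x" for t x
    define H where "H t x = 0 + (k t x *\<^sub>R hV x + k' t x *\<^sub>R outer_prod (gV x) (gV x))" for t x
    define d where "d t x = C' - \<Gamma> (flow (t - s) (V x))" for t x
    \<comment> \<open>The supersolution serves up to time \<open>s + \<delta>\<close>; later on the
      constant reached there is itself a supersolution.\<close>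
    have "u (s + \<delta>) x \<le> v (s + \<delta>) x" for x
    proof (rule solution_le_supersolution[OF u order_refl, of "s + \<delta>" v "flow \<delta> c" g H d])
      have 1: "continuous_on UNIV V" using has_grad_hess_continuous[OF V] .
      have "continuous_on ({s..s + \<delta>} \<times> UNIV) (\<lambda>p. flow (fst p - s) (V (snd p)))"
      proof -
        have 2: "continuous_on ({s..s + \<delta>} \<times> UNIV) (\<lambda>p. (fst p - s, V (snd p)))"
          by (intro continuous_intros continuous_on_compose2[OF 1]) auto
        have 3: "(\<lambda>p. (fst p - s, V (snd p))) ` ({s..s + \<delta>} \<times> UNIV) \<subseteq> {0..} \<times> UNIV"
          by auto
        from continuous_on_compose2[OF flow_continuous 2 3] show ?thesis by simp
      qed
      then show "continuous_on ({s..s + \<delta>} \<times> UNIV) (\<lambda>(t, x). v t x)"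
        unfolding v_def case_prod_unfold by (intro continuous_intros)
      show "flow \<delta> c \<le> v t x" if t: "t \<in> {s..s + \<delta>}" for t x
      proof -
        have "flow \<delta> c \<le> flow (t - s) c" using t by (intro flow_antimono_time) auto
        also have "\<dots> \<le> flow (t - s) (V x)" using t V_low by (intro flow_mono) auto
        also have "\<dots> \<le> v t x" using t by (simp add: v_def C'_def)
        finally show ?thesis .
      qed
      show "u s x \<le> v s x" for x
        using bounded_classical_solutionD(5)[OF u q_sym] le by (simp add: v_def flow_0)
      show "has_grad_hess (v t) (g t) (H t)" if "t \<in> {s<..s + \<delta>}" for t
        unfolding v_def[abs_def] g_def[abs_def] H_def[abs_def] k_def k'_def
        using that by (intro has_grad_hess_add has_grad_hess_const
            has_grad_hess_compose[OF V] flow_deriv flow_deriv2) auto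
      show "((\<lambda>r. v r x) has_real_derivative d t x) (at t)" if "t \<in> {s<..s + \<delta>}" for t x
      proof -
        have "((\<lambda>r. flow (r - s) (V x)) has_real_derivative - \<Gamma> (flow (t - s) (V x)) * 1) (at t)"
          using that by (intro DERIV_chain2[where f = "\<lambda>\<tau>. flow \<tau> (V x)"] flow_deriv_time)
            (auto intro!: derivative_eq_intros)
        then show ?thesis
          unfolding v_def d_def by (auto intro!: derivative_eq_intros)
      qed
      show "q t x \<bullet> H t x + b t x \<bullet> g t x \<le> d t x" if t: "t \<in> {s<..s + \<delta>}" for t x
      proof -
        have ts: "0 \<le> t - s" using t by simp
        have k: "0 < k t x" "k t x \<le> 1"
          using flow_deriv_bounds[OF ts, of "V x"] by (auto simp: k_def)
        have "q t x \<bullet> H t x + b t x \<bullet> g t x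
            = k t x * (q t x \<bullet> hV x + b t x \<bullet> gV x) + k' t x * ((q t x *v gV x) \<bullet> gV x)"
          by (simp add: H_def g_def inner_add_right inner_outer_prod algebra_simps)
        also have "k' t x * ((q t x *v gV x) \<bullet> gV x) \<le> 0"
          using flow_concave[OF ts, of "V x"] q_psd unfolding k'_def by (intro mult_nonpos_nonneg)
        also have "k t x * (q t x \<bullet> hV x + b t x \<bullet> gV x) \<le> k t x * (C' - \<Gamma> (V x))"
          using AV' k by (intro mult_left_mono) auto
        \<comment> \<open>\<open>k\<close> is the spatial derivative of the flow, so
          \<open>k t x * \<Gamma> (V x)\<close> is exactly the speed of the flow and cancels against
          the time derivative.\<close>
        also have "\<dots> = k t x * C' - \<Gamma> (flow (t - s) (V x))"
          using \<Gamma>_pos[of "V x"] by (simp add: k_def field_simps)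
        also have "k t x * C' \<le> 1 * C'"
          using k by (intro mult_right_mono) (auto simp: C'_def)
        finally show ?thesis by (simp add: d_def)
      qed
    qed (use \<delta> in auto)
    then have "u (s + \<delta>) x \<le> C' * \<delta> + D" for x
      using D[of "V x"] by (force simp: v_def intro: order_trans)
    then show ?thesis
      by (rule solution_le_const[OF u _ _ t, rotated]) (use \<delta> in auto)
  qed
  then show ?thesis by blast
qed

end

section \<open>From bounded functions to an unbounded integrand\<close>

lemma apply_bcontfun_Bcontfun:
  assumes "continuous_on UNIV f" "\<And>x. \<bar>f x\<bar> \<le> (B::real)"
  shows "apply_bcontfun (Bcontfun f) = f"
  using assms by (intro Bcontfun_inverse) (auto simp: bcontfun_def bounded_iff)

text \<open>The functions \<open>min V n\<close> are admissible bounded minorants and increase to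
  \<open>V\<close>; subtracting \<open>c\<close> makes monotone convergence applicable.\<close>

lemma nn_integral_le_of_truncations:
  fixes V :: "'a::euclidean_space \<Rightarrow> real"
  assumes P: "prob_space P" "sets P = sets borel"
    and V: "continuous_on UNIV V" "\<And>x. c \<le> V x"
    and le: "\<And>\<phi>. (\<And>x. apply_bcontfun \<phi> x \<le> V x) \<Longrightarrow> (\<integral>y. apply_bcontfun \<phi> y \<partial>P) \<le> M"
  shows "(\<integral>\<^sup>+ y. ennreal (V y - c) \<partial>P) \<le> ennreal (M - c)"
proof -
  interpret prob_space P by (fact P(1))
  define f where "f n y = min (V y) (real n)" for n y
  have meas: "f n \<in> borel_measurable P" for n
  proof -
    have "continuous_on UNIV (f n)" unfolding f_def[abs_def] by (intro continuous_intros V(1))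
    then show ?thesis
      using borel_measurable_continuous_onI measurable_cong_sets[OF P(2) refl] by blast
  qed
  have bd: "\<bar>f n y\<bar> \<le> real n + \<bar>c\<bar>" for n y using V(2)[of y] by (auto simp: f_def)
  define h where "h n y = ennreal (f n y - c)" for n y
  have int: "integrable P (f n)" for n
    by (rule integrable_const_bound[OF _ meas]) (use bd in auto)
  have fM: "(\<integral>y. f n y \<partial>P) \<le> M" for n
  proof -
    have "apply_bcontfun (Bcontfun (f n)) = f n"
      by (rule apply_bcontfun_Bcontfun[OF _ bd]) (unfold f_def, intro continuous_intros V(1))
    then show ?thesis using le[of "Bcontfun (f n)"] by (simp add: f_def)
  qed
  \<comment> \<open>From \<open>N\<close> on the truncations stay above \<open>c\<close>, so that
    \<open>ennreal\<close> cuts nothing off in \<open>h\<close>.\<close>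
  obtain N :: nat where N: "c \<le> real N" using real_arch_simple by blast
  have bound: "(\<integral>\<^sup>+ y. h (n + N) y \<partial>P) \<le> ennreal (M - c)" for n
  proof -
    have "0 \<le> f (n + N) y - c" for y using V(2)[of y] N by (auto simp: f_def)
    then have "(\<integral>\<^sup>+ y. h (n + N) y \<partial>P) = ennreal (\<integral>y. f (n + N) y - c \<partial>P)"
      unfolding h_def using int by (intro nn_integral_eq_integral) auto
    also have "(\<integral>y. f (n + N) y - c \<partial>P) = (\<integral>y. f (n + N) y \<partial>P) - c"
      using int by (simp add: prob_space)
    finally show ?thesis using fM[of "n + N"] by (simp add: ennreal_leI)
  qed
  have "(\<integral>\<^sup>+ y. ennreal (V y - c) \<partial>P) \<le> (\<integral>\<^sup>+ y. (SUP n. h (n + N) y) \<partial>P)"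
  proof (intro nn_integral_mono)
    fix y
    obtain n :: nat where "V y \<le> real n" using real_arch_simple by blast
    then have "ennreal (V y - c) = h (n + N) y" by (simp add: h_def f_def)
    then show "ennreal (V y - c) \<le> (SUP n. h (n + N) y)" using SUP_upper[of n UNIV "\<lambda>n. h (n + N) y"] by simp
  qed
  also have "\<dots> = (SUP n. \<integral>\<^sup>+ y. h (n + N) y \<partial>P)"
  proof (rule nn_integral_monotone_convergence_SUP)
    show "incseq (\<lambda>n. h (n + N))"
      by (auto simp: incseq_def le_fun_def h_def f_def intro!: ennreal_leI)
    show "h (n + N) \<in> borel_measurable P" for n
      unfolding h_def using meas by measurable
  qed
  also have "\<dots> \<le> ennreal (M - c)" using bound by (intro SUP_least)
  finally show ?thesis .
qed

context lyapunov_setting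
begin

text \<open>The bound is for the positive part of \<open>W\<close>, as \<open>ennreal\<close> is 0
  on negative reals. In this form it serves both the extended integral and the tightness.\<close>

lemma nn_integral_transition_le:
  assumes G: "evolution_operator q b G" and p: "transition_measures G p"
    and W: "has_grad_hess W gW hW"
    and W_nonneg: "\<And>x. norm x \<ge> R \<Longrightarrow> 0 \<le> W x"
    and g_convex: "convex_on {0..} g" and g_mono: "mono_on {0..} g"
    and g_integrable: "\<forall>\<^sub>F a in at_top.
          (\<forall>r>a. g r \<noteq> 0) \<and> set_integrable lborel {a<..} (\<lambda>r. 1 / g r)"
    and W_ineq: "\<And>s x. norm x \<ge> R \<Longrightarrow> q s x \<bullet> hW x + b s x \<bullet> gW x \<le> - g (W x)"
    and \<delta>: "0 < \<delta>"
  shows "\<exists>C>0. \<forall>s t x. s \<le> t - \<delta> \<longrightarrow> (\<integral>\<^sup>+ y. ennreal (W y) \<partial>(p t s x)) \<le> ennreal C"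
proof (rule merged_lyapunov[OF W W_nonneg g_mono W_ineq])
  fix V gV hV m
  assume V: "has_grad_hess V gV hV"
    and low: "\<exists>c. \<forall>x. c \<le> V x" and up: "\<exists>c. \<forall>x. W x \<le> V x + c"
    and AV: "\<And>\<Gamma> :: real \<Rightarrow> real. mono \<Gamma> \<Longrightarrow> (\<And>r. \<Gamma> r \<le> max 1 (g (max 0 (r - m)))) \<Longrightarrow> (\<And>r. 0 \<le> \<Gamma> r) \<Longrightarrow>
       \<exists>C. \<forall>s x. q s x \<bullet> hV x + b s x \<bullet> gV x \<le> C - \<Gamma> (V x)"
  obtain c c' where c: "\<And>x. c \<le> V x" and c': "\<And>x. W x \<le> V x + c'" using low up by blast
  obtain \<Gamma> \<Gamma>' h where cd: "coming_down \<Gamma> \<Gamma>' h" and \<Gamma>: "\<And>r. \<Gamma> r \<le> max 1 (g (max 0 (r - m)))"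
    using coming_down_exists[OF g_convex g_mono g_integrable] by blast
  obtain C where C: "\<And>s x. q s x \<bullet> hV x + b s x \<bullet> gV x \<le> C - \<Gamma> (V x)"
    using AV[OF coming_down.\<Gamma>_mono[OF cd] \<Gamma> less_imp_le[OF coming_down.\<Gamma>_pos[OF cd]]] by blast
  obtain M where M: "\<And>s \<phi> u t x. bounded_classical_solution q b s \<phi> u \<Longrightarrow>
    (\<And>x. apply_bcontfun \<phi> x \<le> V x) \<Longrightarrow> s + \<delta> \<le> t \<Longrightarrow> u t x \<le> M"
    using solution_le_uniform[OF cd V c C \<delta>] by blast
  \<comment> \<open>Absolute values, because \<open>ennreal\<close> is additive on nonnegative reals
    only; the 1 makes \<open>D\<close> positive.\<close>
  define D where "D = \<bar>M - c\<bar> + \<bar>c + c'\<bar> + 1"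
  have "(\<integral>\<^sup>+ y. ennreal (W y) \<partial>(p t s x)) \<le> ennreal D" if st: "s \<le> t - \<delta>" for s t x
  proof -
    have lt: "s < t" using st \<delta> by linarith
    have P: "prob_space (p t s x)" "sets (p t s x) = sets borel"
      and pG: "\<And>\<phi>. apply_bcontfun (G t s \<phi>) x = (\<integral>y. apply_bcontfun \<phi> y \<partial>(p t s x))"
      using p lt unfolding transition_measures_def by blast+
    have trunc: "(\<integral>y. apply_bcontfun \<phi> y \<partial>(p t s x)) \<le> M" if "\<And>x. apply_bcontfun \<phi> x \<le> V x" for \<phi>
      using M[OF G[unfolded evolution_operator_def, rule_format, of s \<phi>] that, of t x] st
      by (simp add: pG)
    have *: "(\<integral>\<^sup>+ y. ennreal (V y - c) \<partial>(p t s x)) \<le> ennreal (M - c)"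
      by (rule nn_integral_le_of_truncations[OF P has_grad_hess_continuous[OF V] c trunc])
    have meas: "V \<in> borel_measurable (p t s x)"
      using borel_measurable_continuous_onI[OF has_grad_hess_continuous[OF V]]
        measurable_cong_sets[OF P(2) refl] by blast
    interpret prob_space "p t s x" by (fact P(1))
    have "(\<integral>\<^sup>+ y. ennreal (W y) \<partial>(p t s x)) \<le> (\<integral>\<^sup>+ y. ennreal (V y - c) + ennreal \<bar>c + c'\<bar> \<partial>(p t s x))"
    proof (intro nn_integral_mono)
      fix y
      have "W y \<le> (V y - c) + \<bar>c + c'\<bar>" using c'[of y] by linarith
      then show "ennreal (W y) \<le> ennreal (V y - c) + ennreal \<bar>c + c'\<bar>"
        using c[of y] by (subst ennreal_plus[symmetric]) (auto intro!: ennreal_leI simp del: ennreal_plus)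
    qed
    also have "\<dots> = (\<integral>\<^sup>+ y. ennreal (V y - c) \<partial>(p t s x)) + ennreal \<bar>c + c'\<bar>"
      using meas by (subst nn_integral_add) (auto simp: emeasure_space_1)
    also have "\<dots> \<le> ennreal \<bar>M - c\<bar> + ennreal \<bar>c + c'\<bar>"
      using * by (intro add_right_mono order_trans[OF *] ennreal_leI) auto
    also have "\<dots> \<le> ennreal D"
      by (subst ennreal_plus[symmetric]) (auto simp: D_def intro!: ennreal_leI simp del: ennreal_plus)
    finally show ?thesis .
  qed
  moreover have "D > 0" by (simp add: D_def)
  ultimately show ?thesis by blast
qed

end

lemma ext_integral_le_nn_integral:
  assumes "(\<integral>\<^sup>+ y. ennreal (f y) \<partial>M) \<le> ennreal C" "0 \<le> C"
  shows "ext_integral M f \<le> ereal C"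
proof -
  have "enn2ereal (\<integral>\<^sup>+ y. ennreal (f y) \<partial>M) \<le> ereal C"
    using assms by (metis enn2ereal_ennreal less_eq_ennreal.rep_eq)
  moreover have "0 \<le> enn2ereal (\<integral>\<^sup>+ y. ennreal (- f y) \<partial>M)" by simp
  ultimately show ?thesis
    unfolding ext_integral_def by (metis ereal_diff_le_self order_trans)
qed

text \<open>Markov's inequality at the level \<open>C / \<epsilon>\<close>, which \<open>W\<close>
  reaches outside a ball.\<close>

lemma tight_family_of_nn_integral:
  fixes W :: "'a::euclidean_space \<Rightarrow> real"
  assumes P: "\<And>p. p \<in> P \<Longrightarrow> prob_space p \<and> sets p = sets borel"
    and C: "0 < C" "\<And>p. p \<in> P \<Longrightarrow> (\<integral>\<^sup>+ y. ennreal (W y) \<partial>p) \<le> ennreal C"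
    and lim: "filterlim W at_top at_infinity"
  shows "tight_family P"
  unfolding tight_family_def
proof (intro allI impI)
  fix \<epsilon> :: real assume \<epsilon>: "0 < \<epsilon>"
  have "\<forall>\<^sub>F x in at_infinity. C / \<epsilon> \<le> W x"
    using lim by (simp add: filterlim_at_top)
  then obtain r where r: "\<And>x. r \<le> norm x \<Longrightarrow> C / \<epsilon> \<le> W x"
    by (auto simp: eventually_at_infinity)
  define \<rho> where "\<rho> = max r 1"
  have "1 - \<epsilon> \<le> measure p (ball 0 \<rho>)" if p: "p \<in> P" for p
  proof -
    interpret prob_space p using P[OF p] by blast
    have s: "sets p = sets borel" and sp: "space p = UNIV"
      using P[OF p] sets_eq_imp_space_eq[of p borel] by auto
    have A: "- ball 0 \<rho> \<in> sets p" by (simp add: s)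
    have "ennreal (C / \<epsilon>) * emeasure p (- ball 0 \<rho>) = (\<integral>\<^sup>+ y. ennreal (C / \<epsilon>) * indicator (- ball 0 \<rho>) y \<partial>p)"
      using A by (simp add: nn_integral_cmult_indicator)
    also have "\<dots> \<le> (\<integral>\<^sup>+ y. ennreal (W y) \<partial>p)"
      by (intro nn_integral_mono) (auto simp: indicator_def \<rho>_def intro!: ennreal_leI r)
    also have "\<dots> \<le> ennreal C" using C p by blast
    finally have "ennreal (C / \<epsilon> * measure p (- ball 0 \<rho>)) \<le> ennreal C"
      using C \<epsilon> by (subst ennreal_mult) (auto simp: emeasure_eq_measure)
    then have "C / \<epsilon> * measure p (- ball 0 \<rho>) \<le> C" using C by (simp add: ennreal_le_iff)
    then have "measure p (- ball 0 \<rho>) \<le> \<epsilon>" using C \<epsilon> by (simp add: field_simps)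
    moreover have "measure p (- ball 0 \<rho>) = 1 - measure p (ball 0 \<rho>)"
      using prob_compl[of "ball 0 \<rho>"] by (simp add: s sp Compl_eq_Diff_UNIV)
    ultimately show ?thesis by simp
  qed
  then show "\<exists>\<rho>>0. \<forall>p\<in>P. 1 - \<epsilon> \<le> measure p (ball 0 \<rho>)"
    by (intro exI[of _ \<rho>]) (auto simp: \<rho>_def)
qed

section \<open>Interior Hoelder estimate\<close>

lemma trace_eq_inner: "trace Q = Q \<bullet> mat 1"
  by (simp add: inner_mat_1)

lemma norm_outer_prod: "norm (outer_prod u v) = norm u * norm v"
proof -
  have "(norm (outer_prod u v))\<^sup>2 = (norm u * norm v)\<^sup>2"
    by (simp add: power2_norm_eq_inner inner_outer_prod outer_prod_mult_vec power_mult_distrib)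
  then show ?thesis by (simp add: power2_eq_iff_nonneg)
qed

text \<open>The norm on matrices is the Frobenius norm; the quadratic form is the pairing with a
  rank one matrix.\<close>

lemma abs_inner_matrix_vector_le:
  fixes A :: "real ^ 'n ^ 'n"
  shows "\<bar>(A *v x) \<bullet> x\<bar> \<le> norm A * (norm x)\<^sup>2"
  using Cauchy_Schwarz_ineq2[of A "outer_prod x x"]
  by (simp add: inner_outer_prod norm_outer_prod power2_eq_square)

lemma transpose_outer_prod: "transpose (outer_prod u u) = outer_prod u u"
  by (simp add: transpose_def outer_prod_def mult.commute)

lemma transpose_diff: "transpose (A - B :: real ^ 'n ^ 'n) = transpose A - transpose B"
  by (simp add: transpose_def vec_eq_iff)

lemma transpose_add: "transpose (A + B :: real ^ 'n ^ 'n) = transpose A + transpose B"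
  by (simp add: transpose_def vec_eq_iff)

lemma transpose_scaleR: "transpose (c *\<^sub>R A :: real ^ 'n ^ 'n) = c *\<^sub>R transpose A"
  by (simp add: transpose_def vec_eq_iff)

lemmas mv_simps = matrix_vector_mult_diff_rdistrib matrix_vector_mult_add_rdistrib
  scaleR_matrix_vector_assoc[symmetric] inner_diff_left inner_add_left outer_prod_mult_vec

text \<open>The diffusions are coupled synchronously except for the fixed amount \<open>\<theta>\<close> in the
  direction of \<open>z\<close>, which is reflected, and for the small discrepancy \<open>\<kappa>\<close> of the two
  matrices, which is left independent.\<close>

lemma coupling_estimate:
  fixes X Y Q1 Q2 :: "real ^ 'n ^ 'n" and z :: "real ^ 'n" and S K L \<kappa> \<theta> :: real
  assumes z: "z \<noteq> 0" and S: "0 \<le> S" and K: "0 \<le> K" and L: "0 \<le> L" and \<kappa>: "0 \<le> \<kappa>" and \<theta>: "0 \<le> \<theta>"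
    and form: "\<And>\<xi> \<zeta>. (X *v \<xi>) \<bullet> \<xi> - (Y *v \<zeta>) \<bullet> \<zeta>
      \<le> K * (S * ((\<xi> - \<zeta>) \<bullet> (\<xi> - \<zeta>)) - 3/2 * S * (z \<bullet> (\<xi> - \<zeta>))\<^sup>2 / (z \<bullet> z)) + 2 * L * (\<xi> \<bullet> \<xi>)"
    and sym: "transpose Q1 = Q1" "transpose Q2 = Q2"
    and ell: "\<And>\<xi>. (\<kappa> + \<theta>) * (norm \<xi>)\<^sup>2 \<le> (Q1 *v \<xi>) \<bullet> \<xi>"
    and close: "\<And>\<xi>. \<bar>((Q2 - Q1) *v \<xi>) \<bullet> \<xi>\<bar> \<le> \<kappa> * (norm \<xi>)\<^sup>2"
  shows "Q1 \<bullet> X - Q2 \<bullet> Y \<le> K * S * (3 * CARD('n) * \<kappa> - 2 * \<theta>)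
      + 2 * L * (trace Q1 + \<kappa> * CARD('n) + \<theta>)"
proof -
  let ?d = "real CARD('n)"
  let ?I = "mat 1 :: real ^ 'n ^ 'n"
  define e where "e = z /\<^sub>R norm z"
  define E where "E = outer_prod e e"
  have "norm e = 1" using z by (simp add: e_def)
  then have e: "norm e = 1" "e \<bullet> e = 1" by (simp_all add: norm_eq_1)
  have tr1: "?I \<bullet> ?I = ?d" by (simp add: inner_mat_1 trace_I)
  have trE: "E \<bullet> ?I = 1"
    by (subst inner_commute) (simp add: E_def inner_outer_prod e)
  have ineq: "(X *v \<xi>) \<bullet> \<xi> - (Y *v \<zeta>) \<bullet> \<zeta> \<le> K * S * ((\<xi> - \<zeta>) \<bullet> (\<xi> - \<zeta>)) + 2 * L * (\<xi> \<bullet> \<xi>)" for \<xi> \<zeta>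
  proof -
    have "K * (S * ((\<xi> - \<zeta>) \<bullet> (\<xi> - \<zeta>)) - 3/2 * S * (z \<bullet> (\<xi> - \<zeta>))\<^sup>2 / (z \<bullet> z))
        \<le> K * (S * ((\<xi> - \<zeta>) \<bullet> (\<xi> - \<zeta>)))"
      using K S by (intro mult_left_mono) auto
    then show ?thesis using form[of \<xi> \<zeta>] by (simp add: mult.assoc)
  qed
  \<comment> \<open>\<open>Q1\<close> splits into \<open>P\<close>,
    \<open>\<kappa> *\<^sub>R ?I\<close> and \<open>\<theta> *\<^sub>R E\<close>, and
    \<open>Q2\<close> into \<open>P\<close>, \<open>N\<close> and
    \<open>\<theta> *\<^sub>R E\<close>. The lower bound for \<open>Q1\<close> makes
    \<open>P\<close> nonnegative, the closeness assumption gives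
    \<open>0 \<le> N \<le> 2 * \<kappa>\<close>.\<close>
  define P where "P = Q1 - \<kappa> *\<^sub>R ?I - \<theta> *\<^sub>R E"
  define N where "N = Q2 - Q1 + \<kappa> *\<^sub>R ?I"
  \<comment> \<open>Synchronous part: on the diagonal \<open>\<xi> = \<zeta>\<close> the singular
    terms of \<open>form\<close> vanish and only \<open>L\<close> remains.\<close>
  have "0 \<le> P \<bullet> ((2 * L) *\<^sub>R ?I - X + Y)"
  proof (rule inner_psd_nonneg)
    show "transpose P = P"
      by (simp add: P_def E_def transpose_diff transpose_scaleR transpose_outer_prod transpose_mat sym)
    fix \<xi>
    have "(e \<bullet> \<xi>)\<^sup>2 \<le> (norm \<xi>)\<^sup>2"
      using Cauchy_Schwarz_ineq[of e \<xi>] e by (simp add: power2_norm_eq_inner)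
    then have "\<theta> * (e \<bullet> \<xi>)\<^sup>2 \<le> \<theta> * (norm \<xi>)\<^sup>2" using \<theta> by (rule mult_left_mono)
    then show "0 \<le> (P *v \<xi>) \<bullet> \<xi>"
      using ell[of \<xi>] unfolding power2_norm_eq_inner
      by (simp add: P_def E_def mv_simps power2_eq_square algebra_simps)
    show "0 \<le> (((2 * L) *\<^sub>R ?I - X + Y) *v \<xi>) \<bullet> \<xi>"
      using ineq[of \<xi> \<xi>] by (simp add: mv_simps)
  qed
  then have 1: "P \<bullet> X - P \<bullet> Y \<le> 2 * L * (trace Q1 - \<kappa> * ?d - \<theta>)"
    by (simp add: inner_add_right inner_diff_right)
      (simp add: P_def inner_diff_left tr1 trE trace_eq_inner)
  have "0 \<le> \<kappa> * ?d" using \<kappa> by simp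
  then have "2 * L * (trace Q1 - \<kappa> * ?d - \<theta>) \<le> 2 * L * trace Q1"
    using L \<theta> by (intro mult_left_mono) auto
  with 1 have 1: "P \<bullet> X - P \<bullet> Y \<le> 2 * L * trace Q1" by linarith
  \<comment> \<open>Independent part: \<open>\<zeta> = 0\<close> bounds \<open>X\<close> from above,
    and below \<open>\<xi> = 0\<close> bounds \<open>Y\<close> from below.\<close>
  have "0 \<le> ?I \<bullet> ((K * S + 2 * L) *\<^sub>R ?I - X)"
  proof (rule inner_psd_nonneg)
    show "0 \<le> (((K * S + 2 * L) *\<^sub>R ?I - X) *v \<xi>) \<bullet> \<xi>" for \<xi>
      using ineq[of \<xi> 0] by (simp add: mv_simps algebra_simps)
  qed (simp_all add: transpose_mat)
  then have 2: "\<kappa> * (?I \<bullet> X) \<le> \<kappa> * ((K * S + 2 * L) * ?d)"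
    using \<kappa> by (intro mult_left_mono) (simp_all add: inner_diff_right tr1)
  have Npsd: "0 \<le> (N *v \<xi>) \<bullet> \<xi>" and Nle: "(N *v \<xi>) \<bullet> \<xi> \<le> 2 * \<kappa> * (norm \<xi>)\<^sup>2" for \<xi>
    using close[of \<xi>] by (auto simp: N_def mv_simps power2_norm_eq_inner abs_le_iff)
  have "0 \<le> N \<bullet> ((K * S) *\<^sub>R ?I + Y)"
  proof (rule inner_psd_nonneg)
    show "transpose N = N"
      by (simp add: N_def transpose_diff transpose_add transpose_scaleR transpose_mat sym)
    show "0 \<le> (((K * S) *\<^sub>R ?I + Y) *v \<xi>) \<bullet> \<xi>" for \<xi>
      using ineq[of 0 \<xi>] by (simp add: mv_simps algebra_simps)
  qed (fact Npsd)
  then have 3: "- (N \<bullet> Y) \<le> K * S * (N \<bullet> ?I)" by (simp add: inner_add_right)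
  have "0 \<le> ?I \<bullet> ((2 * \<kappa>) *\<^sub>R ?I - N)"
  proof (rule inner_psd_nonneg)
    show "0 \<le> (((2 * \<kappa>) *\<^sub>R ?I - N) *v \<xi>) \<bullet> \<xi>" for \<xi>
      using Nle[of \<xi>] by (simp add: mv_simps power2_norm_eq_inner)
  qed (simp_all add: transpose_mat)
  then have "N \<bullet> ?I \<le> 2 * \<kappa> * ?d" by (simp add: inner_diff_right tr1 inner_commute)
  then have "K * S * (N \<bullet> ?I) \<le> K * S * (2 * \<kappa> * ?d)" using K S by (intro mult_left_mono) auto
  with 3 have 3: "- (N \<bullet> Y) \<le> K * S * (2 * \<kappa> * ?d)" by linarith
  \<comment> \<open>Reflected part: for \<open>\<xi> = e\<close> and \<open>\<zeta> = - e\<close>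
    the bracket is \<open>4 * S - 6 * S\<close>, the negative term that drives the whole
    estimate.\<close>
  have "(X *v e) \<bullet> e - (Y *v (- e)) \<bullet> (- e) \<le> K * (- 2 * S) + 2 * L"
  proof -
    have ee: "e - (- e) = 2 *\<^sub>R e" by (simp add: scaleR_2)
    have "(z \<bullet> e)\<^sup>2 = z \<bullet> z"
      using z by (simp add: e_def power2_norm_eq_inner[symmetric] power2_eq_square field_simps
          flip: power2_norm_eq_inner)
    then have "3/2 * S * (z \<bullet> (2 *\<^sub>R e))\<^sup>2 / (z \<bullet> z) = 6 * S" using z by (simp add: power_mult_distrib)
    moreover have "S * ((2 *\<^sub>R e) \<bullet> (2 *\<^sub>R e)) = 4 * S" by (simp add: e)
    ultimately have "S * ((2 *\<^sub>R e) \<bullet> (2 *\<^sub>R e)) - 3/2 * S * (z \<bullet> (2 *\<^sub>R e))\<^sup>2 / (z \<bullet> z) = - 2 * S"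
      by linarith
    then show ?thesis using form[of e "- e"] unfolding ee by (simp only: e mult_1_right)
  qed
  then have "E \<bullet> X - E \<bullet> Y \<le> - 2 * (K * S) + 2 * L"
    using linear_neg[OF matrix_vector_mul_linear[of Y], of e]
    by (simp add: E_def inner_outer_prod inner_commute[of "outer_prod e e"] mult.commute)
  then have "\<theta> * (E \<bullet> X - E \<bullet> Y) \<le> \<theta> * (- 2 * (K * S) + 2 * L)" using \<theta> by (rule mult_left_mono)
  moreover have "Q1 \<bullet> X - Q2 \<bullet> Y
     = (P \<bullet> X - P \<bullet> Y) + \<kappa> * (?I \<bullet> X) - N \<bullet> Y + \<theta> * (E \<bullet> X - E \<bullet> Y)"
    by (simp add: P_def N_def inner_diff_left inner_add_left algebra_simps)
  ultimately show ?thesis using 1 2 3 by (simp add: algebra_simps)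
qed

text \<open>First and second derivative of \<open>|z|^(1/2)\<close> along a line. For
  \<open>h\<close> parallel to \<open>z\<close> the second one is negative: the coefficient 3/2
  exceeds 1.\<close>

lemma quarter_power_line:
  fixes z h :: "'a::real_inner"
  assumes "z \<noteq> 0"
  defines "p \<equiv> \<lambda>r. (z + r *\<^sub>R h) \<bullet> (z + r *\<^sub>R h)"
  defines "f' \<equiv> \<lambda>r. 1/2 * p r powr (-3/4) * ((z + r *\<^sub>R h) \<bullet> h)"
  shows "p r > 0 \<Longrightarrow> ((\<lambda>r. p r powr (1/4)) has_real_derivative f' r) (at r)"
    and "(f' has_real_derivative (1/2 * (z \<bullet> z) powr (-3/4)) * (h \<bullet> h)
       - 3/2 * (1/2 * (z \<bullet> z) powr (-3/4)) * (z \<bullet> h)\<^sup>2 / (z \<bullet> z)) (at 0)"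
proof -
  have p_eq: "p = (\<lambda>r. z \<bullet> z + 2 * r * (z \<bullet> h) + r^2 * (h \<bullet> h))"
    by (simp add: p_def fun_eq_iff inner_add_left inner_add_right inner_commute power2_eq_square algebra_simps)
  have l_eq: "(\<lambda>r. (z + r *\<^sub>R h) \<bullet> h) = (\<lambda>r. z \<bullet> h + r * (h \<bullet> h))"
    by (simp add: inner_add_left)
  have dp: "(p has_real_derivative 2 * ((z + r *\<^sub>R h) \<bullet> h)) (at r)" for r
    unfolding p_eq by (auto intro!: derivative_eq_intros simp: inner_add_left algebra_simps)
  have dl: "((\<lambda>r. (z + r *\<^sub>R h) \<bullet> h) has_real_derivative h \<bullet> h) (at r)" for r
    unfolding l_eq by (auto intro!: derivative_eq_intros)
  have dpow: "((\<lambda>r. p r powr c) has_real_derivative c * p r powr (c - 1) * (2 * ((z + r *\<^sub>R h) \<bullet> h))) (at r)"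
    if "p r > 0" for r c
    using DERIV_fun_powr[OF dp that, of c] by (simp add: mult_ac)
  show "((\<lambda>r. p r powr (1/4)) has_real_derivative f' r) (at r)" if "p r > 0"
    using dpow[OF that, of "1/4"] by (simp add: f'_def mult_ac)
  have p0: "p 0 = z \<bullet> z" "p 0 > 0" using assms(1) by (simp_all add: p_def)
  have d0: "(f' has_real_derivative
     1/2 * (-3/4 * p 0 powr (-3/4 - 1) * (2 * ((z + 0 *\<^sub>R h) \<bullet> h))) * ((z + 0 *\<^sub>R h) \<bullet> h)
     + 1/2 * p 0 powr (-3/4) * (h \<bullet> h)) (at 0)"
    unfolding f'_def
    by (rule derivative_eq_intros dpow dl p0(2) refl)+ (simp add: algebra_simps)
  have pw: "p 0 powr (-3/4 - 1) = (z \<bullet> z) powr (-3/4) / (z \<bullet> z)"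
    using powr_diff[of "z \<bullet> z" "-3/4" 1] p0 by simp
  show "(f' has_real_derivative (1/2 * (z \<bullet> z) powr (-3/4)) * (h \<bullet> h)
       - 3/2 * (1/2 * (z \<bullet> z) powr (-3/4)) * (z \<bullet> h)\<^sup>2 / (z \<bullet> z)) (at 0)"
    by (rule DERIV_cong[OF d0]) (unfold pw, simp add: p0 power2_eq_square algebra_simps)
qed

text \<open>Second derivative test along the lines in direction \<open>(\<xi>, \<zeta>)\<close> of
  the doubled space. As \<open>u\<close> and \<open>v\<close> are twice differentiable, this takes
  the place of Ishii's lemma. Taking \<open>\<zeta> = 0\<close> or \<open>\<xi> = 0\<close> in the
  first order condition separates the two gradients.\<close>

lemma doubled_max:
  fixes u v :: "real ^ 'n \<Rightarrow> real"
  assumes u: "has_grad_hess u gu hu" and v: "has_grad_hess v gv hv" and z: "x \<noteq> y"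
    and max: "\<And>x' y'. u x' - v y' - K * ((x' - y') \<bullet> (x' - y')) powr (1/4) - L * ((x' - x0) \<bullet> (x' - x0))
       \<le> u x - v y - K * ((x - y) \<bullet> (x - y)) powr (1/4) - L * ((x - x0) \<bullet> (x - x0))"
  defines "S \<equiv> 1/2 * ((x - y) \<bullet> (x - y)) powr (-3/4)"
  shows "gu x = (K * S) *\<^sub>R (x - y) + (2 * L) *\<^sub>R (x - x0)" "gv y = (K * S) *\<^sub>R (x - y)"
    "(hu x *v \<xi>) \<bullet> \<xi> - (hv y *v \<zeta>) \<bullet> \<zeta>
      \<le> K * (S * ((\<xi> - \<zeta>) \<bullet> (\<xi> - \<zeta>)) - 3/2 * S * ((x - y) \<bullet> (\<xi> - \<zeta>))\<^sup>2 / ((x - y) \<bullet> (x - y))) + 2 * L * (\<xi> \<bullet> \<xi>)"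
proof -
  have *: "K * (S * ((x - y) \<bullet> (\<xi> - \<zeta>))) + 2 * L * ((x - x0) \<bullet> \<xi>) - gu x \<bullet> \<xi> + gv y \<bullet> \<zeta> = 0 \<and>
    0 \<le> K * (S * ((\<xi> - \<zeta>) \<bullet> (\<xi> - \<zeta>)) - 3/2 * S * ((x - y) \<bullet> (\<xi> - \<zeta>))\<^sup>2 / ((x - y) \<bullet> (x - y)))
       + 2 * L * (\<xi> \<bullet> \<xi>) - (hu x *v \<xi>) \<bullet> \<xi> + (hv y *v \<zeta>) \<bullet> \<zeta>" for \<xi> \<zeta>
  proof -
    define z h where "z = x - y" and "h = \<xi> - \<zeta>"
    have z0: "z \<noteq> 0" using z by (simp add: z_def)
    let ?p = "\<lambda>r. (z + r *\<^sub>R h) \<bullet> (z + r *\<^sub>R h)"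
    define F where "F r = K * ?p r powr (1/4) + L * (((x + r *\<^sub>R \<xi>) - x0) \<bullet> ((x + r *\<^sub>R \<xi>) - x0))
        - u (x + r *\<^sub>R \<xi>) + v (y + r *\<^sub>R \<zeta>)" for r
    define F' where "F' r = K * (1/2 * ?p r powr (-3/4) * ((z + r *\<^sub>R h) \<bullet> h))
        + L * (2 * (((x + r *\<^sub>R \<xi>) - x0) \<bullet> \<xi>)) - gu (x + r *\<^sub>R \<xi>) \<bullet> \<xi> + gv (y + r *\<^sub>R \<zeta>) \<bullet> \<zeta>" for r
    \<comment> \<open>For \<open>\<bar>r\<bar> < d\<close> the segment avoids the origin, where the
      modulus is not differentiable; the 1 covers \<open>h = 0\<close>.\<close>
    define d where "d = norm z / (norm h + 1)"
    have d: "0 < d" using z0 by (simp add: d_def add_nonneg_pos)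
    have ppos: "?p r > 0" if "\<bar>r\<bar> < d" for r
    proof -
      have "\<bar>r\<bar> * norm h \<le> \<bar>r\<bar> * (norm h + 1)" by (simp add: algebra_simps)
      also have "\<dots> < d * (norm h + 1)" using that by (intro mult_strict_right_mono) (auto simp: add_nonneg_pos)
      also have "\<dots> = norm z" by (simp add: d_def add_nonneg_eq_0_iff)
      finally have "norm (r *\<^sub>R h) < norm z" by simp
      then have "z + r *\<^sub>R h \<noteq> 0" by (metis add_eq_0_iff norm_minus_cancel less_irrefl)
      then show ?thesis by simp
    qed
    have dq: "((\<lambda>r. ((x + r *\<^sub>R \<xi>) - x0) \<bullet> ((x + r *\<^sub>R \<xi>) - x0)) has_real_derivative
        2 * (((x + r *\<^sub>R \<xi>) - x0) \<bullet> \<xi>)) (at r)" for r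
    proof -
      have "(\<lambda>r. ((x + r *\<^sub>R \<xi>) - x0) \<bullet> ((x + r *\<^sub>R \<xi>) - x0))
          = (\<lambda>r. (x - x0) \<bullet> (x - x0) + 2 * r * ((x - x0) \<bullet> \<xi>) + r^2 * (\<xi> \<bullet> \<xi>))"
        by (simp add: fun_eq_iff inner_add_left inner_add_right inner_diff_left inner_diff_right
            inner_commute power2_eq_square algebra_simps)
      then show ?thesis
        by (auto intro!: derivative_eq_intros simp: inner_add_left inner_diff_left algebra_simps)
    qed
    have dq': "((\<lambda>r. 2 * (((x + r *\<^sub>R \<xi>) - x0) \<bullet> \<xi>)) has_real_derivative 2 * (\<xi> \<bullet> \<xi>)) (at r)" for r
    proof -
      have "(\<lambda>r. 2 * (((x + r *\<^sub>R \<xi>) - x0) \<bullet> \<xi>)) = (\<lambda>r. 2 * ((x - x0) \<bullet> \<xi>) + r * (2 * (\<xi> \<bullet> \<xi>)))"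
        by (simp add: fun_eq_iff inner_add_left inner_diff_left algebra_simps)
      then show ?thesis by (auto intro!: derivative_eq_intros)
    qed
    have F: "(F has_real_derivative F' r) (at r)" if "\<bar>r\<bar> < d" for r
      unfolding F_def F'_def
      by (intro DERIV_add DERIV_diff DERIV_cmult quarter_power_line(1) z0 ppos that dq
          has_grad_hess_line(1)[OF u] has_grad_hess_line(1)[OF v])
    have F': "(F' has_real_derivative
        K * ((1/2 * (z \<bullet> z) powr (-3/4)) * (h \<bullet> h) - 3/2 * (1/2 * (z \<bullet> z) powr (-3/4)) * (z \<bullet> h)\<^sup>2 / (z \<bullet> z))
        + L * (2 * (\<xi> \<bullet> \<xi>)) - (hu (x + 0 *\<^sub>R \<xi>) *v \<xi>) \<bullet> \<xi> + (hv (y + 0 *\<^sub>R \<zeta>) *v \<zeta>) \<bullet> \<zeta>) (at 0)"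
      unfolding F'_def
      by (intro DERIV_add DERIV_diff DERIV_cmult quarter_power_line(2) z0 dq'
          has_grad_hess_line(2)[OF u] has_grad_hess_line(2)[OF v])
    have min: "F 0 \<le> F r" for r
    proof -
      have eq: "z + r *\<^sub>R h = (x + r *\<^sub>R \<xi>) - (y + r *\<^sub>R \<zeta>)"
        by (simp add: z_def h_def algebra_simps)
      show ?thesis
        using max[of "x + r *\<^sub>R \<xi>" "y + r *\<^sub>R \<zeta>"] unfolding F_def eq by (simp add: z_def)
    qed
    show ?thesis
      using second_deriv_nonneg_at_min[OF d F F' min]
      by (simp add: F'_def z_def h_def S_def algebra_simps)
  qed
  show "gv y = (K * S) *\<^sub>R (x - y)"
    by (rule vector_eq_rdot[THEN iffD1]) (use *[of 0] in \<open>auto simp: algebra_simps\<close>)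
  show "gu x = (K * S) *\<^sub>R (x - y) + (2 * L) *\<^sub>R (x - x0)"
    by (rule vector_eq_rdot[THEN iffD1]) (use *[of _ 0] in \<open>auto simp: algebra_simps inner_add_left\<close>)
  show "(hu x *v \<xi>) \<bullet> \<xi> - (hv y *v \<zeta>) \<bullet> \<zeta>
      \<le> K * (S * ((\<xi> - \<zeta>) \<bullet> (\<xi> - \<zeta>)) - 3/2 * S * ((x - y) \<bullet> (\<xi> - \<zeta>))\<^sup>2 / ((x - y) \<bullet> (x - y))) + 2 * L * (\<xi> \<bullet> \<xi>)"
    using *[of \<xi> \<zeta>] by linarith
qed

lemma quarter_power_continuous:
  fixes z :: "'b::topological_space \<Rightarrow> 'a::real_inner"
  assumes "continuous_on S z"
  shows "continuous_on S (\<lambda>x. (z x \<bullet> z x) powr (1/4))"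
  using assms by (intro continuous_on_powr' continuous_intros) auto

text \<open>If the estimate failed, the doubled function \<open>\<Phi>\<close> would have a positive
  maximum, which its penalties force off the initial time, the lateral boundary and the diagonal;
  there the equation is contradicted. \<open>K\<close> is chosen before \<open>\<phi>\<close> and
  \<open>u\<close>.\<close>

lemma interior_Holder:
  fixes q :: "real \<Rightarrow> real ^ 'n \<Rightarrow> real ^ 'n ^ 'n" and b :: "real \<Rightarrow> real ^ 'n \<Rightarrow> real ^ 'n"
  assumes q_sym: "\<And>s x. transpose (q s x) = q s x"
    and \<eta>: "0 < \<eta>" and ell: "\<And>s x \<xi>. \<eta> * (norm \<xi>)\<^sup>2 \<le> (q s x *v \<xi>) \<bullet> \<xi>"
    and q_cont: "continuous_on UNIV (\<lambda>(s, x). q s x)"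
    and b_cont: "continuous_on UNIV (\<lambda>(s, x). b s x)"
    and st: "s < t0"
  shows "\<exists>K. \<forall>\<phi> u x y. bounded_classical_solution q b s \<phi> u \<longrightarrow> (\<forall>t\<ge>s. \<forall>x. \<bar>u t x\<bar> \<le> M) \<longrightarrow>
     norm x \<le> \<rho> \<longrightarrow> u t0 x - u t0 y \<le> K * ((x - y) \<bullet> (x - y)) powr (1/4)"
proof -
  \<comment> \<open>At a positive value of \<open>\<Phi>\<close> the point \<open>x\<close> is
    within 1 of \<open>x1\<close>, and \<open>y\<close> within \<open>r1 \<le> 1\<close> of
    \<open>x\<close>.\<close>
  define Z where "Z = {s..t0} \<times> cball (0 :: real ^ 'n) (\<rho> + 2)"
  have Z: "compact Z" unfolding Z_def by (intro compact_Times compact_Icc compact_cball)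
  define M' where "M' = \<bar>M\<bar>"
  have qZ: "continuous_on Z (\<lambda>(s, x). q s x)" and bZ: "continuous_on Z (\<lambda>(s, x). b s x)"
    using q_cont b_cont continuous_on_subset by blast+
  obtain B1 where B1: "\<And>p. p \<in> Z \<Longrightarrow> norm (q (fst p) (snd p)) \<le> B1"
    using compact_imp_bounded[OF compact_continuous_image[OF qZ Z]]
    by (fastforce simp: bounded_iff case_prod_unfold)
  obtain B2 where B2: "\<And>p. p \<in> Z \<Longrightarrow> norm (b (fst p) (snd p)) \<le> B2"
    using compact_imp_bounded[OF compact_continuous_image[OF bZ Z]]
    by (fastforce simp: bounded_iff case_prod_unfold)
  define B where "B = max 0 (max B1 B2)"
  have B0: "0 \<le> B" by (simp add: B_def)
  have qB: "norm (q t x) \<le> B" and bB: "norm (b t x) \<le> B"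
    if "t \<in> {s..t0}" "norm x \<le> \<rho> + 2" for t x
    using B1[of "(t, x)"] B2[of "(t, x)"] that by (auto simp: B_def Z_def)
  define d where "d = real CARD('n)"
  have d: "1 \<le> d" by (simp add: d_def Suc_le_eq)
  \<comment> \<open>With these values \<open>\<kappa> + \<theta> \<le> \<eta>\<close>, and the
    matrix mismatch costs \<open>3 * d * \<kappa> = \<theta> / 2\<close>, a quarter of the gain
    \<open>2 * \<theta>\<close> from the reflection.\<close>
  define \<theta> where "\<theta> = \<eta> / 2"
  define \<kappa> where "\<kappa> = \<eta> / (12 * d)"
  have \<kappa>: "0 < \<kappa>" using \<eta> d by (simp add: \<kappa>_def)
  have \<theta>: "0 < \<theta>" using \<eta> by (simp add: \<theta>_def)
  have d\<kappa>: "3 * d * \<kappa> = \<theta> / 2" using d by (simp add: \<kappa>_def \<theta>_def)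
  have "1 * \<kappa> \<le> d * \<kappa>" using d \<kappa> by (intro mult_right_mono) auto
  then have \<kappa>\<theta>: "\<kappa> + \<theta> \<le> \<eta>" using d\<kappa> \<theta> by (simp add: \<theta>_def)
  obtain r0 where r0: "0 < r0"
    "\<And>p p'. p \<in> Z \<Longrightarrow> p' \<in> Z \<Longrightarrow> dist p' p < r0 \<Longrightarrow> dist (q (fst p') (snd p')) (q (fst p) (snd p)) < \<kappa>"
    using compact_uniformly_continuous[OF qZ Z] \<kappa>
    by (fastforce simp: uniformly_continuous_on_def case_prod_unfold)
  \<comment> \<open>Below the distance \<open>r1\<close> the matrix \<open>q\<close> varies by less
    than \<open>\<kappa>\<close>, and the drift difference costs at most
    \<open>2 * B * r1 \<le> \<theta> / 2\<close>.\<close>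
  define r1 where "r1 = Min {1, r0 / 2, \<theta> / (4 * B + 1)}"
  have r1: "0 < r1" "r1 \<le> 1" "r1 < r0"
    using r0(1) \<theta> B0 by (auto simp: r1_def min_less_iff_disj)
  have "r1 \<le> \<theta> / (4 * B + 1)" by (simp add: r1_def)
  then have "r1 * (4 * B + 1) \<le> \<theta>" using B0 by (simp add: pos_le_divide_eq)
  moreover have "r1 * (4 * B + 1) = 2 * (2 * B * r1) + r1" by (simp add: algebra_simps)
  ultimately have r1B: "2 * B * r1 \<le> \<theta> / 2" using r1(1) by linarith
  \<comment> \<open>The second multiple of \<open>M'\<close> defeats the oscillation of
    \<open>u\<close> at the initial time, whatever the datum; the first does so at distance 1 from
    \<open>x1\<close>.\<close>
  define L where "L = 2 * M' + 2 * M' / (t0 - s) + 1"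
  have L: "0 < L" "2 * M' \<le> L" "2 * M' \<le> L * (t0 - s)"
  proof -
    have "0 \<le> 2 * M' / (t0 - s)" using st by (simp add: M'_def)
    then show "0 < L" "2 * M' \<le> L" by (auto simp: L_def M'_def)
    have "2 * M' / (t0 - s) \<le> L" by (simp add: L_def M'_def)
    then show "2 * M' \<le> L * (t0 - s)" using st by (simp add: pos_divide_le_eq)
  qed
  define D where "D = B * norm (mat 1 :: real ^ 'n ^ 'n) + \<kappa> * d + \<theta> + B"
  have D: "0 \<le> D" using B0 \<kappa> \<theta> d by (simp add: D_def)
  define \<omega> where "\<omega> z = (z \<bullet> z) powr (1/4)" for z :: "real ^ 'n"
  \<comment> \<open>The first summand is for the final contradiction, the last one makes the modulus
    exceed the oscillation \<open>2 * M'\<close> of \<open>u\<close> once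
    \<open>norm z \<ge> r1\<close>.\<close>
  define K where "K = 2 / \<theta> * (L + 2 * L * D) + 1 + 2 * M' / (r1\<^sup>2) powr (1/4)"
  have K0: "0 < K" using \<theta> L D r1 by (simp add: K_def M'_def add_nonneg_pos add_pos_nonneg)
  have Kr1: "2 * M' \<le> K * (r1\<^sup>2) powr (1/4)"
  proof -
    have "0 \<le> 2 / \<theta> * (L + 2 * L * D)" using \<theta> L D by simp
    then have "2 * M' / (r1\<^sup>2) powr (1/4) \<le> K" by (simp add: K_def)
    then show ?thesis using r1 by (simp add: pos_divide_le_eq)
  qed
  have K\<theta>: "L + 2 * L * D < K * \<theta> / 2"
  proof -
    have "2 / \<theta> * (L + 2 * L * D) < K"
      using r1 by (simp add: K_def M'_def add_pos_nonneg)
    then show ?thesis using \<theta> by (simp add: field_simps)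
  qed
  have "u t0 x1 - u t0 y1 \<le> K * \<omega> (x1 - y1)"
    if sol: "bounded_classical_solution q b s \<phi> u" and uM: "\<And>t x. s \<le> t \<Longrightarrow> \<bar>u t x\<bar> \<le> M"
      and x1: "norm x1 \<le> \<rho>" for \<phi> u x1 y1
  proof (rule ccontr)
    assume neg: "\<not> ?thesis"
    note uD = bounded_classical_solutionD[OF sol q_sym]
    have diff: "u t x - u t y \<le> 2 * M'" if "s \<le> t" for t x y
      using uM[OF that, of x] uM[OF that, of y] by (auto simp: M'_def)
    \<comment> \<open>With \<open>z = x - y\<close> as variable the domain is a product of compact
      sets and the diagonal is \<open>z = 0\<close>.\<close>
    define \<Phi> where "\<Phi> t x z = u t x - u t (x - z) - K * \<omega> z - L * ((x - x1) \<bullet> (x - x1)) - L * (t0 - t)"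
      for t x z
    define \<Omega> where "\<Omega> = {s..t0} \<times> cball x1 1 \<times> cball (0 :: real ^ 'n) r1"
    have \<Omega>: "compact \<Omega>" unfolding \<Omega>_def by (intro compact_Times compact_Icc compact_cball)
    have out: "\<Phi> t x z \<le> 0" if t: "t \<in> {s..t0}" and "t = s \<or> norm (x - x1) \<ge> 1 \<or> norm z \<ge> r1 \<or> z = 0"
      for t x z
    proof -
      have n: "0 \<le> K * \<omega> z" "0 \<le> L * ((x - x1) \<bullet> (x - x1))" "0 \<le> L * (t0 - t)"
        using K0 L t by (auto simp: \<omega>_def)
      have du: "u t x - u t (x - z) \<le> 2 * M'" using t by (intro diff) auto
      from that(2) consider "t = s" | "norm (x - x1) \<ge> 1" | "norm z \<ge> r1" | "z = 0" by blast
      then show ?thesis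
      proof cases
        case 1
        then have "2 * M' \<le> L * (t0 - t)" using L by simp
        then show ?thesis using n du unfolding \<Phi>_def by linarith
      next
        case 2
        then have "1 \<le> (norm (x - x1))\<^sup>2" by (simp add: one_le_power)
        then have "L * 1 \<le> L * ((x - x1) \<bullet> (x - x1))"
          using L by (intro mult_left_mono) (auto simp: power2_norm_eq_inner)
        then show ?thesis using n du L unfolding \<Phi>_def by linarith
      next
        case 3
        then have "r1\<^sup>2 \<le> (norm z)\<^sup>2" using r1 by (intro power_mono) auto
        then have "(r1\<^sup>2) powr (1/4) \<le> \<omega> z"
          unfolding \<omega>_def by (intro powr_mono2) (auto simp: power2_norm_eq_inner)
        then have "K * (r1\<^sup>2) powr (1/4) \<le> K * \<omega> z" using K0 by (intro mult_left_mono) auto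
        then show ?thesis using n du Kr1 unfolding \<Phi>_def by linarith
      next
        case 4
        then have "u t x - u t (x - z) = 0" by simp
        then show ?thesis using n unfolding \<Phi>_def by linarith
      qed
    qed
    have start: "0 < \<Phi> t0 x1 (x1 - y1)" using neg by (simp add: \<Phi>_def)
    \<comment> \<open>Positivity at the starting point forces \<open>norm (x1 - y1) < r1\<close>, so
      distant pairs are covered too.\<close>
    then have in\<Omega>: "(t0, x1, x1 - y1) \<in> \<Omega>"
      using out[of t0 x1 "x1 - y1"] st by (force simp: \<Omega>_def not_le)
    have cont: "continuous_on \<Omega> (\<lambda>p. \<Phi> (fst p) (fst (snd p)) (snd (snd p)))"
    proof -
      have 1: "continuous_on \<Omega> (\<lambda>p. u (fst p) (f p))" if "continuous_on \<Omega> f" for f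
      proof -
        have a: "continuous_on \<Omega> (\<lambda>p. (fst p, f p))" by (intro continuous_intros that)
        have b: "(\<lambda>p. (fst p, f p)) ` \<Omega> \<subseteq> {s..} \<times> UNIV" by (auto simp: \<Omega>_def)
        from continuous_on_compose2[OF uD(2) a b] show ?thesis by simp
      qed
      show ?thesis unfolding \<Phi>_def \<omega>_def
        by (intro continuous_intros 1 quarter_power_continuous)
    qed
    obtain p where p: "p \<in> \<Omega>" "\<And>z. z \<in> \<Omega> \<Longrightarrow>
        \<Phi> (fst z) (fst (snd z)) (snd (snd z)) \<le> \<Phi> (fst p) (fst (snd p)) (snd (snd p))"
      using continuous_attains_sup[OF \<Omega> _ cont] in\<Omega> by blast
    obtain t x z where pe: "p = (t, x, z)" by (cases p)
    define y where "y = x - z"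
    have z: "z = x - y" by (simp add: y_def)
    have tI: "t \<in> {s..t0}" using p(1) pe by (auto simp: \<Omega>_def)
    have pos: "0 < \<Phi> t x z" using p(2)[OF in\<Omega>] start pe by simp
    have max: "\<Phi> r x' z' \<le> \<Phi> t x z" if "r \<in> {s..t0}" for r x' z'
    proof (cases "(r, x', z') \<in> \<Omega>")
      case True
      then show ?thesis using p(2)[OF True] pe by simp
    next
      case False
      then have "norm (x' - x1) \<ge> 1 \<or> norm z' \<ge> r1"
        using that by (auto simp: \<Omega>_def dist_norm norm_minus_commute)
      then show ?thesis using out[OF that, of x' z'] pos by linarith
    qed
    have inner: "s < t" "norm (x - x1) < 1" "norm z < r1" "z \<noteq> 0"
    proof -
      have "\<not> (t = s \<or> norm (x - x1) \<ge> 1 \<or> norm z \<ge> r1 \<or> z = 0)"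
        using out[OF tI, of x z] pos by linarith
      then show "s < t" "norm (x - x1) < 1" "norm z < r1" "z \<noteq> 0" using tI by auto
    qed
    have xy: "x \<noteq> y" using inner by (simp add: y_def)
    have nx: "norm x \<le> \<rho> + 1"
      using norm_triangle_ineq[of "x - x1" x1] inner x1 by simp
    have ny: "norm y \<le> \<rho> + 2"
      using norm_triangle_ineq4[of x z] nx inner r1 by (simp add: y_def)
    have xZ: "(t, x) \<in> Z" "(t, y) \<in> Z" using nx ny tI by (auto simp: Z_def)
    define Lx where "Lx = q t x \<bullet> hess (u t) x + b t x \<bullet> grad (u t) x"
    define Ly where "Ly = q t y \<bullet> hess (u t) y + b t y \<bullet> grad (u t) y"
    have dt: "((\<lambda>r. \<Phi> r x z) has_real_derivative Lx - Ly + L) (at t)"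
    proof -
      have "((\<lambda>r. u r x - u r y - K * \<omega> z - L * ((x - x1) \<bullet> (x - x1)) - L * (t0 - r))
          has_real_derivative Lx - Ly - 0 - 0 - L * (0 - 1)) (at t)"
        unfolding Lx_def Ly_def
        by (intro DERIV_diff DERIV_cmult uD(4) inner(1) DERIV_const DERIV_ident)
      then show ?thesis by (simp add: \<Phi>_def y_def)
    qed
    \<comment> \<open>The maximum may lie at \<open>t = t0\<close>; comparison with earlier times
      gives the sign of the time derivative.\<close>
    have "0 \<le> Lx - Ly + L"
    proof (rule ccontr)
      assume "\<not> ?thesis"
      then have "Lx - Ly + L < 0" by simp
      from DERIV_neg_dec_left[OF dt this] obtain e where
        e: "e > 0" "\<And>h. h > 0 \<Longrightarrow> h < e \<Longrightarrow> \<Phi> t x z < \<Phi> (t - h) x z" by blast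
      define h where "h = min e (t - s) / 2"
      have "0 < h" "h < e" "t - h \<in> {s..t0}"
        using e(1) inner(1) tI by (auto simp: h_def min_def field_simps)
      then show False using e(2)[of h] max[of "t - h" x z] by auto
    qed
    moreover have "Lx - Ly + L < 0"
    proof -
      define S where "S = 1/2 * ((x - y) \<bullet> (x - y)) powr (-3/4)"
      have zz: "0 < z \<bullet> z" "z \<bullet> z \<le> 1"
      proof -
        show "0 < z \<bullet> z" using inner by simp
        have "(norm z)\<^sup>2 \<le> 1" using inner r1 by (intro power_le_one) auto
        then show "z \<bullet> z \<le> 1" by (simp add: power2_norm_eq_inner)
      qed
      have S: "1/2 \<le> S"
        using powr_mono2'[of "-3/4" "z \<bullet> z" 1] zz by (simp add: S_def z[symmetric])
      have spatial: "u t x' - u t y' - K * ((x' - y') \<bullet> (x' - y')) powr (1/4) - L * ((x' - x1) \<bullet> (x' - x1))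
         \<le> u t x - u t y - K * ((x - y) \<bullet> (x - y)) powr (1/4) - L * ((x - x1) \<bullet> (x - x1))" for x' y'
        using max[OF tI, of x' "x' - y'"] by (simp add: \<Phi>_def \<omega>_def z)
      note dm = doubled_max[OF uD(3)[OF inner(1)] uD(3)[OF inner(1)] xy spatial, folded S_def]
      have "q t x \<bullet> hess (u t) x - q t y \<bullet> hess (u t) y \<le> K * S * (3 * CARD('n) * \<kappa> - 2 * \<theta>)
          + 2 * L * (trace (q t x) + \<kappa> * CARD('n) + \<theta>)"
      proof (rule coupling_estimate[where z = "x - y"])
        show "x - y \<noteq> 0" using xy by simp
        show "0 \<le> S" using S by simp
        show "0 \<le> K" "0 \<le> L" "0 \<le> \<kappa>" "0 \<le> \<theta>" using K0 L \<kappa> \<theta> by auto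
        show "transpose (q t x) = q t x" "transpose (q t y) = q t y" by (rule q_sym)+
        show "(\<kappa> + \<theta>) * (norm \<xi>)\<^sup>2 \<le> (q t x *v \<xi>) \<bullet> \<xi>" for \<xi>
          using mult_right_mono[OF \<kappa>\<theta>, of "(norm \<xi>)\<^sup>2"] ell[of \<xi> t x] by simp
        show "\<bar>((q t y - q t x) *v \<xi>) \<bullet> \<xi>\<bar> \<le> \<kappa> * (norm \<xi>)\<^sup>2" for \<xi>
        proof -
          have "dist (t, y) (t, x) < r0"
            using inner r1 by (simp add: dist_Pair_Pair dist_norm y_def)
          then have "norm (q t y - q t x) \<le> \<kappa>"
            using r0(2)[OF xZ] by (simp add: dist_norm)
          then show ?thesis
            using abs_inner_matrix_vector_le[of "q t y - q t x" \<xi>]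
            by (meson mult_right_mono order_trans zero_le_power2)
        qed
        show "(hess (u t) x *v \<xi>) \<bullet> \<xi> - (hess (u t) y *v \<zeta>) \<bullet> \<zeta>
          \<le> K * (S * ((\<xi> - \<zeta>) \<bullet> (\<xi> - \<zeta>)) - 3 / 2 * S * ((x - y) \<bullet> (\<xi> - \<zeta>))\<^sup>2 / ((x - y) \<bullet> (x - y)))
            + 2 * L * (\<xi> \<bullet> \<xi>)" for \<xi> \<zeta>
          by (rule dm(3))
      qed
      moreover have "3 * real CARD('n) * \<kappa> - 2 * \<theta> = - (3/2) * \<theta>" using d\<kappa> by (simp add: d_def)
      then have "K * S * (3 * real CARD('n) * \<kappa> - 2 * \<theta>) = - (3/2) * (K * S * \<theta>)" by simp
      ultimately have A2: "q t x \<bullet> hess (u t) x - q t y \<bullet> hess (u t) y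
          \<le> - (3/2) * (K * S * \<theta>) + 2 * L * (trace (q t x) + \<kappa> * d + \<theta>)"
        unfolding d_def by (simp only: of_nat_mult of_nat_numeral mult.commute[of \<kappa>])
      have "b t x \<bullet> grad (u t) x - b t y \<bullet> grad (u t) y
          = K * S * ((b t x - b t y) \<bullet> z) + 2 * L * (b t x \<bullet> (x - x1))"
        by (simp add: dm(1,2) z inner_add_right inner_diff_left algebra_simps)
      also have "(b t x - b t y) \<bullet> z \<le> \<theta> / 2"
      proof -
        have "(b t x - b t y) \<bullet> z \<le> norm (b t x - b t y) * norm z" by (rule norm_cauchy_schwarz)
        also have "\<dots> \<le> (2 * B) * r1"
        proof (intro mult_mono)
          show "norm (b t x - b t y) \<le> 2 * B"
            using norm_triangle_ineq4[of "b t x" "b t y"] bB[OF tI, of x] bB[OF tI, of y] nx ny by linarith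
        qed (use inner B0 in auto)
        finally show ?thesis using r1B by simp
      qed
      also have "b t x \<bullet> (x - x1) \<le> B"
      proof -
        have "b t x \<bullet> (x - x1) \<le> norm (b t x) * norm (x - x1)" by (rule norm_cauchy_schwarz)
        also have "\<dots> \<le> B * 1" using bB[OF tI, of x] nx inner B0 by (intro mult_mono) auto
        finally show ?thesis by simp
      qed
      finally have A1: "b t x \<bullet> grad (u t) x - b t y \<bullet> grad (u t) y \<le> K * S * (\<theta> / 2) + 2 * L * B"
        using K0 S L by (simp add: mult_left_mono)
      have "trace (q t x) \<le> B * norm (mat 1 :: real ^ 'n ^ 'n)"
      proof -
        have "trace (q t x) \<le> norm (q t x) * norm (mat 1 :: real ^ 'n ^ 'n)"
          unfolding trace_eq_inner by (rule norm_cauchy_schwarz)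
        also have "\<dots> \<le> B * norm (mat 1 :: real ^ 'n ^ 'n)"
          using qB[OF tI, of x] nx by (intro mult_right_mono) auto
        finally show ?thesis .
      qed
      then have "2 * L * (trace (q t x) + \<kappa> * d + \<theta> + B) \<le> 2 * L * D"
        using L by (intro mult_left_mono) (auto simp: D_def)
      moreover have "K * (1/2) * \<theta> \<le> K * S * \<theta>"
        using K0 S \<theta> by (intro mult_right_mono mult_left_mono) auto
      \<comment> \<open>The diffusion gains \<open>3/2 * (K * S * \<theta>)\<close> and the drift
        spends a third of it. As \<open>S \<ge> 1/2\<close>, what remains is at least
        \<open>K * \<theta> / 2\<close>, which exceeds \<open>L + 2 * L * D\<close>.\<close>
      ultimately show ?thesis
        using A1 A2 K\<theta> by (simp add: Lx_def Ly_def algebra_simps)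
    qed
    ultimately show False by linarith
  qed
  then show ?thesis unfolding \<omega>_def by blast
qed

section \<open>Compactness\<close>

text \<open>A set that is not totally bounded contains, by greedy choice, an infinite separated
  sequence. With this criterion no limit in the space of bounded continuous functions has to be
  constructed.\<close>

lemma compact_closure_if_no_separated_sequence:
  fixes S :: "'a::complete_space set"
  assumes "\<And>\<epsilon> f. 0 < \<epsilon> \<Longrightarrow> (\<And>n::nat. f n \<in> S) \<Longrightarrow> \<exists>m n. m < n \<and> dist (f m) (f n) < \<epsilon>"
  shows "compact (closure S)"
  unfolding compact_eq_totally_bounded
proof (intro conjI allI impI)
  show "complete (closure S)" by (simp add: complete_eq_closed)
  fix e :: real assume "0 < e"
  then have e: "0 < e / 2" by simp
  have "\<exists>k. finite k \<and> S \<subseteq> (\<Union>x\<in>k. ball x (e / 2))"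
  proof (rule ccontr)
    assume no: "\<not> ?thesis"
    let ?Q = "\<lambda>x n r. r \<in> S \<and> (\<forall>m < (n::nat). \<not> dist (x m) r < e / 2)"
    have "\<exists>x. \<forall>n::nat. ?Q x n (x n)"
    proof (rule dependent_wellorder_choice)
      fix n and x :: "nat \<Rightarrow> 'a"
      have "\<not> S \<subseteq> (\<Union>x\<in>x ` {0..<n}. ball x (e / 2))"
        using no by blast
      then show "\<exists>r. ?Q x n r" unfolding subset_eq by auto
    qed simp
    then obtain f where f: "\<And>n::nat. ?Q f n (f n)" by blast
    then show False using assms[OF e, of f] by blast
  qed
  then obtain k where k: "finite k" "S \<subseteq> (\<Union>x\<in>k. ball x (e / 2))" by blast
  have "closure S \<subseteq> (\<Union>x\<in>k. cball x (e / 2))"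
  proof (rule closure_minimal)
    show "S \<subseteq> (\<Union>x\<in>k. cball x (e / 2))" using k(2) ball_subset_cball by blast
    show "closed (\<Union>x\<in>k. cball x (e / 2))" using k(1) by blast
  qed
  also have "\<dots> \<subseteq> (\<Union>x\<in>k. ball x e)" using \<open>0 < e\<close> by force
  finally show "\<exists>k. finite k \<and> closure S \<subseteq> (\<Union>x\<in>k. ball x e)" using k(1) by blast
qed

lemma integrable_bcontfun:
  fixes \<phi> :: "'a::euclidean_space \<Rightarrow>\<^sub>C real"
  assumes "prob_space P" "sets P = sets borel"
  shows "integrable P (apply_bcontfun \<phi>)"
proof -
  interpret prob_space P by (fact assms(1))
  have "apply_bcontfun \<phi> \<in> borel_measurable P"
    using borel_measurable_continuous_onI[OF continuous_on_apply_bcontfun]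
      measurable_cong_sets[OF assms(2) refl] by blast
  then show ?thesis
    by (rule integrable_const_bound[rotated]) (use norm_bounded[of \<phi>] in auto)
qed

text \<open>Closeness on a ball suffices up to the mass outside it; the bound is the same for all
  measures of a tight family.\<close>

lemma abs_integral_bcontfun_le:
  fixes \<phi> \<psi> :: "'a::euclidean_space \<Rightarrow>\<^sub>C real"
  assumes P: "prob_space P" "sets P = sets borel" and B: "0 \<le> B" and c: "0 \<le> c"
    and mass: "1 - \<epsilon> \<le> measure P (ball 0 \<rho>)"
    and near: "\<And>y. norm y \<le> \<rho> \<Longrightarrow> \<bar>apply_bcontfun \<phi> y - apply_bcontfun \<psi> y\<bar> \<le> c"
    and all: "\<And>y. \<bar>apply_bcontfun \<phi> y - apply_bcontfun \<psi> y\<bar> \<le> B"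
  shows "\<bar>(\<integral>y. apply_bcontfun \<phi> y \<partial>P) - (\<integral>y. apply_bcontfun \<psi> y \<partial>P)\<bar> \<le> c + B * \<epsilon>"
proof -
  interpret prob_space P by (fact P(1))
  have sp: "space P = UNIV" using sets_eq_imp_space_eq[OF P(2)] by simp
  have m: "- ball 0 \<rho> \<in> sets P" by (simp add: P(2))
  note int = integrable_bcontfun[OF P]
  have "\<bar>(\<integral>y. apply_bcontfun \<phi> y \<partial>P) - (\<integral>y. apply_bcontfun \<psi> y \<partial>P)\<bar>
      = \<bar>\<integral>y. apply_bcontfun \<phi> y - apply_bcontfun \<psi> y \<partial>P\<bar>"
    by (simp add: int)
  also have "\<dots> \<le> (\<integral>y. \<bar>apply_bcontfun \<phi> y - apply_bcontfun \<psi> y\<bar> \<partial>P)"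
    by (rule integral_abs_bound)
  also have "\<dots> \<le> (\<integral>y. c + B * indicator (- ball 0 \<rho>) y \<partial>P)"
  proof (rule integral_mono)
    show "integrable P (\<lambda>y. \<bar>apply_bcontfun \<phi> y - apply_bcontfun \<psi> y\<bar>)" using int by simp
    show "integrable P (\<lambda>y. c + B * indicator (- ball 0 \<rho>) y)"
      using m by (intro Bochner_Integration.integrable_add integrable_mult_right integrable_real_indicator)
        (auto simp: emeasure_eq_measure)
    show "\<bar>apply_bcontfun \<phi> y - apply_bcontfun \<psi> y\<bar> \<le> c + B * indicator (- ball 0 \<rho>) y" for y
      using near[of y] all[of y] c by (cases "norm y < \<rho>") auto
  qed
  also have "\<dots> = c + B * measure P (- ball 0 \<rho>)"
    using m by (subst Bochner_Integration.integral_add) (auto simp: emeasure_eq_measure prob_space)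
  also have "measure P (- ball 0 \<rho>) = 1 - measure P (ball 0 \<rho>)"
    using prob_compl[of "ball 0 \<rho>"] by (simp add: P(2) sp Compl_eq_Diff_UNIV)
  also have "c + B * (1 - measure P (ball 0 \<rho>)) \<le> c + B * \<epsilon>"
    using mass B by (intro add_left_mono mult_left_mono) auto
  finally show ?thesis .
qed

lemma linear_evolution:
  assumes p: "transition_measures G p" and st: "s < t"
  shows "linear (G t s)"
proof -
  have P: "prob_space (p t s x)" "sets (p t s x) = sets borel"
    and pG: "apply_bcontfun (G t s \<phi>) x = (\<integral>y. apply_bcontfun \<phi> y \<partial>(p t s x))" for x \<phi>
    using p st unfolding transition_measures_def by blast+
  show ?thesis
  proof
    show "G t s (\<phi> + \<psi>) = G t s \<phi> + G t s \<psi>" for \<phi> \<psi>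
      by (intro bcontfun_eqI) (simp add: pG integrable_bcontfun[OF P])
    show "G t s (c *\<^sub>R \<phi>) = c *\<^sub>R G t s \<phi>" for c \<phi>
      by (intro bcontfun_eqI) (simp add: pG)
  qed
qed

context lyapunov_setting
begin

text \<open>As functions of \<open>t\<close> both sides are bounded classical solutions that agree
  at \<open>t = r\<close>.\<close>

lemma evolution_law:
  assumes G: "evolution_operator q b G" and "s \<le> r" "r \<le> t"
  shows "G t s \<phi> = G t r (G r s \<phi>)"
proof (rule bcontfun_eqI)
  fix x
  have sol: "bounded_classical_solution q b s \<phi> (\<lambda>t x. apply_bcontfun (G t s \<phi>) x)" for s \<phi>
    using G unfolding evolution_operator_def by blast
  show "apply_bcontfun (G t s \<phi>) x = apply_bcontfun (G t r (G r s \<phi>)) x"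
    using solution_unique[OF sol \<open>s \<le> r\<close> sol order_refl]
      bounded_classical_solutionD(5)[OF sol q_sym] \<open>r \<le> t\<close> by metis
qed

text \<open>For \<open>s < r < t\<close> the operator \<open>G r s\<close> maps bounded sets to locally equicontinuous ones, and
  by tightness the sup norm of \<open>G t r \<psi>\<close> is controlled by the values of \<open>\<psi>\<close> on a ball.\<close>

lemma compact_evolution:
  assumes G: "evolution_operator q b G" and p: "transition_measures G p"
    and \<eta>: "0 < \<eta>" and ell: "\<And>s x \<xi>. \<eta> * (norm \<xi>)\<^sup>2 \<le> (q s x *v \<xi>) \<bullet> \<xi>"
    and q_cont: "continuous_on UNIV (\<lambda>(s, x). q s x)"
    and b_cont: "continuous_on UNIV (\<lambda>(s, x). b s x)"
    and tight: "\<And>\<delta>. 0 < \<delta> \<Longrightarrow> tight_family {p t s x | t s x. s \<le> t - \<delta>}"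
    and st: "s < t"
  shows "compact_operator (G t s)"
  unfolding compact_operator_def
proof (intro conjI allI impI)
  show "linear (G t s)" by (rule linear_evolution[OF p st])
  fix A :: "((real ^ 'n) \<Rightarrow>\<^sub>C real) set" assume "bounded A"
  then obtain M where M: "\<And>\<phi>. \<phi> \<in> A \<Longrightarrow> norm \<phi> \<le> M" by (auto simp: bounded_iff)
  define r where "r = (s + t) / 2"
  have r: "s < r" "r < t" using st by (auto simp: r_def)
  have sol: "bounded_classical_solution q b s \<phi> (\<lambda>t x. apply_bcontfun (G t s \<phi>) x)" for s \<phi>
    using G unfolding evolution_operator_def by blast
  have P: "prob_space (p t s x)" "sets (p t s x) = sets borel"
    and pG: "apply_bcontfun (G t s \<phi>) x = (\<integral>y. apply_bcontfun \<phi> y \<partial>(p t s x))" if "s < t" for t s x \<phi>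
    using p that unfolding transition_measures_def by blast+
  \<comment> \<open>The case \<open>s = t\<close> is separate, because the measures represent
    \<open>G t s\<close> for \<open>s < t\<close> only.\<close>
  have GM: "\<bar>apply_bcontfun (G t s \<phi>) x\<bar> \<le> M" if \<phi>: "\<phi> \<in> A" and t: "s \<le> t" for t \<phi> x
  proof (cases "s = t")
    case True
    then show ?thesis
      using bounded_classical_solutionD(5)[OF sol q_sym, of s \<phi> x] norm_bounded[of \<phi> x] M[OF \<phi>] by simp
  next
    case False
    then have lt: "s < t" using t by simp
    interpret prob_space "p t s x" by (rule P[OF lt])
    have "\<bar>\<integral>y. apply_bcontfun \<phi> y \<partial>(p t s x)\<bar> \<le> (\<integral>y. \<bar>apply_bcontfun \<phi> y\<bar> \<partial>(p t s x))"
      by (rule integral_abs_bound)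
    also have "\<dots> \<le> (\<integral>y. M \<partial>(p t s x))"
    proof (rule integral_mono)
      show "\<bar>apply_bcontfun \<phi> y\<bar> \<le> M" for y
        using norm_bounded[of \<phi> y] M[OF \<phi>] by simp
    qed (use integrable_bcontfun[OF P[OF lt]] in auto)
    also have "\<dots> = M" by (simp add: prob_space)
    finally show ?thesis by (simp add: pG[OF lt])
  qed
  show "compact (closure (G t s ` A))"
  proof (rule compact_closure_if_no_separated_sequence)
    fix \<epsilon> :: real and f :: "nat \<Rightarrow> (real ^ 'n) \<Rightarrow>\<^sub>C real"
    assume \<epsilon>: "0 < \<epsilon>" and f: "\<And>n. f n \<in> G t s ` A"
    define \<phi> where "\<phi> n = (SOME \<phi>. \<phi> \<in> A \<and> f n = G t s \<phi>)" for n
    have \<phi>: "\<phi> n \<in> A" "f n = G t s (\<phi> n)" for n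
      using f[of n] someI_ex[of "\<lambda>\<phi>. \<phi> \<in> A \<and> f n = G t s \<phi>"] unfolding \<phi>_def by blast+
    define \<psi> where "\<psi> n = G r s (\<phi> n)" for n
    have \<psi>M: "\<bar>apply_bcontfun (\<psi> n) x\<bar> \<le> M" for n x
      unfolding \<psi>_def using r by (intro GM \<phi>) auto
    have M0: "0 \<le> M" using \<psi>M[of 0 0] by linarith
    have f\<psi>: "f n = G t r (\<psi> n)" for n
      unfolding \<phi>(2) \<psi>_def using r by (intro evolution_law[OF G]) auto
    \<comment> \<open>The mass outside the ball then contributes at most
      \<open>2 * M * \<epsilon>' \<le> \<epsilon> / 4\<close>; the summand 8 covers
      \<open>M = 0\<close>.\<close>
    define \<epsilon>' where "\<epsilon>' = \<epsilon> / (8 * M + 8)"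
    have \<epsilon>': "0 < \<epsilon>'" using \<epsilon> M0 by (simp add: \<epsilon>'_def)
    obtain \<rho> where \<rho>: "0 < \<rho>" "\<And>x. 1 - \<epsilon>' \<le> measure (p t r x) (ball 0 \<rho>)"
    proof -
      have "0 < t - r" using r by simp
      from tight[OF this] \<epsilon>' obtain \<rho> where \<rho>: "\<rho> > 0"
        "\<forall>P\<in>{p t' s x | t' s x. s \<le> t' - (t - r)}. 1 - \<epsilon>' \<le> measure P (ball 0 \<rho>)"
        unfolding tight_family_def by blast
      have "p t r x \<in> {p t' s x | t' s x. s \<le> t' - (t - r)}" for x by force
      with \<rho> that show thesis by blast
    qed
    obtain K where K: "\<And>\<phi> u x y. bounded_classical_solution q b s \<phi> u \<Longrightarrow> (\<forall>t\<ge>s. \<forall>x. \<bar>u t x\<bar> \<le> M) \<Longrightarrow>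
        norm x \<le> \<rho> \<Longrightarrow> u r x - u r y \<le> K * ((x - y) \<bullet> (x - y)) powr (1/4)"
      using interior_Holder[OF q_sym \<eta> ell q_cont b_cont r(1), of M \<rho>] by blast
    have Hol: "\<bar>apply_bcontfun (\<psi> n) x - apply_bcontfun (\<psi> n) y\<bar> \<le> K * ((x - y) \<bullet> (x - y)) powr (1/4)"
      if "norm x \<le> \<rho>" "norm y \<le> \<rho>" for n x y
    proof -
      have b: "\<forall>t\<ge>s. \<forall>x. \<bar>apply_bcontfun (G t s (\<phi> n)) x\<bar> \<le> M" using GM \<phi>(1) by blast
      have "(y - x) \<bullet> (y - x) = (x - y) \<bullet> (x - y)"
        by (simp add: inner_diff_left inner_diff_right inner_commute)
      then show ?thesis
        using K[OF sol b that(1), of y] K[OF sol b that(2), of x] by (simp add: \<psi>_def abs_le_iff)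
    qed
    obtain g k where k: "strict_mono (k :: nat \<Rightarrow> nat)" and
      lim: "\<And>e. 0 < e \<Longrightarrow> \<exists>N. \<forall>n x. n \<ge> N \<and> x \<in> cball 0 \<rho> \<longrightarrow> norm (apply_bcontfun (\<psi> (k n)) x - g x) < e"
    proof (rule Arzela_Ascoli[of "cball 0 \<rho>" "\<lambda>n. apply_bcontfun (\<psi> n)" M])
      show "compact (cball (0 :: real ^ 'n) \<rho>)" by simp
      show "norm (apply_bcontfun (\<psi> n) x) \<le> M" for n x using \<psi>M by simp
      fix x :: "real ^ 'n" and e :: real assume x: "x \<in> cball 0 \<rho>" and e: "0 < e"
      have "continuous_on UNIV (\<lambda>y. K * ((x - y) \<bullet> (x - y)) powr (1/4))"
        by (intro continuous_intros quarter_power_continuous)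
      then obtain d where d: "0 < d" "\<And>y. dist y x < d \<Longrightarrow>
          dist (K * ((x - y) \<bullet> (x - y)) powr (1/4)) (K * ((x - x) \<bullet> (x - x)) powr (1/4)) < e"
        unfolding continuous_on_iff using e by (metis UNIV_I)
      show "\<exists>d>0. \<forall>n y. y \<in> cball 0 \<rho> \<and> norm (x - y) < d \<longrightarrow>
          norm (apply_bcontfun (\<psi> n) x - apply_bcontfun (\<psi> n) y) < e"
      proof (intro exI[of _ d] conjI allI impI d(1))
        fix n y assume y: "y \<in> cball 0 \<rho> \<and> norm (x - y) < d"
        have "K * ((x - y) \<bullet> (x - y)) powr (1/4) < e"
          using d(2)[of y] y by (simp add: dist_norm norm_minus_commute abs_less_iff)
        then show "norm (apply_bcontfun (\<psi> n) x - apply_bcontfun (\<psi> n) y) < e"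
          using Hol[of x y n] x y by simp
      qed
    qed blast
    obtain N where N: "\<And>n x. n \<ge> N \<Longrightarrow> norm x \<le> \<rho> \<Longrightarrow> \<bar>apply_bcontfun (\<psi> (k n)) x - g x\<bar> < \<epsilon> / 8"
      using lim[of "\<epsilon> / 8"] \<epsilon> by auto
    \<comment> \<open>Both terms are within \<open>\<epsilon> / 8\<close> of the limit
      \<open>g\<close> on the ball, hence within \<open>\<epsilon> / 4\<close> of each other
      there.\<close>
    define m n where "m = k N" and "n = k (Suc N)"
    have mn: "m < n" using k by (simp add: m_def n_def strict_mono_def)
    have "dist (apply_bcontfun (f m) x) (apply_bcontfun (f n) x) \<le> \<epsilon> / 2" for x
    proof -
      have "\<bar>(\<integral>y. apply_bcontfun (\<psi> m) y \<partial>(p t r x)) - (\<integral>y. apply_bcontfun (\<psi> n) y \<partial>(p t r x))\<bar>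
          \<le> \<epsilon> / 4 + (2 * M) * \<epsilon>'"
      proof (rule abs_integral_bcontfun_le[OF P[OF r(2)] _ _ \<rho>(2)])
        show "\<bar>apply_bcontfun (\<psi> m) y - apply_bcontfun (\<psi> n) y\<bar> \<le> \<epsilon> / 4" if "norm y \<le> \<rho>" for y
          using N[of N y] N[of "Suc N" y] that unfolding m_def n_def by linarith
        show "\<bar>apply_bcontfun (\<psi> m) y - apply_bcontfun (\<psi> n) y\<bar> \<le> 2 * M" for y
          using \<psi>M[of m y] \<psi>M[of n y] by (simp add: abs_le_iff)
      qed (use M0 \<epsilon> in auto)
      also have "(2 * M) * \<epsilon>' \<le> \<epsilon> / 4"
        using M0 \<epsilon> by (simp add: \<epsilon>'_def field_simps)
      finally show ?thesis by (simp add: f\<psi> pG[OF r(2)] dist_real_def)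
    qed
    then have "dist (f m) (f n) \<le> \<epsilon> / 2" by (rule dist_bound)
    then show "\<exists>m n. m < n \<and> dist (f m) (f n) < \<epsilon>" using mn \<epsilon> by (intro exI[of _ m] exI[of _ n]) auto
  qed
qed

end

lemma continuous_on_matrix_field:
  assumes "\<And>i j. parabolic_Holder_loc \<alpha> (\<lambda>s x. q s x $ i $ j)"
  shows "continuous_on UNIV (\<lambda>(s, x). q s x :: real ^ 'n ^ 'm)"
proof -
  have "continuous_on UNIV (\<lambda>p. q (fst p) (snd p) $ i $ j)" for i j
    using assms[of i j] by (simp add: parabolic_Holder_loc_def case_prod_unfold)
  then have "continuous_on UNIV (\<lambda>p. \<chi> i j. q (fst p) (snd p) $ i $ j)"
    by (intro continuous_on_vec_lambda)
  then show ?thesis by (simp add: case_prod_unfold)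
qed

lemma continuous_on_vector_field:
  assumes "\<And>i. parabolic_Holder_loc \<alpha> (\<lambda>s x. b s x $ i)"
  shows "continuous_on UNIV (\<lambda>(s, x). b s x :: real ^ 'm)"
proof -
  have "continuous_on UNIV (\<lambda>p. b (fst p) (snd p) $ i)" for i
    using assms[of i] by (simp add: parabolic_Holder_loc_def case_prod_unfold)
  then have "continuous_on UNIV (\<lambda>p. \<chi> i. b (fst p) (snd p) $ i)"
    by (intro continuous_on_vec_lambda)
  then show ?thesis by (simp add: case_prod_unfold)
qed

theorem theorem3p3:
  fixes q :: "real \<Rightarrow> real ^ 'n \<Rightarrow> real ^ 'n ^ 'n"
    and b :: "real \<Rightarrow> real ^ 'n \<Rightarrow> real ^ 'n"
    and \<eta> :: "real \<Rightarrow> real ^ 'n \<Rightarrow> real"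
    and W\<^sub>0 W :: "real ^ 'n \<Rightarrow> real"
    and g :: "real \<Rightarrow> real"
    and \<alpha> lam R :: real
    and G :: "real \<Rightarrow> real \<Rightarrow> ((real ^ 'n) \<Rightarrow>\<^sub>C real) \<Rightarrow> ((real ^ 'n) \<Rightarrow>\<^sub>C real)"
    and p :: "real \<Rightarrow> real \<Rightarrow> real ^ 'n \<Rightarrow> (real ^ 'n) measure"
  assumes alpha: "0 < \<alpha>" "\<alpha> < 1"
    and q_Holder: "\<And>i j. parabolic_Holder_loc \<alpha> (\<lambda>s x. q s x $ i $ j)"
    and b_Holder: "\<And>i. parabolic_Holder_loc \<alpha> (\<lambda>s x. b s x $ i)"
    and q_sym: "\<And>s x. transpose (q s x) = q s x"
    and eta_pos: "(INF s. INF x. ereal (\<eta> s x)) > 0"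
    and elliptic: "\<And>s x \<xi>. (q s x *v \<xi>) \<bullet> \<xi> \<ge> \<eta> s x * (norm \<xi>)\<^sup>2"
    and W0_pos: "\<And>x. W\<^sub>0 x > 0"
    and W0_C2: "C2_fun W\<^sub>0"
    and W0_lim: "filterlim W\<^sub>0 at_top at_infinity"
    and W0_Lyapunov: "(SUP s. SUP x. ereal (ell_op q b s W\<^sub>0 x - lam * W\<^sub>0 x)) < 0"
    and G: "evolution_operator q b G"
    and p: "transition_measures G p"
    and W_C2: "C2_fun W"
    and W_lim: "filterlim W at_top at_infinity"
    and R_pos: "R > 0"
    and W_nonneg: "\<And>x. norm x \<ge> R \<Longrightarrow> W x \<ge> 0"
    and g_convex: "convex_on {0..} g"
    and g_mono: "mono_on {0..} g"
    and g_integrable: "\<forall>\<^sub>F a in at_top.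
          (\<forall>r>a. g r \<noteq> 0) \<and> set_integrable lborel {a<..} (\<lambda>r. 1 / g r)"
    and W_ineq: "\<And>s x. norm x \<ge> R \<Longrightarrow> ell_op q b s W x \<le> - g (W x)"
  shows "(\<forall>\<delta>>0. \<exists>C>0. \<forall>s t x. s \<le> t - \<delta> \<longrightarrow> ext_integral (p t s x) W \<le> ereal C)
       \<and> (\<forall>\<delta>>0. tight_family {p t s x | t s x. s \<le> t - \<delta>})
       \<and> (\<forall>s t. s < t \<longrightarrow> compact_operator (G t s))"
proof -
  \<comment> \<open>A real number strictly between 0 and the infimum is the ellipticity constant
    from here on, so no extended real is carried along.\<close>
  obtain c where c: "0 < ereal c" "ereal c < (INF s. INF x. ereal (\<eta> s x))"
    using ereal_dense2[OF eta_pos] by blast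
  then have c0: "0 < c" by simp
  have c\<eta>: "c \<le> \<eta> s x" for s x
  proof -
    have "ereal c < (INF x. ereal (\<eta> s x))" using c(2) by (rule less_INF_D) simp
    then have "ereal c < ereal (\<eta> s x)" by (rule less_INF_D) simp
    then show ?thesis by simp
  qed
  have ell: "c * (norm \<xi>)\<^sup>2 \<le> (q s x *v \<xi>) \<bullet> \<xi>" for s x \<xi>
    using mult_right_mono[OF c\<eta>[of s x], of "(norm \<xi>)\<^sup>2"] elliptic[where s = s and x = x and \<xi> = \<xi>]
    by simp
  have psd: "0 \<le> (q s x *v \<xi>) \<bullet> \<xi>" for s x \<xi>
    using ell[of \<xi> s x] c0 by (meson mult_nonneg_nonneg less_imp_le order_trans zero_le_power2)
  have lyap: "q s x \<bullet> hess W\<^sub>0 x + b s x \<bullet> grad W\<^sub>0 x \<le> lam * W\<^sub>0 x" for s x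
  proof -
    have "(SUP x. ereal (ell_op q b s W\<^sub>0 x - lam * W\<^sub>0 x)) < 0"
      using W0_Lyapunov by (rule SUP_lessD) simp
    then have "ereal (ell_op q b s W\<^sub>0 x - lam * W\<^sub>0 x) < 0" by (rule SUP_lessD) simp
    then show ?thesis by (simp add: ell_op_eq_inner q_sym)
  qed
  interpret lyapunov_setting q b W\<^sub>0 "grad W\<^sub>0" "hess W\<^sub>0" lam
    by unfold_locales (fact q_sym psd C2_fun_has_grad_hess[OF W0_C2] W0_pos W0_lim lyap)+
  have W_ineq': "q s x \<bullet> hess W x + b s x \<bullet> grad W x \<le> - g (W x)" if "R \<le> norm x" for s x
    using W_ineq[OF that, of s] by (simp add: ell_op_eq_inner q_sym)
  have bound: "\<exists>C>0. \<forall>s t x. s \<le> t - \<delta> \<longrightarrow> (\<integral>\<^sup>+ y. ennreal (W y) \<partial>(p t s x)) \<le> ennreal C"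
    if "0 < \<delta>" for \<delta>
    by (rule nn_integral_transition_le[OF G p C2_fun_has_grad_hess[OF W_C2] W_nonneg
          g_convex g_mono g_integrable W_ineq' that])
  have 1: "\<exists>C>0. \<forall>s t x. s \<le> t - \<delta> \<longrightarrow> ext_integral (p t s x) W \<le> ereal C" if \<delta>: "0 < \<delta>" for \<delta>
  proof -
    obtain C where C: "0 < C" "\<And>s t x. s \<le> t - \<delta> \<Longrightarrow> (\<integral>\<^sup>+ y. ennreal (W y) \<partial>(p t s x)) \<le> ennreal C"
      using bound[OF \<delta>] by blast
    then show ?thesis
      by (intro exI[of _ C] conjI allI impI ext_integral_le_nn_integral) auto
  qed
  have 2: "tight_family {p t s x | t s x. s \<le> t - \<delta>}" if \<delta>: "0 < \<delta>" for \<delta>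
  proof -
    obtain C where C: "0 < C" "\<And>s t x. s \<le> t - \<delta> \<Longrightarrow> (\<integral>\<^sup>+ y. ennreal (W y) \<partial>(p t s x)) \<le> ennreal C"
      using bound[OF \<delta>] by blast
    show ?thesis
    proof (rule tight_family_of_nn_integral[OF _ C(1) _ W_lim])
      fix P assume "P \<in> {p t s x | t s x. s \<le> t - \<delta>}"
      then obtain t s x where P: "P = p t s x" "s \<le> t - \<delta>" by blast
      then have "s < t" using \<delta> by linarith
      then show "prob_space P \<and> sets P = sets borel"
        using p unfolding transition_measures_def P(1) by blast
      show "(\<integral>\<^sup>+ y. ennreal (W y) \<partial>P) \<le> ennreal C" using C(2) P by blast
    qed
  qed
  have 3: "compact_operator (G t s)" if "s < t" for s t
    by (rule compact_evolution[OF G p c0 ell continuous_on_matrix_field[OF q_Holder]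
          continuous_on_vector_field[OF b_Holder] 2 that])
  show ?thesis using 1 2 3 by blast
qed

end
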